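(* For all integers $n\ge 0$ and $k\ge 3$, $$\operatorname{zcl}_k(P^n)=kn-\max\Bigl(\{2^{\nu(n+1)}-1\}\cup\{2^{i+1}-1-k\cdot Z_i(n): i\in S(n)\}\Bigr).$$
   Context: $P^n$ denotes $n$-dimensional real projective space, and all cohomology is with coefficients in $\mathbb{Z}_2=\mathbb{Z}/2$. For a space $X$, $\operatorname{zcl}_k(X)$ is the maximal number of (not necessarily distinct) elements of $\ker(\Delta^*:H^*(X)^{\otimes k}\to H^*(X))$ having nonzero product, where $\Delta^*$ is induced by the diagonal $X\to X^k$ (i.e. it is the iterated cup product). For $X=P^n$ it is known that $$\operatorname{zcl}_k(P^n)=\max\{a_1+\cdots+a_{k-1}:(x_1+x_k)^{a_1}\cdots(x_{k-1}+x_k)^{a_{k-1}}\ne 0\},$$ where $a_1,\dots,a_{k-1}$ are nonnegative integers and the product is taken in $\mathbb{Z}_2[x_1,\ldots,x_k]/(x_1^{n+1},\ldots,x_k^{n+1})$. Write $n=\sum_{j\ge0}\varepsilon_j2^j$ with $\varepsilon_j\in\{0,1\}$ (binary expansion). Then $$Z_i(n)=\sum_{j=0}^i(1-\varepsilon_j)2^j,\qquad S(n)=\{i\ge 1:\varepsilon_i=\varepsilon_{i-1}=1\text{ and }\varepsilon_{i+1}=0\}.$$ For a positive integer $m$, $\nu(m)=\max\{t:2^t\text{ divides }m\}$. *)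

theory Defs
  imports
    "HOL-Homology.Homology"
    "HOL-Algebra.QuotRing"
    "HOL-Library.Z2"
begin

section \<open>Real projective space\<close>

definition antipodal_class :: "(nat \<Rightarrow> real) \<Rightarrow> (nat \<Rightarrow> real) set" where
  "antipodal_class x = {x, \<lambda>i. - x i}"

text \<open>The quotient of the \<open>n\<close>-sphere by the antipodal action, with the quotient topology.\<close>

definition projective_space :: "nat \<Rightarrow> (nat \<Rightarrow> real) set topology" where
  "projective_space n = topology (\<lambda>U. U \<subseteq> antipodal_class ` topspace (nsphere n) \<and>
     openin (nsphere n) {x \<in> topspace (nsphere n). antipodal_class x \<in> U})"

lemma openin_projective_space:
  "openin (projective_space n) U \<longleftrightarrow> U \<subseteq> antipodal_class ` topspace (nsphere n) \<and>
     openin (nsphere n) {x \<in> topspace (nsphere n). antipodal_class x \<in> U}"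
proof -
  let ?S = "nsphere n" and ?q = antipodal_class
  have "istopology (\<lambda>U. U \<subseteq> ?q ` topspace ?S \<and> openin ?S {x \<in> topspace ?S. ?q x \<in> U})"
    unfolding istopology_def
  proof (intro conjI allI impI; (elim conjE)?)
    fix U V
    assume "openin ?S {x \<in> topspace ?S. ?q x \<in> U}" "openin ?S {x \<in> topspace ?S. ?q x \<in> V}"
    then have "openin ?S ({x \<in> topspace ?S. ?q x \<in> U} \<inter> {x \<in> topspace ?S. ?q x \<in> V})"
      by blast
    then show "openin ?S {x \<in> topspace ?S. ?q x \<in> U \<inter> V}"
      by (rule back_subst) blast
  next
    fix \<K>
    assume "\<forall>K\<in>\<K>. K \<subseteq> ?q ` topspace ?S \<and> openin ?S {x \<in> topspace ?S. ?q x \<in> K}"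
    then have "openin ?S (\<Union>K\<in>\<K>. {x \<in> topspace ?S. ?q x \<in> K})"
      by blast
    then show "openin ?S {x \<in> topspace ?S. ?q x \<in> \<Union> \<K>}"
      by (rule back_subst) blast
  qed blast+
  then show ?thesis
    by (simp add: projective_space_def)
qed

lemma topspace_projective_space:
  "topspace (projective_space n) = antipodal_class ` topspace (nsphere n)"
proof -
  have "{x \<in> topspace (nsphere n). antipodal_class x \<in> antipodal_class ` topspace (nsphere n)}
      = topspace (nsphere n)"
    by blast
  then have "openin (projective_space n) (antipodal_class ` topspace (nsphere n))"
    by (simp add: openin_projective_space)
  then show ?thesis
    unfolding topspace_def [of "projective_space n"] openin_projective_space by blast
qed

lemma quotient_map_antipodal_class:
  "quotient_map (nsphere n) (projective_space n) antipodal_class"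
  by (auto simp: quotient_map_def topspace_projective_space openin_projective_space)

section \<open>Singular cohomology ring with coefficients in \<open>\<int>/2\<close>\<close>

text \<open>
  An inhomogeneous cochain is a family of homogeneous cochains, indexed by the degree and zero
  in all but finitely many degrees; its degree \<open>p\<close> component is a function on the singular
  \<open>p\<close>-simplices (and is zero on everything else).  The type \<open>bit\<close> is the field with two elements.
\<close>

type_synonym 'a cochain = "nat \<Rightarrow> ((nat \<Rightarrow> real) \<Rightarrow> 'a) \<Rightarrow> bit"

definition cochains :: "'a topology \<Rightarrow> 'a cochain set" where
  "cochains X = {c. (\<forall>p f. \<not> singular_simplex p X f \<longrightarrow> c p f = 0) \<and>
     finite {p. \<exists>f. c p f \<noteq> 0}}"

text \<open>Signs are irrelevant modulo 2.\<close>

definition coboundary :: "'a topology \<Rightarrow> 'a cochain \<Rightarrow> 'a cochain" where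
  "coboundary X c = (\<lambda>p f. if 1 \<le> p \<and> singular_simplex p X f
     then \<Sum>k\<le>p. c (p - 1) (singular_face p k f) else 0)"

text \<open>Restriction of a simplex to the face on its first \<open>i + 1\<close> vertices \<open>v\<^sub>0, \<dots>, v\<^sub>i\<close>; a standard
  simplex of smaller dimension is literally a subset of one of larger dimension.\<close>

definition front_face :: "nat \<Rightarrow> ((nat \<Rightarrow> real) \<Rightarrow> 'a) \<Rightarrow> (nat \<Rightarrow> real) \<Rightarrow> 'a" where
  "front_face i f = restrict f (standard_simplex i)"

text \<open>Restriction of a \<open>p\<close>-simplex to the face on its last vertices \<open>v\<^sub>i, \<dots>, v\<^sub>p\<close>.\<close>

definition back_face :: "nat \<Rightarrow> nat \<Rightarrow> ((nat \<Rightarrow> real) \<Rightarrow> 'a) \<Rightarrow> (nat \<Rightarrow> real) \<Rightarrow> 'a" where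
  "back_face p i f = restrict (\<lambda>x. f (\<lambda>j. if j < i then 0 else x (j - i))) (standard_simplex (p - i))"

definition cup :: "'a topology \<Rightarrow> 'a cochain \<Rightarrow> 'a cochain \<Rightarrow> 'a cochain" where
  "cup X a b = (\<lambda>p f. if singular_simplex p X f
     then \<Sum>i\<le>p. a i (front_face i f) * b (p - i) (back_face p i f) else 0)"

definition cochain_ring :: "'a topology \<Rightarrow> 'a cochain ring" where
  "cochain_ring X =
    \<lparr>carrier = cochains X,
     mult = cup X,
     one = (\<lambda>p f. if p = 0 \<and> singular_simplex p X f then 1 else 0),
     zero = (\<lambda>p f. 0),
     add = (\<lambda>a b p f. a p f + b p f)\<rparr>"

definition cocycle_ring :: "'a topology \<Rightarrow> 'a cochain ring" where
  "cocycle_ring X =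
     (cochain_ring X)\<lparr>carrier := {c \<in> cochains X. coboundary X c = (\<lambda>p f. 0)}\<rparr>"

definition cohomology_ring :: "'a topology \<Rightarrow> 'a cochain set ring" where
  "cohomology_ring X = cocycle_ring X Quot (coboundary X ` cochains X)"

section \<open>Tensor powers over \<open>\<int>/2\<close>\<close>

definition tuples :: "nat \<Rightarrow> ('r, 'm) ring_scheme \<Rightarrow> (nat \<Rightarrow> 'r) set" where
  "tuples k R = {..<k} \<rightarrow>\<^sub>E carrier R"

definition pure :: "(nat \<Rightarrow> 'r) \<Rightarrow> (nat \<Rightarrow> 'r) \<Rightarrow> bit" where
  "pure t = (\<lambda>s. if s = t then 1 else 0)"

text \<open>The vector space over \<open>\<int>/2\<close> with basis the \<open>k\<close>-tuples of elements of \<open>R\<close>, multiplied by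
  extending the componentwise multiplication of tuples bilinearly.\<close>

definition free_tuple_ring :: "nat \<Rightarrow> ('r, 'm) ring_scheme \<Rightarrow> ((nat \<Rightarrow> 'r) \<Rightarrow> bit) ring" where
  "free_tuple_ring k R =
    \<lparr>carrier = {u. finite {t. u t \<noteq> 0} \<and> {t. u t \<noteq> 0} \<subseteq> tuples k R},
     mult = (\<lambda>u v t. \<Sum>s\<in>{s. u s \<noteq> 0}. \<Sum>s'\<in>{s'. v s' \<noteq> 0}.
               if t = (\<lambda>i\<in>{..<k}. s i \<otimes>\<^bsub>R\<^esub> s' i) then u s * v s' else 0),
     one = pure (\<lambda>i\<in>{..<k}. \<one>\<^bsub>R\<^esub>),
     zero = (\<lambda>t. 0),
     add = (\<lambda>u v t. u t + v t)\<rparr>"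

text \<open>Additivity in each variable; over \<open>\<int>/2\<close> this is the same as multilinearity.\<close>

definition multilinear_relations :: "nat \<Rightarrow> ('r, 'm) ring_scheme \<Rightarrow> ((nat \<Rightarrow> 'r) \<Rightarrow> bit) set" where
  "multilinear_relations k R =
     {\<lambda>s. pure (t(i := a \<oplus>\<^bsub>R\<^esub> b)) s - pure (t(i := a)) s - pure (t(i := b)) s | t i a b.
        t \<in> tuples k R \<and> i < k \<and> a \<in> carrier R \<and> b \<in> carrier R}"

definition tensor_power :: "nat \<Rightarrow> ('r, 'm) ring_scheme \<Rightarrow> ((nat \<Rightarrow> 'r) \<Rightarrow> bit) set ring" where
  "tensor_power k R =
     free_tuple_ring k R Quot (Idl\<^bsub>free_tuple_ring k R\<^esub> (multilinear_relations k R))"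

text \<open>The iterated multiplication \<open>a\<^sub>0 \<otimes> \<dots> \<otimes> a\<^bsub>k-1\<^esub> \<mapsto> a\<^sub>0 \<dots> a\<^bsub>k-1\<^esub>\<close>, first on the free vector space,
  then induced on the quotient.\<close>

definition free_iterated_mult :: "nat \<Rightarrow> ('r, 'm) ring_scheme \<Rightarrow> ((nat \<Rightarrow> 'r) \<Rightarrow> bit) \<Rightarrow> 'r" where
  "free_iterated_mult k R u =
     (\<Oplus>\<^bsub>R\<^esub>t\<in>{t. u t \<noteq> 0}. foldr (\<lambda>i y. t i \<otimes>\<^bsub>R\<^esub> y) [0..<k] \<one>\<^bsub>R\<^esub>)"

definition iterated_mult :: "nat \<Rightarrow> ('r, 'm) ring_scheme \<Rightarrow> ((nat \<Rightarrow> 'r) \<Rightarrow> bit) set \<Rightarrow> 'r" where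
  "iterated_mult k R w = the_elem (free_iterated_mult k R ` w)"

section \<open>Zero-divisor cup length\<close>

definition zcl_kernel :: "nat \<Rightarrow> 'a topology \<Rightarrow> ((nat \<Rightarrow> 'a cochain set) \<Rightarrow> bit) set set" where
  "zcl_kernel k X = a_kernel (tensor_power k (cohomology_ring X)) (cohomology_ring X)
     (iterated_mult k (cohomology_ring X))"

text \<open>The value is only meaningful if the lengths of nonzero products are bounded.\<close>

definition zcl :: "nat \<Rightarrow> 'a topology \<Rightarrow> nat" where
  "zcl k X = Max {length zs | zs. set zs \<subseteq> zcl_kernel k X \<and>
     foldr (mult (tensor_power k (cohomology_ring X))) zs \<one>\<^bsub>tensor_power k (cohomology_ring X)\<^esub>
       \<noteq> \<zero>\<^bsub>tensor_power k (cohomology_ring X)\<^esub>}"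

section \<open>Binary expansions\<close>

definition digit :: "nat \<Rightarrow> nat \<Rightarrow> nat" where
  "digit n j = n div 2 ^ j mod 2"

definition Z :: "nat \<Rightarrow> nat \<Rightarrow> nat" where
  "Z i n = (\<Sum>j\<le>i. (1 - digit n j) * 2 ^ j)"

definition S :: "nat \<Rightarrow> nat set" where
  "S n = {i. 1 \<le> i \<and> digit n i = 1 \<and> digit n (i - 1) = 1 \<and> digit n (i + 1) = 0}"

definition \<nu> :: "nat \<Rightarrow> nat" where
  "\<nu> m = Max {t. 2 ^ t dvd m}"

end

theory Submission
  imports Defs "HOL-Library.Function_Algebras"
begin

text \<open>
  The cohomology ring of \<open>P\<^sup>n\<close> is determined from the double cover \<open>S\<^sup>n \<rightarrow> P\<^sup>n\<close>.  Modulo 2, restriction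
  to the cover and transfer fit into the Gysin sequence, whose connecting map is the cup product with
  the class \<open>w\<close> of the cover; together with the cohomology of the sphere it shows that every
  \<open>H\<^sup>p(P\<^sup>n)\<close> is generated by \<open>w\<^sup>p\<close> as soon as \<open>w\<^bsup>n+1\<^esup> = 0\<close>.  The latter holds because \<open>w\<close> vanishes
  on each of the \<open>n + 1\<close> charts \<open>x\<^sub>i \<noteq> 0\<close>.

  The kernel of the multiplication \<open>H\<^sup>*(P\<^sup>n)\<^bsup>\<otimes>k\<^esup> \<rightarrow> H\<^sup>*(P\<^sup>n)\<close> is the ideal generated by the elements
  \<open>x\<^sub>l + x\<^sub>k\<close>, so the question is for which \<open>a\<close> the product of the \<open>(x\<^sub>l + x\<^sub>k)\<^bsup>a\<^sub>l\<^esup>\<close> is nonzero.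
  If \<open>M = 2\<^bsup>i+1\<^esup>\<close>, a nonzero monomial has exponents \<open>j\<^sub>l \<le> n\<close> and \<open>b\<^sub>l = a\<^sub>l - j\<^sub>l\<close> with \<open>\<Sum>b\<^sub>l \<le> n\<close> and
  \<open>(j\<^sub>l mod M) + (b\<^sub>l mod M) < M\<close>; hence \<open>j\<^sub>l + (b\<^sub>l mod M) \<le> n + Z\<^sub>i(n)\<close>, and summing over \<open>l\<close> gives the upper
  bound.  It is attained for \<open>j\<^sub>l = n\<close> and \<open>b\<^sub>l\<close> having no binary digit in common with \<open>n\<close>, where the sum of
  the \<open>b\<^sub>l\<close> is made as close to \<open>n\<close> as possible by a greedy choice.
\<close>

text \<open>Mod 2 cocycles meet integral homology as follows: a cocycle is a coboundary once it
  vanishes on the integral chains whose boundary is divisible by 2, and on the sphere, whose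
  homology has no 2-torsion, such chains are cycles up to even chains. The Gysin sequence is made of
  cochain formulas, the transfer being split degreewise by the indicator of an arbitrary,
  discontinuous choice of a point on each line. Tensors are controlled from two sides: spans
  restrict which monomials can occur, products of coefficient functionals detect one of them. The
  upper bound exists for every exponent \<open>p\<close>, with deficiency
  \<open>2 ^ p - 1 - k * zeros_below p n\<close>, and the greedy choice leaves a remainder of at
  most some such deficiency, so the answer is \<open>k * n\<close> minus the largest one. Comparing
  neighbouring exponents leaves the tops of runs of at least two ones, which form
  \<open>S n\<close>, and the trailing run of ones, of length \<open>\<nu> (n + 1)\<close>. Here
  \<open>k \<ge> 3\<close> enters: a zero digit at \<open>j\<close> costs \<open>k * 2 ^ j\<close>,
  at least the \<open>3 * 2 ^ j\<close> gained by passing from \<open>j\<close> to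
  \<open>j + 2\<close>.\<close>

declare add_bit_eq_xor [simp del] mult_bit_eq_and [simp del]

lemma bit_add_self [simp]: "(a::bit) + a = 0"
  by (cases a) simp_all

lemma bit_add_eq_0_iff: "a + b = 0 \<longleftrightarrow> a = (b::bit)"
  by (cases a; cases b) simp_all

lemma cochain_add_self [simp]: "(c::'a cochain) + c = 0"
  by (simp add: fun_eq_iff)

lemma cochain_add_self_left [simp]: "(c::'a cochain) + (c + d) = d"
  unfolding add.assoc [symmetric] by simp

subsection \<open>Faces\<close>

text \<open>The affine embedding onto the vertices from \<open>i\<close> on. With a name for it,
  identities between faces reduce to identities between maps of points, checked
  coordinatewise.\<close>

definition vertex_shift :: "nat \<Rightarrow> (nat \<Rightarrow> real) \<Rightarrow> nat \<Rightarrow> real" where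
  "vertex_shift i x = (\<lambda>j. if j < i then 0 else x (j - i))"

lemma back_face_eq: "back_face p i f = restrict (f \<circ> vertex_shift i) (standard_simplex (p - i))"
  by (simp add: back_face_def vertex_shift_def o_def)

lemma vertex_shift_in_standard_simplex:
  assumes "i \<le> p" "x \<in> standard_simplex (p - i)"
  shows "vertex_shift i x \<in> standard_simplex p"
proof -
  have "(\<Sum>j\<le>p. vertex_shift i x j) = (\<Sum>j\<in>{i..p}. x (j - i))"
    by (rule sum.mono_neutral_cong_right) (auto simp: vertex_shift_def)
  also have "\<dots> = (\<Sum>j\<le>p - i. x j)"
    by (rule sum.reindex_bij_witness [of _ "\<lambda>j. j + i" "\<lambda>j. j - i"]) (use assms(1) in auto)
  moreover have "x (j - i) = 0" if "j > p" for j
    using that assms by (auto simp: standard_simplex_def)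
  ultimately show ?thesis
    using assms(2) by (auto simp: standard_simplex_def vertex_shift_def)
qed

lemma continuous_map_vertex_shift:
  assumes "i \<le> p"
  shows "continuous_map (subtopology (powertop_real UNIV) (standard_simplex (p - i)))
    (subtopology (powertop_real UNIV) (standard_simplex p)) (vertex_shift i)"
proof -
  have "continuous_map (subtopology (powertop_real UNIV) (standard_simplex (p - i)))
      euclideanreal (\<lambda>x. vertex_shift i x j)" for j
    by (cases "j < i")
      (auto simp: vertex_shift_def
        intro: continuous_map_from_subtopology continuous_map_product_projection)
  then show ?thesis
    using assms
    by (auto simp: continuous_map_in_subtopology continuous_map_componentwise
        vertex_shift_in_standard_simplex)
qed

lemma singular_simplex_front_face:
  assumes "singular_simplex p X f" "i \<le> p"
  shows "singular_simplex i X (front_face i f)"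
  using assms standard_simplex_mono [OF assms(2)]
  by (auto simp: singular_simplex_def front_face_def continuous_map_from_subtopology_mono)

lemma singular_simplex_back_face:
  assumes "singular_simplex p X f" "i \<le> p"
  shows "singular_simplex (p - i) X (back_face p i f)"
  using assms continuous_map_compose [OF continuous_map_vertex_shift]
  by (fastforce simp: singular_simplex_def back_face_eq)

lemma back_face_0 [simp]: "singular_simplex p X f \<Longrightarrow> back_face p 0 f = f"
  by (simp add: back_face_def singular_simplex_def extensional_restrict)

lemma front_face_front_face: "j \<le> i \<Longrightarrow> front_face j (front_face i f) = front_face j f"
  using standard_simplex_mono [of j i] by (auto simp: front_face_def fun_eq_iff restrict_def)

lemma back_face_front_face:
  assumes "j \<le> i" "i \<le> p"
  shows "back_face i j (front_face i f) = front_face (i - j) (back_face p j f)"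
  using assms standard_simplex_mono [of "i - j" "p - j"]
  by (force simp: front_face_def back_face_eq fun_eq_iff restrict_def vertex_shift_in_standard_simplex)

lemma back_face_back_face:
  assumes "j + l \<le> p"
  shows "back_face (p - j) l (back_face p j f) = back_face p (j + l) f"
proof -
  have "vertex_shift j (vertex_shift l x) = vertex_shift (j + l) x" for x
    by (auto simp: vertex_shift_def fun_eq_iff)
  moreover have "vertex_shift l x \<in> standard_simplex (p - j)" if "x \<in> standard_simplex (p - (j + l))" for x
    using that assms by (intro vertex_shift_in_standard_simplex) (auto simp: algebra_simps)
  ultimately show ?thesis
    by (auto simp: back_face_eq intro!: restrict_ext)
qed

text \<open>The face opposite vertex \<open>k\<close> skips that vertex and renumbers the later
  ones. If \<open>k \<le> i\<close>, its front part on \<open>i + 1\<close> vertices is a face of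
  the front part on \<open>i + 2\<close> vertices, and its back part starts one vertex later; if
  \<open>i < k\<close>, the front part is untouched and the skipped vertex lies in the back part.
  The resulting four cases feed the Leibniz rule.\<close>

lemma front_face_singular_face:
  assumes "k \<le> i" "i < p"
  shows "front_face i (singular_face p k f) = singular_face (Suc i) k (front_face (Suc i) f)"
proof -
  have "x \<in> standard_simplex (p - Suc 0)" "simplical_face k x \<in> standard_simplex (Suc i)"
    if "x \<in> standard_simplex i" for x
    using that assms standard_simplex_mono [of i "p - Suc 0", THEN subsetD, of x]
    by (auto intro!: simplical_face_in_standard_simplex)
  then show ?thesis
    by (auto simp: front_face_def singular_face_def intro!: restrict_ext)
qed

lemma back_face_singular_face:
  assumes "k \<le> i" "i < p"
  shows "back_face (p - Suc 0) i (singular_face p k f) = back_face p (Suc i) f"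
proof -
  have "simplical_face k (vertex_shift i x) = vertex_shift (Suc i) x" for x
    using assms by (auto simp: vertex_shift_def simplical_face_def fun_eq_iff)
  moreover have "vertex_shift i x \<in> standard_simplex (p - Suc 0)" if "x \<in> standard_simplex (p - Suc i)" for x
    using that assms by (intro vertex_shift_in_standard_simplex) auto
  ultimately show ?thesis
    by (auto simp: back_face_eq singular_face_def intro!: restrict_ext)
qed

lemma front_face_singular_face':
  assumes "i < k" "k \<le> p"
  shows "front_face i (singular_face p k f) = front_face i f"
proof -
  have "x \<in> standard_simplex (p - Suc 0)" if "x \<in> standard_simplex i" for x
    using that assms standard_simplex_mono [of i "p - Suc 0", THEN subsetD, of x] by auto
  moreover have "simplical_face k x = x" if "x \<in> standard_simplex i" for x
    using that assms by (auto simp: simplical_face_def fun_eq_iff standard_simplex_def)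
  ultimately show ?thesis
    by (auto simp: front_face_def singular_face_def intro!: restrict_ext)
qed

lemma back_face_singular_face':
  assumes "i < k" "k \<le> p"
  shows "back_face (p - Suc 0) i (singular_face p k f) = singular_face (p - i) (k - i) (back_face p i f)"
proof -
  have "simplical_face k (vertex_shift i x) = vertex_shift i (simplical_face (k - i) x)" for x
    using assms by (auto simp: vertex_shift_def simplical_face_def fun_eq_iff)
  moreover have "vertex_shift i x \<in> standard_simplex (p - Suc 0)"
     "simplical_face (k - i) x \<in> standard_simplex (p - i)" if "x \<in> standard_simplex (p - Suc i)" for x
    using that assms by (auto intro!: vertex_shift_in_standard_simplex simplical_face_in_standard_simplex)
  moreover have "p - Suc 0 - i = p - Suc i" "p - i - Suc 0 = p - Suc i"
    by auto
  ultimately show ?thesis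
    by (auto simp: back_face_eq singular_face_def intro!: restrict_ext)
qed

text \<open>Leaving out the last vertex of a front face gives the next shorter front face;
  \<open>singular_face_first\<close> is the same at the other end. These two faces are the terms
  that cancel in the Leibniz rule.\<close>

lemma singular_face_last:
  assumes "singular_simplex (Suc i) X f"
  shows "singular_face (Suc i) (Suc i) f = front_face i f"
  using front_face_singular_face' [of i "Suc i" "Suc i" f]
  by (simp add: front_face_def singular_face_def)

lemma singular_face_first:
  assumes "0 < p"
  shows "singular_face p 0 f = back_face p (Suc 0) f"
  using back_face_singular_face [of 0 0 p f] assms
  by (simp add: back_face_eq singular_face_def vertex_shift_def cong: restrict_cong)

subsection \<open>The cochain ring\<close>

lemma cochains_eqI:
  assumes "c \<in> cochains X" "d \<in> cochains X"
    and "\<And>p f. singular_simplex p X f \<Longrightarrow> c p f = d p f"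
  shows "c = d"
  using assms by (fastforce simp: fun_eq_iff cochains_def)

lemma zero_cochains [simp]: "0 \<in> cochains X"
  by (simp add: cochains_def)

lemma cochainsI_degrees:
  assumes "\<And>p f. \<not> singular_simplex p X f \<Longrightarrow> c p f = 0"
    and "\<And>p f. c p f \<noteq> 0 \<Longrightarrow> p \<in> D" and "finite D"
  shows "c \<in> cochains X"
proof -
  have "{p. \<exists>f. c p f \<noteq> 0} \<subseteq> D"
    using assms(2) by blast
  then show ?thesis
    using assms(1,3) by (auto simp: cochains_def intro: finite_subset)
qed

lemma finite_cochain_degrees: "c \<in> cochains X \<Longrightarrow> finite {p. \<exists>f. c p f \<noteq> 0}"
  by (simp add: cochains_def)

lemma add_cochains [simp]:
  assumes "a \<in> cochains X" "b \<in> cochains X"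
  shows "a + b \<in> cochains X"
proof (rule cochainsI_degrees)
  show "finite ({p. \<exists>f. a p f \<noteq> 0} \<union> {p. \<exists>f. b p f \<noteq> 0})"
    using assms by (simp only: finite_Un finite_cochain_degrees)
qed (use assms in \<open>auto simp: cochains_def\<close>)

lemma coboundary_add [simp]: "coboundary X (a + b) = coboundary X a + coboundary X b"
  by (auto simp: coboundary_def fun_eq_iff sum.distrib)

lemma coboundary_0 [simp]: "coboundary X 0 = 0"
  by (auto simp: coboundary_def fun_eq_iff)

lemma coboundary_cochains [simp]:
  assumes "a \<in> cochains X"
  shows "coboundary X a \<in> cochains X"
proof -
  have "p \<in> Suc ` {p. \<exists>f. a p f \<noteq> 0}" if nz: "coboundary X a p f \<noteq> 0" for p f
  proof -
    from nz have "1 \<le> p" "(\<Sum>k\<le>p. a (p - 1) (singular_face p k f)) \<noteq> 0"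
      by (auto simp: coboundary_def split: if_splits)
    then obtain k where "a (p - 1) (singular_face p k f) \<noteq> 0"
      by (meson sum.neutral)
    with \<open>1 \<le> p\<close> show ?thesis
      by (intro image_eqI [of _ _ "p - 1"]) auto
  qed
  moreover have "finite (Suc ` {p. \<exists>f. a p f \<noteq> 0})"
    using assms by (simp only: finite_imageI finite_cochain_degrees)
  ultimately show ?thesis
    by (intro cochainsI_degrees [of X _ "Suc ` {p. \<exists>f. a p f \<noteq> 0}"])
      (simp_all only: coboundary_def simp_thms if_False)
qed

lemma cup_add_left: "cup X (a + b) c = cup X a c + cup X b c"
  by (auto simp: cup_def fun_eq_iff distrib_right sum.distrib)

lemma cup_add_right: "cup X a (b + c) = cup X a b + cup X a c"
  by (auto simp: cup_def fun_eq_iff distrib_left sum.distrib)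

lemma cup_0_left [simp]: "cup X 0 c = 0"
  by (auto simp: cup_def fun_eq_iff)

lemma cup_0_right [simp]: "cup X c 0 = 0"
  by (auto simp: cup_def fun_eq_iff)

lemma cup_cochains [simp]:
  assumes "a \<in> cochains X" "b \<in> cochains X"
  shows "cup X a b \<in> cochains X"
proof -
  let ?D = "\<lambda>c::'a cochain. {p. \<exists>f. c p f \<noteq> 0}"
  have "p \<in> (\<lambda>(i, j). i + j) ` (?D a \<times> ?D b)" if nz: "cup X a b p f \<noteq> 0" for p f
  proof -
    from nz have "(\<Sum>i\<le>p. a i (front_face i f) * b (p - i) (back_face p i f)) \<noteq> 0"
      by (auto simp: cup_def split: if_splits)
    then obtain i where i: "i \<le> p" "a i (front_face i f) * b (p - i) (back_face p i f) \<noteq> 0"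
      by (meson sum.neutral atMost_iff)
    then have "i \<in> ?D a" "p - i \<in> ?D b"
      by (auto simp: mult_eq_0_iff)
    with i(1) show ?thesis
      by (intro image_eqI [of _ _ "(i, p - i)"]) auto
  qed
  moreover have "finite (?D a \<times> ?D b)"
    using assms by (simp only: finite_cartesian_product finite_cochain_degrees)
  ultimately show ?thesis
    by (intro cochainsI_degrees [of X _ "(\<lambda>(i, j). i + j) ` (?D a \<times> ?D b)"])
      (simp_all only: finite_imageI cup_def if_False)
qed

definition unit_cochain :: "'a topology \<Rightarrow> 'a cochain" where
  "unit_cochain X = (\<lambda>p f. if p = 0 \<and> singular_simplex p X f then 1 else 0)"

lemma unit_cochain_cochains [simp]: "unit_cochain X \<in> cochains X"
  by (auto simp: unit_cochain_def cochains_def)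

lemma coboundary_unit_cochain [simp]: "coboundary X (unit_cochain X) = 0"
proof -
  have "coboundary X (unit_cochain X) p f = 0" for p f
  proof (cases "p = 1 \<and> singular_simplex p X f")
    case True
    then have "singular_simplex 0 X (singular_face (Suc 0) k f)" if "k \<le> Suc 0" for k
      using that singular_simplex_singular_face [of p X f k] by auto
    then show ?thesis
      using True by (simp add: coboundary_def unit_cochain_def)
  next
    case False
    then show ?thesis
      by (cases "singular_simplex p X f"; cases p) (auto simp: coboundary_def unit_cochain_def)
  qed
  then show ?thesis
    by (simp add: fun_eq_iff)
qed

lemma cup_unit_left [simp]:
  assumes "c \<in> cochains X"
  shows "cup X (unit_cochain X) c = c"
proof (rule cochains_eqI)
  fix p f assume f: "singular_simplex p X f"
  have "cup X (unit_cochain X) c p f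
      = (\<Sum>i\<le>p. unit_cochain X i (front_face i f) * c (p - i) (back_face p i f))"
    using f by (simp add: cup_def)
  also have "\<dots> = (\<Sum>i\<in>{0}. unit_cochain X i (front_face i f) * c (p - i) (back_face p i f))"
    by (rule sum.mono_neutral_right) (auto simp: unit_cochain_def)
  also have "\<dots> = c p f"
    using f by (simp add: unit_cochain_def singular_simplex_front_face)
  finally show "cup X (unit_cochain X) c p f = c p f" .
qed (use assms in auto)

lemma front_face_self: "singular_simplex p X f \<Longrightarrow> front_face p f = f"
  by (simp add: front_face_def singular_simplex_def extensional_restrict)

lemma cup_unit_right [simp]:
  assumes "c \<in> cochains X"
  shows "cup X c (unit_cochain X) = c"
proof (rule cochains_eqI)
  fix p f assume f: "singular_simplex p X f"
  have "cup X c (unit_cochain X) p f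
      = (\<Sum>i\<le>p. c i (front_face i f) * unit_cochain X (p - i) (back_face p i f))"
    using f by (simp add: cup_def)
  also have "\<dots> = (\<Sum>i\<in>{p}. c i (front_face i f) * unit_cochain X (p - i) (back_face p i f))"
    by (rule sum.mono_neutral_right) (auto simp: unit_cochain_def)
  also have "\<dots> = c p f"
    using f singular_simplex_back_face [OF f, of p] by (simp add: unit_cochain_def front_face_self)
  finally show "cup X c (unit_cochain X) p f = c p f" .
qed (use assms in auto)

lemma sum_triangle:
  fixes g :: "nat \<Rightarrow> nat \<Rightarrow> 'b::comm_monoid_add"
  shows "(\<Sum>i\<le>p. \<Sum>j\<le>i. g i j) = (\<Sum>j\<le>p. \<Sum>l\<le>p - j. g (j + l) j)"
  unfolding sum.Sigma [OF finite_atMost ballI [OF finite_atMost]]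
  by (rule sum.reindex_bij_witness [of _ "\<lambda>(j, l). (j + l, j)" "\<lambda>(i, j). (j, i - j)"]) auto

lemma cup_assoc:
  assumes "a \<in> cochains X" "b \<in> cochains X" "c \<in> cochains X"
  shows "cup X (cup X a b) c = cup X a (cup X b c)"
proof (rule cochains_eqI)
  fix p f assume f: "singular_simplex p X f"
  have "cup X (cup X a b) c p f = (\<Sum>i\<le>p. (\<Sum>j\<le>i. a j (front_face j f) *
      b (i - j) (front_face (i - j) (back_face p j f))) * c (p - i) (back_face p i f))"
    using f by (simp add: cup_def singular_simplex_front_face front_face_front_face
        back_face_front_face [of _ _ p])
  also have "\<dots> = (\<Sum>i\<le>p. \<Sum>j\<le>i. a j (front_face j f) *
      b (i - j) (front_face (i - j) (back_face p j f)) * c (p - i) (back_face p i f))"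
    by (simp add: sum_distrib_right)
  also have "\<dots> = (\<Sum>j\<le>p. \<Sum>l\<le>p - j. a j (front_face j f) *
      b l (front_face l (back_face p j f)) * c (p - (j + l)) (back_face p (j + l) f))"
    by (subst sum_triangle) simp
  also have "\<dots> = cup X a (cup X b c) p f"
    using f by (simp add: cup_def singular_simplex_back_face back_face_back_face
        sum_distrib_left mult.assoc diff_diff_left [symmetric] del: diff_diff_left)
  finally show "cup X (cup X a b) c p f = cup X a (cup X b c) p f" .
qed (use assms in auto)

section \<open>Evaluation of mod 2 cochains on integral chains\<close>

definition pairing :: "nat \<Rightarrow> 'a cochain \<Rightarrow> 'a chain \<Rightarrow> bit" where
  "pairing p c z = (\<Sum>f\<in>Poly_Mapping.keys z. of_int (Poly_Mapping.lookup z f) * c p f)"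

lemma pairing_superset:
  assumes "finite A" "Poly_Mapping.keys z \<subseteq> A"
  shows "pairing p c z = (\<Sum>f\<in>A. of_int (Poly_Mapping.lookup z f) * c p f)"
  unfolding pairing_def using assms by (intro sum.mono_neutral_left) (auto simp: in_keys_iff)

lemma pairing_0 [simp]: "pairing p c 0 = 0"
  by (simp add: pairing_def)

lemma pairing_of [simp]: "pairing p c (frag_of f) = c p f"
  by (simp add: pairing_def)

lemma pairing_add: "pairing p c (z + w) = pairing p c z + pairing p c w"
proof -
  let ?A = "Poly_Mapping.keys z \<union> Poly_Mapping.keys w"
  have "Poly_Mapping.keys (z + w) \<subseteq> ?A"
    by (rule keys_add)
  then show ?thesis
    by (simp add: pairing_superset [of ?A] lookup_add distrib_right sum.distrib)
qed

lemma pairing_cmul: "pairing p c (frag_cmul k z) = of_int k * pairing p c z"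
proof -
  have "Poly_Mapping.keys (frag_cmul k z) \<subseteq> Poly_Mapping.keys z"
    by (rule keys_cmul)
  then show ?thesis
    by (simp add: pairing_superset [of "Poly_Mapping.keys z"] sum_distrib_left mult.assoc)
qed

lemma pairing_minus: "pairing p c (- z) = pairing p c z"
  using pairing_cmul [of p c "-1" z] by simp

lemma pairing_diff: "pairing p c (z - w) = pairing p c z + pairing p c w"
  using pairing_add [of p c z "- w"] by (simp add: pairing_minus)

lemma pairing_sum: "pairing p c (sum g I) = (\<Sum>i\<in>I. pairing p c (g i))"
  by (induction I rule: infinite_finite_induct) (simp_all add: pairing_add)

lemma pairing_add_cochain: "pairing p (c + d) z = pairing p c z + pairing p d z"
  by (simp add: pairing_def distrib_left sum.distrib)

text \<open>Stokes' formula: the signs of the integral boundary become 1 in \<open>bit\<close>, and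
  additivity reduces the claim to a single simplex. It makes integral subdivision and integral
  homology applicable to mod 2 cochains.\<close>

lemma pairing_coboundary:
  assumes "singular_chain (Suc p) X z"
  shows "pairing (Suc p) (coboundary X c) z = pairing p c (chain_boundary (Suc p) z)"
  using assms unfolding singular_chain_def
proof (induction rule: frag_induction)
  case (one f)
  have "of_int ((- 1) ^ k) = (1::bit)" for k
    by simp
  with one show ?case
    by (simp add: coboundary_def chain_boundary_of pairing_sum pairing_cmul del: sum.atMost_Suc)
qed (auto simp: pairing_diff chain_boundary_diff)

lemma coboundary_coboundary [simp]:
  assumes "c \<in> cochains X"
  shows "coboundary X (coboundary X c) = 0"
proof (rule cochains_eqI)
  fix p f assume f: "singular_simplex p X f"
  show "coboundary X (coboundary X c) p f = 0 p f"
  proof (cases "2 \<le> p")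
    case True
    then obtain m where m: "p = Suc (Suc m)"
      by (metis Suc_le_D numeral_2_eq_2 Suc_le_mono)
    have "coboundary X (coboundary X c) p f = pairing m c (chain_boundary (Suc m) (chain_boundary p (frag_of f)))"
      using pairing_coboundary [of "Suc m" X "frag_of f" "coboundary X c"] f
        pairing_coboundary [of m X "chain_boundary p (frag_of f)" c]
        singular_chain_boundary_alt [of "Suc m" X "frag_of f"]
      by (simp add: singular_chain_of m)
    then show ?thesis
      using chain_boundary_boundary [of p X "frag_of f"] f by (simp add: singular_chain_of m)
  next
    case False
    \<comment> \<open>For \<open>p = 1\<close> the inner coboundary has degree 0, where it is zero
      by definition; for \<open>p = 0\<close> the outer one is.\<close>
    then have "p - 1 = 0"
      by simp
    then show ?thesis
      by (simp add: coboundary_def)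
  qed
qed (use assms in auto)

text \<open>Passing to the face opposite \<open>k\<close> changes only one factor of the product
  split at vertex \<open>i\<close>: the first if \<open>k \<le> i\<close>, the second if
  \<open>k > i\<close>. The sum over \<open>k\<close> thus separates into the two coboundaries,
  except that each of them lacks one extreme face.\<close>

lemma coboundary_cup:
  assumes "a \<in> cochains X" "b \<in> cochains X"
  shows "coboundary X (cup X a b) = cup X (coboundary X a) b + cup X a (coboundary X b)"
proof (rule cochains_eqI)
  fix p f assume f: "singular_simplex p X f"
  show "coboundary X (cup X a b) p f = (cup X (coboundary X a) b + cup X a (coboundary X b)) p f"
  proof (cases p)
    case 0
    then show ?thesis
      using f by (simp add: coboundary_def cup_def)
  next
    case (Suc m)
    have bf: "singular_simplex (Suc (m - i)) X (back_face (Suc m) i f)" if "i \<le> m" for i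
      using singular_simplex_back_face [OF f, of i] that by (simp add: Suc Suc_diff_le)
    define T where "T i = a i (front_face i f) * b (m - i) (back_face p (Suc i) f)" for i
    define U where "U i k = a i (singular_face (Suc i) k (front_face (Suc i) f)) *
      b (m - i) (back_face p (Suc i) f)" for i k
    define V where "V i k = a i (front_face i f) *
      b (m - i) (singular_face (p - i) k (back_face p i f))" for i k
    have "coboundary X (cup X a b) p f =
        (\<Sum>k\<le>p. \<Sum>i\<le>m. a i (front_face i (singular_face p k f)) *
           b (m - i) (back_face m i (singular_face p k f)))"
      using f singular_simplex_singular_face [OF f] by (simp add: coboundary_def cup_def Suc)
    also have "\<dots> = (\<Sum>i\<le>m. \<Sum>k\<le>p. a i (front_face i (singular_face p k f)) *
           b (m - i) (back_face m i (singular_face p k f)))"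
      by (rule sum.swap)
    also have "\<dots> = (\<Sum>i\<le>m. (\<Sum>k\<le>i. U i k) + (\<Sum>k\<in>{i<..p}. V i (k - i)))"
    proof (rule sum.cong [OF refl])
      fix i assume "i \<in> {..m}"
      then have i: "i < p" by (simp add: Suc)
      then have *: "{..p} = {..i} \<union> {i<..p}" by auto
      have "(\<Sum>k\<le>p. a i (front_face i (singular_face p k f)) *
           b (m - i) (back_face m i (singular_face p k f))) =
        (\<Sum>k\<le>i. a i (front_face i (singular_face p k f)) *
           b (m - i) (back_face m i (singular_face p k f))) +
        (\<Sum>k\<in>{i<..p}. a i (front_face i (singular_face p k f)) *
           b (m - i) (back_face m i (singular_face p k f)))"
        unfolding * by (rule sum.union_disjoint) auto
      moreover have "m = p - Suc 0"
        by (simp add: Suc)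
      ultimately show "(\<Sum>k\<le>p. a i (front_face i (singular_face p k f)) *
           b (m - i) (back_face m i (singular_face p k f))) = (\<Sum>k\<le>i. U i k) + (\<Sum>k\<in>{i<..p}. V i (k - i))"
        using i by (auto simp: U_def V_def front_face_singular_face back_face_singular_face
            front_face_singular_face' back_face_singular_face' intro!: arg_cong2 [of _ _ _ _ "(+)"] sum.cong)
    qed
    \<comment> \<open>\<open>T i\<close> is inserted twice, which is harmless modulo 2: it is the
      missing last face of the first factor and the missing first face of the second.\<close>
    also have "\<dots> = (\<Sum>i\<le>m. ((\<Sum>k\<le>i. U i k) + T i) + (T i + (\<Sum>k\<in>{i<..p}. V i (k - i))))"
      by (rule sum.cong) (simp_all add: algebra_simps flip: add.assoc)
    also have "\<dots> = (\<Sum>i\<le>m. (\<Sum>k\<le>Suc i. U i k) + (\<Sum>k\<le>p - i. V i k))"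
    proof (intro sum.cong [OF refl] arg_cong2 [of _ _ _ _ "(+)"])
      fix i assume "i \<in> {..m}"
      then have i: "i \<le> m" by simp
      have "U i (Suc i) = T i"
        using singular_face_last [OF singular_simplex_front_face [OF f, of "Suc i"]] i
        by (simp add: U_def T_def Suc front_face_front_face)
      then show "(\<Sum>k\<le>i. U i k) + T i = (\<Sum>k\<le>Suc i. U i k)"
        by simp
      have "V i 0 = T i"
        using singular_face_first [of "p - i" "back_face p i f"] i back_face_back_face [of i 1 p f]
        by (simp add: V_def T_def Suc)
      moreover have "(\<Sum>k\<in>{i<..p}. V i (k - i)) = (\<Sum>k\<in>{0<..p - i}. V i k)"
        by (rule sum.reindex_bij_witness [of _ "\<lambda>k. k + i" "\<lambda>k. k - i"]) auto
      moreover have "{..p - i} = insert 0 {0<..p - i}"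
        by auto
      ultimately show "T i + (\<Sum>k\<in>{i<..p}. V i (k - i)) = (\<Sum>k\<le>p - i. V i k)"
        by simp
    qed
    also have "\<dots> = (\<Sum>i\<le>m. \<Sum>k\<le>Suc i. U i k) + (\<Sum>i\<le>m. \<Sum>k\<le>p - i. V i k)"
      by (rule sum.distrib)
    also have "(\<Sum>i\<le>m. \<Sum>k\<le>Suc i. U i k) = cup X (coboundary X a) b p f"
      unfolding cup_def
      using f by (simp add: Suc sum.atMost_Suc_shift [of _ m] del: sum.atMost_Suc)
        (simp add: coboundary_def U_def Suc singular_simplex_front_face sum_distrib_right del: sum.atMost_Suc)
    also have "(\<Sum>i\<le>m. \<Sum>k\<le>p - i. V i k) = cup X a (coboundary X b) p f"
      unfolding cup_def
      using f bf
      by (simp add: Suc) (simp add: coboundary_def V_def Suc sum_distrib_left Suc_diff_le del: sum.atMost_Suc)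
    finally show ?thesis
      by simp
  qed
qed (use assms in auto)

subsection \<open>Cocycles over the field with two elements\<close>

lemma of_int_bit_eq_0_iff: "of_int x = (0::bit) \<longleftrightarrow> even x"
proof (cases "even x")
  case True
  then obtain y where "x = y + y"
    by (metis dvdE mult_2)
  then show ?thesis
    by simp
next
  case False
  then obtain y where "x = y + y + 1"
    by (metis oddE mult_2)
  then show ?thesis
    by simp
qed

text \<open>Values on the vectors \<open>D i\<close> come from an additive functional as soon as
  they respect all finite linear relations between these vectors; over two scalars, a relation is
  just a finite subset with sum zero. The functional is prescribed on a basis chosen among the
  \<open>D i\<close> and extended.\<close>

lemma bit_functional_exists:
  fixes D :: "'i \<Rightarrow> 's \<Rightarrow> bit" and c :: "'i \<Rightarrow> bit"
  assumes consistent: "\<And>A. finite A \<Longrightarrow> A \<subseteq> I \<Longrightarrow> (\<Sum>i\<in>A. D i) = 0 \<Longrightarrow> (\<Sum>i\<in>A. c i) = 0"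
  obtains g :: "('s \<Rightarrow> bit) \<Rightarrow> bit" where "\<And>u v. g (u + v) = g u + g v" "\<And>i. i \<in> I \<Longrightarrow> g (D i) = c i"
proof -
  define scale :: "bit \<Rightarrow> ('s \<Rightarrow> bit) \<Rightarrow> 's \<Rightarrow> bit" where "scale r v = (\<lambda>x. r * v x)" for r v
  interpret V: vector_space scale
    by unfold_locales (simp_all add: scale_def fun_eq_iff distrib_left distrib_right mult.assoc)
  interpret W: vector_space "(*) :: bit \<Rightarrow> bit \<Rightarrow> bit"
    by unfold_locales (simp_all add: distrib_left distrib_right mult.assoc)
  interpret VW: vector_space_pair scale "(*) :: bit \<Rightarrow> bit \<Rightarrow> bit" ..
  obtain B where B: "B \<subseteq> D ` I" "V.independent B" "D ` I \<subseteq> V.span B"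
    using V.maximal_independent_subset by blast
  define s where "s = inv_into I D"
  have s: "s v \<in> I" "D (s v) = v" if "v \<in> B" for v
    using that B(1) by (auto simp: s_def inv_into_into f_inv_into_f subset_eq)
  obtain g where g: "Vector_Spaces.linear scale (*) g" "\<And>v. v \<in> B \<Longrightarrow> g v = c (s v)"
    using VW.linear_independent_extend [OF B(2), of "\<lambda>v. c (s v)"] by blast
  interpret g: Vector_Spaces.linear scale "(*) :: bit \<Rightarrow> bit \<Rightarrow> bit" g
    by (rule g(1))
  show thesis
  proof
    show "g (u + v) = g u + g v" for u v
      by (rule g.add)
    fix i assume i: "i \<in> I"
    obtain t r where t: "finite t" "t \<subseteq> B" "D i = (\<Sum>v\<in>t. scale (r v) v)"
      using B(3) i unfolding V.span_explicit by blast
    define T where "T = s ` {v \<in> t. r v = 1}"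
    have T: "finite T" "T \<subseteq> I"
      using t s by (auto simp: T_def)
    have inj: "inj_on s {v \<in> t. r v = 1}"
      using s(2) t(2) by (intro inj_on_inverseI [of _ D]) auto
    have "D i = (\<Sum>v\<in>{v \<in> t. r v = 1}. v)"
      unfolding t(3) by (rule sum.mono_neutral_cong_right) (use t(1) in \<open>auto simp: scale_def fun_eq_iff\<close>)
    also have "\<dots> = (\<Sum>j\<in>T. D j)"
      unfolding T_def sum.reindex [OF inj] using t(2) s(2) by (intro sum.cong) auto
    finally have Di: "D i = (\<Sum>j\<in>T. D j)" .
    have "g (D i) = (\<Sum>j\<in>T. g (D j))"
      unfolding Di by (rule g.sum)
    also have "\<dots> = (\<Sum>j\<in>T. c j)"
      using t(2) s g(2) by (intro sum.cong) (auto simp: T_def subset_eq)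
    \<comment> \<open>\<open>D i\<close> is the sum over \<open>T\<close>, so the relation to test
      is \<open>T - {i}\<close> or \<open>insert i T\<close>, according to whether \<open>i\<close>
      already occurs in \<open>T\<close>.\<close>
    also have "\<dots> = c i"
    proof (cases "i \<in> T")
      case True
      have "(\<Sum>j\<in>T - {i}. D j) = 0"
        using Di sum.remove [OF T(1) True, of D] by simp
      then have "(\<Sum>j\<in>T - {i}. c j) = 0"
        using consistent [of "T - {i}"] T by auto
      then show ?thesis
        using sum.remove [OF T(1) True, of c] by simp
    next
      case False
      have "D i + D i = 0"
        by (simp add: fun_eq_iff)
      then have "(\<Sum>j\<in>insert i T. D j) = 0"
        using Di False T(1) by simp
      then have "(\<Sum>j\<in>insert i T. c j) = 0"
        using consistent [of "insert i T"] T i by auto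
      then show ?thesis
        using False T(1) by (simp add: bit_add_eq_0_iff)
    qed
    finally show "g (D i) = c i" .
  qed
qed

lemma even_chain_halve:
  assumes "\<And>f. even (Poly_Mapping.lookup y f)"
  obtains w where "y = frag_cmul 2 w" "Poly_Mapping.keys w \<subseteq> Poly_Mapping.keys y"
proof
  show "y = frag_cmul 2 (Poly_Mapping.map (\<lambda>i. i div 2) y)"
    by (rule poly_mapping_eqI) (use assms in \<open>auto simp: Poly_Mapping.map.rep_eq when_def\<close>)
  show "Poly_Mapping.keys (Poly_Mapping.map (\<lambda>i. i div 2) y) \<subseteq> Poly_Mapping.keys y"
    by (auto simp: in_keys_iff Poly_Mapping.map.rep_eq when_def)
qed

lemma homogeneous_cochainsI:
  assumes "\<And>q f. \<not> singular_simplex q X f \<Longrightarrow> c q f = 0" "\<And>q f. q \<noteq> p \<Longrightarrow> c q f = 0"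
  shows "c \<in> cochains X"
  by (rule cochainsI_degrees [of X c "{p}"]) (use assms in \<open>auto simp del: bit_not_zero_iff\<close>)

text \<open>The chains \<open>z\<close> with boundary \<open>2 w\<close> are the integral lifts of
  mod 2 cycles. If \<open>c\<close> vanishes on them, sending the mod 2 boundary of a simplex
  \<open>f\<close> to the value of \<open>c\<close> on \<open>f\<close> is consistent, so it extends
  to a functional on all mod 2 chains; its values on simplices form a cochain with coboundary
  \<open>c\<close>.\<close>

lemma coboundary_if_pairing_vanishes:
  assumes c: "c \<in> cochains X" and deg: "\<And>q f. q \<noteq> Suc p \<Longrightarrow> c q f = 0"
    and van: "\<And>z w. singular_chain (Suc p) X z \<Longrightarrow> singular_chain p X w \<Longrightarrow>
       chain_boundary (Suc p) z = frag_cmul 2 w \<Longrightarrow> pairing (Suc p) c z = 0"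
  shows "c \<in> coboundary X ` cochains X"
proof -
  \<comment> \<open>Mod 2 chains are modelled as functions into \<open>bit\<close>:
    \<open>E f\<close> is the basis vector of \<open>f\<close>, and \<open>D f\<close> is the
    boundary of \<open>f\<close>.\<close>
  define E :: "((nat \<Rightarrow> real) \<Rightarrow> 'a) \<Rightarrow> ((nat \<Rightarrow> real) \<Rightarrow> 'a) \<Rightarrow> bit"
    where "E f = (\<lambda>h. if h = f then 1 else 0)" for f
  define D where "D f = (\<Sum>k\<le>Suc p. E (singular_face (Suc p) k f))" for f
  have apply_sum: "(sum F A) x = (\<Sum>i\<in>A. F i x)" for F :: "'j \<Rightarrow> ((nat \<Rightarrow> real) \<Rightarrow> 'a) \<Rightarrow> bit" and A x
    by (induction A rule: infinite_finite_induct) auto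
  have consistent: "(\<Sum>f\<in>A. c (Suc p) f) = 0"
    if A: "finite A" "A \<subseteq> singular_simplex_set (Suc p) X" "(\<Sum>f\<in>A. D f) = 0" for A
  proof -
    define z where "z = (\<Sum>f\<in>A. frag_of f)"
    have z: "singular_chain (Suc p) X z"
      unfolding z_def using A(2) by (intro singular_chain_sum) (auto simp: singular_chain_of)
    have lk: "Poly_Mapping.lookup (sum F B) h = (\<Sum>i\<in>B. Poly_Mapping.lookup (F i) h)"
      for F :: "'j \<Rightarrow> 'a chain" and B h
      by (induction B rule: infinite_finite_induct) (auto simp: lookup_add)
    have sgn': "of_int (if a then 1 else 0) = (if a then 1 else 0 :: bit)" for a
      by simp
    have sgn: "of_int ((- 1) ^ k * (if a then 1 else 0)) = (if a then 1 else 0 :: bit)" for k :: nat and a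
      by auto
    have "of_int (Poly_Mapping.lookup (chain_boundary (Suc p) z) h) = (0::bit)" for h
    proof -
      have "of_int (Poly_Mapping.lookup (chain_boundary (Suc p) z) h) = 
          (\<Sum>f\<in>A. \<Sum>k\<le>Suc p. if h = singular_face (Suc p) k f then 1 else 0 :: bit)"
        unfolding z_def chain_boundary_sum
        by (simp add: lk chain_boundary_of lookup_single when_def sgn sgn' eq_commute [of h]
            del: sum.atMost_Suc)
      also have "\<dots> = (\<Sum>f\<in>A. D f) h"
        by (simp add: apply_sum D_def E_def del: sum.atMost_Suc)
      finally show ?thesis
        using A(3) by simp
    qed
    then obtain w where w: "chain_boundary (Suc p) z = frag_cmul 2 w"
        "Poly_Mapping.keys w \<subseteq> Poly_Mapping.keys (chain_boundary (Suc p) z)"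
      using even_chain_halve by (metis of_int_bit_eq_0_iff)
    then have "singular_chain p X w"
      using singular_chain_boundary_alt [OF z] by (auto simp: singular_chain_def)
    with van z w(1) have "pairing (Suc p) c z = 0"
      by blast
    then show "(\<Sum>f\<in>A. c (Suc p) f) = 0"
      by (simp add: z_def pairing_sum)
  qed
  obtain g :: "(((nat \<Rightarrow> real) \<Rightarrow> 'a) \<Rightarrow> bit) \<Rightarrow> bit"
    where g: "\<And>u v. g (u + v) = g u + g v" "\<And>f. f \<in> singular_simplex_set (Suc p) X \<Longrightarrow> g (D f) = c (Suc p) f"
    using bit_functional_exists [of "singular_simplex_set (Suc p) X" D "c (Suc p)", OF consistent] by metis
  have g_sum: "g (sum F A) = (\<Sum>i\<in>A. g (F i))" if "finite A" for F and A :: "nat set"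
    using that
  proof (induction A)
    case empty
    have "g 0 + g 0 = g 0"
      using g(1) [of 0 0] by simp
    then show ?case
      by (simp only: sum.empty add_cancel_left_left)
  qed (simp only: g(1) sum.insert not_False_eq_True)
  define b where "b q f = (if q = p \<and> singular_simplex p X f then g (E f) else 0)" for q f
  have b: "b \<in> cochains X"
    by (rule homogeneous_cochainsI [where p = p]) (auto simp: b_def)
  have "coboundary X b = c"
  proof (rule cochains_eqI)
    fix q f assume f: "singular_simplex q X f"
    show "coboundary X b q f = c q f"
    proof (cases "q = Suc p")
      case True
      have "coboundary X b q f = (\<Sum>k\<le>Suc p. g (E (singular_face (Suc p) k f)))"
        using f singular_simplex_singular_face [OF f] True
        by (simp add: coboundary_def b_def del: sum.atMost_Suc)
      also have "\<dots> = g (D f)"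
        by (simp add: D_def g_sum del: sum.atMost_Suc)
      finally show ?thesis
        using g(2) f True by simp
    next
      case False
      then show ?thesis
        using deg by (cases q) (auto simp: coboundary_def b_def)
    qed
  qed (use b c in auto)
  with b show ?thesis
    by blast
qed

text \<open>Iterated subdivision makes \<open>z\<close> small with respect to the cover, where
  \<open>c\<close> is zero, and the homotopy \<open>h\<close> compares the result with
  \<open>z\<close>. Of the two homotopy terms, the boundary is killed by \<open>c\<close> because
  \<open>c\<close> is a cocycle, and \<open>h\<close> applied to the boundary of \<open>z\<close> is
  even.\<close>

lemma coboundary_if_vanishes_on_cover:
  assumes op: "\<And>U. U \<in> \<C> \<Longrightarrow> openin X U" and cover: "topspace X \<subseteq> \<Union>\<C>"
    and c: "c \<in> cochains X" and deg: "\<And>q f. q \<noteq> Suc p \<Longrightarrow> c q f = 0"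
    and cocycle: "coboundary X c = 0"
    and van: "\<And>f U. U \<in> \<C> \<Longrightarrow> singular_simplex (Suc p) X f \<Longrightarrow> f ` standard_simplex (Suc p) \<subseteq> U
       \<Longrightarrow> c (Suc p) f = 0"
  shows "c \<in> coboundary X ` cochains X"
proof (rule coboundary_if_pairing_vanishes [OF c deg])
  fix z w assume z: "singular_chain (Suc p) X z" and w: "singular_chain p X w"
    and zw: "chain_boundary (Suc p) z = frag_cmul 2 w"
  obtain N where N: "\<And>m f. \<lbrakk>N \<le> m; f \<in> Poly_Mapping.keys ((singular_subdivision (Suc p) ^^ m) z)\<rbrakk>
      \<Longrightarrow> \<exists>V \<in> \<C>. f \<in> (standard_simplex (Suc p)) \<rightarrow> V"
    using sufficient_iterated_singular_subdivision_exists [OF op cover z] by metis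
  obtain h where h: "\<And>p. h p 0 = (0 :: 'a chain)" "\<And>p c1 c2. h p (c1 - c2) = h p c1 - h p c2"
    "\<And>p X c. singular_chain p X c \<Longrightarrow> singular_chain (Suc p) X (h p c)"
    "\<And>p X c. singular_chain p X c \<Longrightarrow> chain_boundary (Suc p) (h p c) + h (p - Suc 0) (chain_boundary p c)
                   = (singular_subdivision p ^^ N) c - c"
    using chain_homotopic_iterated_singular_subdivision by blast
  let ?s = "(singular_subdivision (Suc p) ^^ N) z"
  have s: "singular_chain (Suc p) X ?s"
    by (induction N) (simp_all add: z singular_chain_singular_subdivision)
  have "pairing (Suc p) c ?s = 0"
    unfolding pairing_def
  proof (rule sum.neutral, rule ballI)
    fix f assume f: "f \<in> Poly_Mapping.keys ?s"
    then obtain V where "V \<in> \<C>" "f ` standard_simplex (Suc p) \<subseteq> V"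
      using N [OF order_refl f] by blast
    moreover have "singular_simplex (Suc p) X f"
      using s f by (auto simp: singular_chain_def)
    ultimately show "of_int (Poly_Mapping.lookup ?s f) * c (Suc p) f = 0"
      using van by auto
  qed
  moreover have "pairing (Suc p) c (chain_boundary (Suc (Suc p)) (h (Suc p) z)) = 0"
    using pairing_coboundary [OF h(3) [OF z], of c] by (simp add: cocycle pairing_def)
  \<comment> \<open>\<open>h\<close> is only known to respect zero and differences, so doubling is
    expressed through subtraction.\<close>
  moreover have "h p (frag_cmul 2 w) = frag_cmul 2 (h p w)"
  proof -
    have "frag_cmul 2 v = v - (0 - v)" for v :: "'a chain"
      by (rule poly_mapping_eqI) (simp add: lookup_add)
    then show ?thesis
      by (simp add: h(1,2) del: diff_0)
  qed
  then have "pairing (Suc p) c (h p (chain_boundary (Suc p) z)) = 0"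
    by (simp add: zw pairing_cmul)
  ultimately show "pairing (Suc p) c z = 0"
    using arg_cong [OF h(4) [OF z], of "pairing (Suc p) c"] by (simp add: pairing_add pairing_diff)
qed

subsection \<open>Cohomology of the sphere\<close>

lemma homologous_rel_set_hom:
  "homologous_rel_set p X {} \<in> hom (relcycle_group p X {}) (homology_group (int p) X)"
  using normal.r_coset_hom_Mod [OF normal_subgroup_singular_relboundary_relcycle [of p X "{}"]]
  by (simp add: right_coset_singular_relboundary relative_homology_group_def)

text \<open>Homology groups are written multiplicatively, so the class of \<open>2 w\<close> is a
  square; the absence of elements of order two is transported from an isomorphic group
  \<open>H\<close>.\<close>

lemma homology_group_torsion_free_transfer:
  assumes iso: "homology_group (int p) X \<cong> H" and H: "group H"
    and tf: "\<And>x. x \<in> carrier H \<Longrightarrow> x \<otimes>\<^bsub>H\<^esub> x = \<one>\<^bsub>H\<^esub> \<Longrightarrow> x = \<one>\<^bsub>H\<^esub>"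
    and w: "singular_relcycle p X {} w" and b: "singular_relboundary p X {} (frag_cmul 2 w)"
  shows "singular_relboundary p X {} w"
proof -
  let ?G = "homology_group (int p) X" and ?h = "homologous_rel_set p X {} w"
  obtain f where f: "f \<in> iso ?G H"
    using iso by (auto simp: is_iso_def)
  have h: "?h \<in> carrier ?G"
    using w by (auto simp: carrier_relative_homology_group)
  have "frag_cmul 2 w = w + w"
    by (rule poly_mapping_eqI) (simp add: lookup_add)
  then have hh: "?h \<otimes>\<^bsub>?G\<^esub> ?h = \<one>\<^bsub>?G\<^esub>"
    using hom_mult [OF homologous_rel_set_hom, of w p X w] w b
    by (metis carrier_relcycle_group homologous_rel_set_eq_relboundary mem_Collect_eq mult_relcycle_group
        one_relative_homology_group)
  have fhom: "f \<in> hom ?G H" and inj: "inj_on f (carrier ?G)"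
    using f by (auto simp: iso_def bij_betw_def)
  have f1: "f \<one>\<^bsub>?G\<^esub> = \<one>\<^bsub>H\<^esub>"
    using fhom H by (intro hom_one) auto
  have "f ?h \<otimes>\<^bsub>H\<^esub> f ?h = \<one>\<^bsub>H\<^esub>"
    using hom_mult [OF fhom h h] hh f1 by simp
  then have "f ?h = f \<one>\<^bsub>?G\<^esub>"
    using tf f1 hom_in_carrier [OF fhom h] by simp
  then have "?h = \<one>\<^bsub>?G\<^esub>"
    using inj h by (meson group.is_monoid group_relative_homology_group inj_onD monoid.one_closed)
  then show ?thesis
    by (simp add: homologous_rel_set_eq_relboundary)
qed

lemma nsphere_homology_trivial:
  assumes "p \<noteq> 0" "p \<noteq> n" "singular_relcycle p (nsphere n) {} z"
  shows "singular_relboundary p (nsphere n) {} z"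
proof -
  let ?G = "homology_group (int p) (nsphere n)"
  have "trivial_group ?G"
    using reduced_homology_group_nsphere(2) [of "int p" n] assms(1,2) by (simp add: un_reduced_homology_group)
  moreover have "homologous_rel_set p (nsphere n) {} z \<in> carrier ?G"
    using assms(3) by (auto simp: carrier_relative_homology_group)
  ultimately have "homologous_rel_set p (nsphere n) {} z = \<one>\<^bsub>?G\<^esub>"
    by (auto simp: trivial_group_def)
  then show ?thesis
    by (simp add: homologous_rel_set_eq_relboundary)
qed

text \<open>Every homology group of the sphere is free: on the path components in degree 0, infinite
  cyclic in positive top degree, trivial elsewhere. Degree 0 is separate because the groups are not
  reduced.\<close>

lemma nsphere_homology_torsion_free:
  assumes w: "singular_relcycle p (nsphere n) {} w"
    and b: "singular_relboundary p (nsphere n) {} (frag_cmul 2 w)"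
  shows "singular_relboundary p (nsphere n) {} w"
proof -
  consider "p = 0" | "p \<noteq> 0" "p \<noteq> n" | "p \<noteq> 0" "p = n"
    by blast
  then show ?thesis
  proof cases
    case 1
    show ?thesis
    proof (rule homology_group_torsion_free_transfer [OF _ _ _ w b])
      show "homology_group (int p) (nsphere n) \<cong> free_Abelian_group (path_components_of (nsphere n))"
        using zeroth_homology_group 1 by simp
      show "x = \<one>\<^bsub>free_Abelian_group A\<^esub>"
        if "x \<otimes>\<^bsub>free_Abelian_group A\<^esub> x = \<one>\<^bsub>free_Abelian_group A\<^esub>" for x and A :: "(nat \<Rightarrow> real) set set"
      proof -
        have "Poly_Mapping.lookup x i + Poly_Mapping.lookup x i = 0" for i
          using that by (metis free_Abelian_group_def lookup_add lookup_zero monoid.select_convs(1,2))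
        then show ?thesis
          by (intro poly_mapping_eqI) (simp add: free_Abelian_group_def)
      qed
    qed auto
  next
    case 2
    then show ?thesis
      using nsphere_homology_trivial w by blast
  next
    case 3
    show ?thesis
    proof (rule homology_group_torsion_free_transfer [OF _ _ _ w b])
      show "homology_group (int p) (nsphere n) \<cong> integer_group"
        using reduced_homology_group_nsphere(1) [of n] 3 by (simp add: un_reduced_homology_group)
    qed (simp_all add: group_integer_group)
  qed
qed

text \<open>Since \<open>2 w\<close> is closed and chains are torsion-free, \<open>w\<close> is a
  cycle; without 2-torsion in homology it bounds some \<open>v\<close>. Subtracting
  \<open>2 v\<close> turns \<open>z\<close> into an integral cycle without changing any evaluation
  modulo 2.\<close>

lemma nsphere_mod2_cycle:
  assumes z: "singular_chain (Suc p) (nsphere n) z" and w: "singular_chain p (nsphere n) w"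
    and zw: "chain_boundary (Suc p) z = frag_cmul 2 w"
  obtains v where "singular_chain (Suc p) (nsphere n) v"
    "singular_relcycle (Suc p) (nsphere n) {} (z - frag_cmul 2 v)"
proof -
  have "frag_cmul 2 (chain_boundary p w) = 0"
    using chain_boundary_boundary [OF z] by (simp add: zw chain_boundary_cmul)
  then have "chain_boundary p w = 0"
    by (metis frag_cmul_eq_0_iff zero_neq_numeral)
  then have "singular_relcycle p (nsphere n) {} w"
    using w by (simp add: singular_cycle)
  moreover have "singular_relboundary p (nsphere n) {} (frag_cmul 2 w)"
    using z zw by (auto simp: singular_boundary)
  ultimately have "singular_relboundary p (nsphere n) {} w"
    by (rule nsphere_homology_torsion_free)
  then obtain v where v: "singular_chain (Suc p) (nsphere n) v" "chain_boundary (Suc p) v = w"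
    by (auto simp: singular_boundary)
  show thesis
  proof
    show "singular_relcycle (Suc p) (nsphere n) {} (z - frag_cmul 2 v)"
      using z v zw by (simp add: singular_cycle singular_chain_diff singular_chain_cmul
          chain_boundary_diff chain_boundary_cmul)
  qed (rule v(1))
qed

lemma pairing_boundary:
  assumes "coboundary X c = 0" "singular_relboundary p X {} z"
  shows "pairing p c z = 0"
proof -
  obtain d where "singular_chain (Suc p) X d" "chain_boundary (Suc p) d = z"
    using assms(2) by (auto simp: singular_boundary)
  then show ?thesis
    using pairing_coboundary [of p X d c] assms(1) by (simp add: pairing_def)
qed

lemma nsphere_cohomology_trivial:
  assumes c: "c \<in> cochains (nsphere n)" and deg: "\<And>q f. q \<noteq> Suc p \<Longrightarrow> c q f = 0"
    and cocycle: "coboundary (nsphere n) c = 0" and "Suc p \<noteq> n"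
  shows "c \<in> coboundary (nsphere n) ` cochains (nsphere n)"
proof (rule coboundary_if_pairing_vanishes [OF c deg])
  fix z w assume zw: "singular_chain (Suc p) (nsphere n) z" "singular_chain p (nsphere n) w"
    "chain_boundary (Suc p) z = frag_cmul 2 w"
  obtain v where v: "singular_relcycle (Suc p) (nsphere n) {} (z - frag_cmul 2 v)"
    using nsphere_mod2_cycle [OF zw] by blast
  then have "pairing (Suc p) c (z - frag_cmul 2 v) = 0"
    using assms(4) by (intro pairing_boundary [OF cocycle] nsphere_homology_trivial) auto
  then show "pairing (Suc p) c z = 0"
    by (simp add: pairing_diff pairing_cmul)
qed

text \<open>Cyclicity of the top homology group brought down to chains: the powers of the generating
  class are represented by the integer multiples of a cycle \<open>g\<close>.\<close>

lemma nsphere_homology_generator: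
  assumes "n \<noteq> 0"
  obtains g where "singular_relcycle n (nsphere n) {} g"
    "\<And>z. singular_relcycle n (nsphere n) {} z \<Longrightarrow> \<exists>k. singular_relboundary n (nsphere n) {} (z - frag_cmul k g)"
proof -
  let ?G = "homology_group (int n) (nsphere n)" and ?h = "homologous_rel_set n (nsphere n) {}"
  have "cyclic_group ?G"
    using cyclic_reduced_homology_group_nsphere [of "int n" n] assms by (simp add: un_reduced_homology_group)
  then obtain x where x: "x \<in> carrier ?G" "carrier ?G = range (\<lambda>k::int. x [^]\<^bsub>?G\<^esub> k)"
    using group.cyclic_group [OF group_relative_homology_group] by blast
  from x(1) obtain g where g: "singular_relcycle n (nsphere n) {} g" "x = ?h g"
    unfolding carrier_relative_homology_group by blast
  have pow: "?h g [^]\<^bsub>?G\<^esub> k = ?h (frag_cmul k g)" for k :: int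
  proof -
    have "g \<in> carrier (relcycle_group n (nsphere n) {})"
      using g(1) by simp
    then have "g [^]\<^bsub>relcycle_group n (nsphere n) {}\<^esub> k = frag_cmul k g"
      using group.int_pow_subgroup_generated [OF group_chain_group [of n "nsphere n"], of g "singular_relcycle_set n (nsphere n) {}" k]
        g(1) int_pow_free_Abelian_group [of g "singular_simplex_set n (nsphere n)" k]
      by (simp add: relcycle_group_def chain_group_def singular_relcycle singular_chain_def)
    then show ?thesis
      apply (rule_tac subst [OF right_coset_singular_relboundary])
      by (simp add: normal.FactGroup_int_pow normal_subgroup_singular_relboundary_relcycle
          relative_homology_group_def g(1))
  qed
  show thesis
  proof
    fix z assume z: "singular_relcycle n (nsphere n) {} z"
    then have "?h z \<in> carrier ?G"
      by (auto simp: carrier_relative_homology_group)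
    then obtain k where "?h z = ?h (frag_cmul k g)"
      using x g(2) pow by auto
    then have "homologous_rel n (nsphere n) {} z (frag_cmul k g)"
      by (simp only: homologous_rel_set_eq)
    then show "\<exists>k. singular_relboundary n (nsphere n) {} (z - frag_cmul k g)"
      unfolding homologous_rel_def by blast
  qed (rule g(1))
qed

text \<open>Evaluation on the generating cycle \<open>g\<close> detects the class, because every
  integral cycle is a multiple of \<open>g\<close> up to a boundary. Two nonzero classes both take
  the value 1 on \<open>g\<close>, so their sum takes the value 0.\<close>

lemma nsphere_cohomology_top:
  assumes c: "c \<in> cochains (nsphere (Suc p))" "\<And>q f. q \<noteq> Suc p \<Longrightarrow> c q f = 0"
      "coboundary (nsphere (Suc p)) c = 0" "c \<notin> coboundary (nsphere (Suc p)) ` cochains (nsphere (Suc p))"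
    and d: "d \<in> cochains (nsphere (Suc p))" "\<And>q f. q \<noteq> Suc p \<Longrightarrow> d q f = 0"
      "coboundary (nsphere (Suc p)) d = 0" "d \<notin> coboundary (nsphere (Suc p)) ` cochains (nsphere (Suc p))"
  shows "c + d \<in> coboundary (nsphere (Suc p)) ` cochains (nsphere (Suc p))"
proof -
  let ?S = "nsphere (Suc p)"
  obtain g where g: "singular_relcycle (Suc p) ?S {} g"
    "\<And>z. singular_relcycle (Suc p) ?S {} z \<Longrightarrow> \<exists>k. singular_relboundary (Suc p) ?S {} (z - frag_cmul k g)"
    using nsphere_homology_generator [of "Suc p"] by auto
  have *: "e \<in> coboundary ?S ` cochains ?S"
    if e: "e \<in> cochains ?S" "\<And>q f. q \<noteq> Suc p \<Longrightarrow> e q f = 0" "coboundary ?S e = 0" "pairing (Suc p) e g = 0" for e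
  proof (rule coboundary_if_pairing_vanishes [OF e(1,2)])
    fix z w assume zw: "singular_chain (Suc p) ?S z" "singular_chain p ?S w"
      "chain_boundary (Suc p) z = frag_cmul 2 w"
    obtain v where v: "singular_relcycle (Suc p) ?S {} (z - frag_cmul 2 v)"
      using nsphere_mod2_cycle [OF zw] by blast
    then obtain k where "singular_relboundary (Suc p) ?S {} (z - frag_cmul 2 v - frag_cmul k g)"
      using g(2) by blast
    then have "pairing (Suc p) e (z - frag_cmul 2 v - frag_cmul k g) = 0"
      by (rule pairing_boundary [OF e(3)])
    then show "pairing (Suc p) e z = 0"
      by (simp add: pairing_diff pairing_cmul e(4))
  qed
  have "pairing (Suc p) c g = 1" "pairing (Suc p) d g = 1"
    using * [OF c(1-3)] * [OF d(1-3)] c(4) d(4) by auto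
  then show ?thesis
    using c d by (intro *) (auto simp: pairing_add_cochain)
qed

subsection \<open>Lifting singular simplices to the sphere\<close>

definition dot :: "nat \<Rightarrow> (nat \<Rightarrow> real) \<Rightarrow> (nat \<Rightarrow> real) \<Rightarrow> real" where
  "dot n x y = (\<Sum>i\<le>n. x i * y i)"

definition antipode :: "(nat \<Rightarrow> real) \<Rightarrow> nat \<Rightarrow> real" where
  "antipode x = (\<lambda>i. - x i)"

text \<open>An arbitrary, discontinuous choice of a unit vector on each line; expressions quadratic
  in it nevertheless depend continuously on the line.\<close>

definition rep :: "(nat \<Rightarrow> real) set \<Rightarrow> nat \<Rightarrow> real" where
  "rep l = (SOME x. x \<in> l)"

lemma nsphere_iff: "x \<in> topspace (nsphere n) \<longleftrightarrow> dot n x x = 1 \<and> (\<forall>i>n. x i = 0)"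
  by (simp add: nsphere dot_def power2_eq_square)

lemma antipode_antipode [simp]: "antipode (antipode x) = x"
  by (simp add: antipode_def)

lemma dot_antipode [simp]: "dot n (antipode x) y = - dot n x y" "dot n x (antipode y) = - dot n x y"
  by (simp_all add: dot_def antipode_def sum_negf)

lemma antipode_in_nsphere: "x \<in> topspace (nsphere n) \<Longrightarrow> antipode x \<in> topspace (nsphere n)"
  by (simp add: nsphere_iff) (simp add: antipode_def)

lemma antipode_neq: "x \<in> topspace (nsphere n) \<Longrightarrow> antipode x \<noteq> x"
proof
  assume "x \<in> topspace (nsphere n)" "antipode x = x"
  then have "dot n x x = - dot n x x" "dot n x x = 1"
    using dot_antipode(1) [of n x x] by (simp_all add: nsphere_iff del: dot_antipode)
  then show False
    by simp
qed

lemma antipodal_class_eq_iff: "antipodal_class x = antipodal_class y \<longleftrightarrow> x = y \<or> x = antipode y"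
proof -
  have "antipodal_class x = {x, antipode x}" for x
    by (simp add: antipodal_class_def antipode_def)
  then show ?thesis
    by (metis antipode_antipode doubleton_eq_iff)
qed

lemma antipodal_class_antipode [simp]: "antipodal_class (antipode x) = antipodal_class x"
  by (simp add: antipodal_class_eq_iff)

lemma rep_cases: "rep (antipodal_class x) = x \<or> rep (antipodal_class x) = antipode x"
proof -
  have "rep (antipodal_class x) \<in> antipodal_class x"
    unfolding rep_def by (rule someI [of _ x]) (simp add: antipodal_class_def)
  then show ?thesis
    by (simp add: antipodal_class_def antipode_def)
qed

lemma antipodal_class_rep:
  assumes "l \<in> topspace (projective_space n)"
  shows "antipodal_class (rep l) = l" "rep l \<in> topspace (nsphere n)"
proof -
  obtain x where "x \<in> topspace (nsphere n)" "l = antipodal_class x"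
    using assms by (auto simp: topspace_projective_space)
  then show "antipodal_class (rep l) = l" "rep l \<in> topspace (nsphere n)"
    using rep_cases [of x] by (auto simp: antipode_in_nsphere)
qed

lemma continuous_map_antipode: "continuous_map (nsphere n) (nsphere n) antipode"
proof -
  have "continuous_map (nsphere n) euclideanreal (\<lambda>x. antipode x i)" for i
    unfolding antipode_def by (intro continuous_map_minus continuous_map_nsphere_projection)
  then have "continuous_map (nsphere n) (powertop_real UNIV) antipode"
    by (simp add: continuous_map_componentwise_UNIV)
  moreover have "antipode x \<in> {x. (\<Sum>i\<le>n. (x i)\<^sup>2) = 1 \<and> (\<forall>i>n. x i = 0)}" if "x \<in> topspace (nsphere n)" for x
    using antipode_in_nsphere [OF that] by (simp add: nsphere)
  ultimately show ?thesis
    by (subst (2) nsphere) (auto simp: continuous_map_in_subtopology)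
qed

lemma continuous_map_antipodal_class: "continuous_map (nsphere n) (projective_space n) antipodal_class"
  by (rule quotient_imp_continuous_map [OF quotient_map_antipodal_class])

text \<open>The sign ambiguity cancels in the product, so the entries of the orthogonal projection
  onto the line descend along the quotient map.\<close>

lemma continuous_map_rep_product:
  "continuous_map (projective_space n) euclideanreal (\<lambda>l. rep l i * rep l j)"
proof -
  have "rep (antipodal_class x) i * rep (antipodal_class x) j = x i * x j" for x
    using rep_cases [of x] by (auto simp: antipode_def)
  then have "continuous_map (nsphere n) euclideanreal ((\<lambda>l. rep l i * rep l j) \<circ> antipodal_class)"
    by (simp add: o_def continuous_map_nsphere_projection continuous_map_real_mult)
  then show ?thesis
    by (simp add: continuous_compose_quotient_map_eq [OF quotient_map_antipodal_class])
qed

definition vertex0 :: "nat \<Rightarrow> real" where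
  "vertex0 = (\<lambda>j. if j = 0 then 1 else 0)"

lemma vertex0_in_standard_simplex [simp]: "vertex0 \<in> standard_simplex p"
  by (simp add: vertex0_def)

lemma compact_standard_simplex: "compact (standard_simplex p)"
  using compactin_standard_simplex [of p] by (simp add: euclidean_product_topology)

lemma connected_standard_simplex: "connected (standard_simplex p)"
  using connectedin_standard_simplex [of p] by (simp add: euclidean_product_topology)

lemma rep_dot_square:
  "(\<Sum>i\<le>n. \<Sum>j\<le>n. (x i * x j) * (y i * y j)) = (dot n x y)\<^sup>2"
  by (simp add: dot_def power2_eq_square sum_product algebra_simps)

text \<open>A path of lines is lifted by projecting the previous lift orthogonally onto the next line;
  this is possible as long as consecutive lines are not orthogonal.  All the radii of the simplex
  are lifted simultaneously.\<close>

lemma lift_exists: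
  assumes \<sigma>: "singular_simplex p (projective_space n) \<sigma>"
  obtains s where "singular_simplex p (nsphere n) s" "simplex_map p antipodal_class s = \<sigma>"
proof -
  let ?D = "standard_simplex p"
  \<comment> \<open>The matrix of the orthogonal projection onto the line \<open>\<sigma> t\<close>,
    continuous in \<open>t\<close> although \<open>rep\<close> is not.\<close>
  define M where "M t i j = rep (\<sigma> t) i * rep (\<sigma> t) j" for t i j
  have \<sigma>_in: "\<sigma> t \<in> topspace (projective_space n)" if "t \<in> ?D" for t
    using \<sigma> that by (auto simp: singular_simplex_def continuous_map_def Pi_iff)
  note rep = antipodal_class_rep [OF \<sigma>_in]
  have contM: "continuous_on ?D (\<lambda>t. M t i j)" for i j
  proof -
    have "continuous_map (subtopology (powertop_real UNIV) ?D) euclideanreal ((\<lambda>l. rep l i * rep l j) \<circ> \<sigma>)"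
      using \<sigma> by (intro continuous_map_compose [OF _ continuous_map_rep_product [of n]]) (simp add: singular_simplex_def)
    then show ?thesis
      by (simp add: euclidean_product_topology M_def o_def)
  qed
  define H where "H t u = (\<lambda>i. (1 - u) * vertex0 i + u * t i)" for t :: "nat \<Rightarrow> real" and u :: real
  have H_in: "H t u \<in> ?D" if "t \<in> ?D" "u \<in> {0..1}" for t u
    using that convex_standard_simplex [of vertex0 p t u] by (simp add: H_def)
  have coord': "continuous_on A (\<lambda>z. f z i)" if "continuous_on A f"
    for A i and f :: "'b::topological_space \<Rightarrow> nat \<Rightarrow> real"
    using continuous_on_product_then_coordinatewise [OF that] .
  have contMH: "continuous_on A (\<lambda>z. M (H (f z) (g z)) i j)"
    if "continuous_on A f" "continuous_on A g" "\<And>z. z \<in> A \<Longrightarrow> f z \<in> ?D \<and> g z \<in> {0..1}"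
    for A i j and f :: "'b::topological_space \<Rightarrow> nat \<Rightarrow> real" and g
  proof (rule continuous_on_compose2 [OF contM])
    show "continuous_on A (\<lambda>z. H (f z) (g z))"
    proof (rule continuous_on_coordinatewise_then_product)
      show "continuous_on A (\<lambda>z. H (f z) (g z) i)" for i
        unfolding H_def using coord' [OF that(1), of i] that(2)
        by (intro continuous_on_add continuous_on_mult continuous_on_diff continuous_on_const)
    qed
  qed (use that H_in in auto)
  define K where "K = ?D \<times> {0..1::real} \<times> {0..1::real}"
  \<comment> \<open>The squared cosine of the angle between the lines at two parameters of one
    radius. It is 1 for equal parameters, so uniform continuity on the compact set \<open>K\<close>
    keeps nearby lines from being orthogonal, with one bound for all radii.\<close>
  define G where "G z = (\<Sum>i\<le>n. \<Sum>j\<le>n. M (H (fst z) (fst (snd z))) i j * M (H (fst z) (snd (snd z))) i j)"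
    for z
  have G_eq: "G (t, u, u') = (dot n (rep (\<sigma> (H t u))) (rep (\<sigma> (H t u'))))\<^sup>2" for t u u'
    by (simp add: G_def M_def flip: rep_dot_square)
  have "continuous_on K G"
    unfolding G_def by (intro continuous_intros contMH) (auto simp: K_def)
  moreover have "compact K"
    by (simp add: K_def compact_Times compact_standard_simplex)
  ultimately have "uniformly_continuous_on K G"
    by (simp add: compact_uniformly_continuous)
  then obtain \<delta> where \<delta>: "\<delta> > 0"
    "\<And>z z'. z \<in> K \<Longrightarrow> z' \<in> K \<Longrightarrow> dist z' z < \<delta> \<Longrightarrow> dist (G z') (G z) < 1"
    unfolding uniformly_continuous_on_def by (metis zero_less_one)
  obtain N where N: "N \<noteq> 0" "1 / real N < \<delta>"
    using \<delta>(1) by (metis not_gr_zero real_arch_inverse inverse_eq_divide)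
  have nonorth: "dot n (rep (\<sigma> (H t u'))) (rep (\<sigma> (H t u))) \<noteq> 0"
    if "t \<in> ?D" "u \<in> {0..1}" "u' \<in> {0..1}" "\<bar>u' - u\<bar> < \<delta>" for t u u'
  proof -
    have "dist (t, u', u) (t, u, u) < \<delta>"
      using that by (simp add: dist_Pair_Pair dist_real_def)
    then have "dist (G (t, u', u)) (G (t, u, u)) < 1"
      using that by (intro \<delta>(2)) (auto simp: K_def)
    moreover have "G (t, u, u) = 1"
      using rep(2) [OF H_in [OF that(1,2)]] by (simp add: G_eq nsphere_iff)
    ultimately show ?thesis
      by (auto simp: G_eq dist_real_def)
  qed
  have step: "k \<le> N \<Longrightarrow> \<exists>y. (\<forall>i. continuous_on ?D (\<lambda>t. y t i)) \<and>
      (\<forall>t\<in>?D. y t \<in> topspace (nsphere n) \<and> antipodal_class (y t) = \<sigma> (H t (real k / real N)))" for k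
  proof (induction k)
    case 0
    have "H t 0 = vertex0" for t
      by (simp add: H_def)
    then show ?case
      using rep [of vertex0] by (intro exI [of _ "\<lambda>t. rep (\<sigma> vertex0)"]) auto
  next
    case (Suc k)
    then obtain y where y: "\<And>i. continuous_on ?D (\<lambda>t. y t i)"
      "\<And>t. t \<in> ?D \<Longrightarrow> y t \<in> topspace (nsphere n) \<and> antipodal_class (y t) = \<sigma> (H t (real k / real N))"
      by auto
    define u where "u = real (Suc k) / real N"
    have u: "u \<in> {0..1}" "real k / real N \<in> {0..1}" "\<bar>u - real k / real N\<bar> < \<delta>"
      using Suc.prems N by (auto simp: u_def field_simps abs_if)
    \<comment> \<open>The projection of \<open>y t\<close> onto the next line, divided by its
      length; both are written with \<open>M\<close> instead of \<open>rep\<close> so that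
      continuity is visible.\<close>
    define y' where "y' t = (\<lambda>i. (\<Sum>j\<le>n. M (H t u) i j * y t j) /
      sqrt (\<Sum>i\<le>n. \<Sum>j\<le>n. M (H t u) i j * (y t i * y t j)))" for t
    have y'_eq: "(\<Sum>i\<le>n. \<Sum>j\<le>n. M (H t u) i j * (y t i * y t j)) = (dot n (rep (\<sigma> (H t u))) (y t))\<^sup>2"
      "y' t = (\<lambda>i. rep (\<sigma> (H t u)) i * (dot n (rep (\<sigma> (H t u))) (y t) / \<bar>dot n (rep (\<sigma> (H t u))) (y t)\<bar>))"
      for t
    proof -
      show *: "(\<Sum>i\<le>n. \<Sum>j\<le>n. M (H t u) i j * (y t i * y t j)) = (dot n (rep (\<sigma> (H t u))) (y t))\<^sup>2"
        by (simp add: M_def flip: rep_dot_square)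
      have "(\<Sum>j\<le>n. M (H t u) i j * y t j) = rep (\<sigma> (H t u)) i * dot n (rep (\<sigma> (H t u))) (y t)" for i
        by (simp add: M_def dot_def sum_distrib_left mult.assoc)
      then show "y' t = (\<lambda>i. rep (\<sigma> (H t u)) i * (dot n (rep (\<sigma> (H t u))) (y t) / \<bar>dot n (rep (\<sigma> (H t u))) (y t)\<bar>))"
        by (simp add: y'_def *)
    qed
    have nz: "dot n (rep (\<sigma> (H t u))) (y t) \<noteq> 0" if t: "t \<in> ?D" for t
    proof -
      have "y t = rep (\<sigma> (H t (real k / real N))) \<or> y t = antipode (rep (\<sigma> (H t (real k / real N))))"
        using y(2) [OF t] rep(1) [OF H_in [OF t u(2)]] by (metis antipodal_class_eq_iff)
      then show ?thesis
        using nonorth [OF t u(2,1,3)] by auto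
    qed
    show ?case
    proof (intro exI [of _ y'] conjI allI ballI)
      show "continuous_on ?D (\<lambda>t. y' t i)" for i
        unfolding y'_def using nz u
        by (intro continuous_intros contMH y(1)) (auto simp: y'_eq)
    next
      fix t assume t: "t \<in> ?D"
      have "y' t = rep (\<sigma> (H t u)) \<or> y' t = antipode (rep (\<sigma> (H t u)))"
        using nz [OF t] by (auto simp: y'_eq(2) antipode_def abs_if)
      then show "y' t \<in> topspace (nsphere n)" "antipodal_class (y' t) = \<sigma> (H t (real (Suc k) / real N))"
        unfolding u_def [symmetric] using rep [OF H_in [OF t u(1)]]
        by (elim disjE; simp only: antipode_in_nsphere antipodal_class_antipode)+
    qed
  qed
  have "H t 1 = t" for t
    by (simp add: H_def)
  then have "\<exists>y. (\<forall>i. continuous_on ?D (\<lambda>t. y t i)) \<and>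
      (\<forall>t\<in>?D. y t \<in> topspace (nsphere n) \<and> antipodal_class (y t) = \<sigma> t)"
    using step [OF order_refl] N(1) by simp
  then obtain y where y: "\<And>i. continuous_on ?D (\<lambda>t. y t i)"
      "\<And>t. t \<in> ?D \<Longrightarrow> y t \<in> topspace (nsphere n) \<and> antipodal_class (y t) = \<sigma> t"
    by metis
  have "continuous_map (subtopology (powertop_real UNIV) ?D) (nsphere n) y"
    using y by (auto simp: nsphere continuous_map_in_subtopology
        euclidean_product_topology intro: continuous_on_coordinatewise_then_product)
  then have "singular_simplex p (nsphere n) (restrict y ?D)"
    by (simp add: singular_simplex_def continuous_map_eq [of _ _ y])
  moreover have "simplex_map p antipodal_class (restrict y ?D) = \<sigma>"
    using \<sigma> y(2) by (auto simp: simplex_map_def singular_simplex_def extensional_def fun_eq_iff)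
  ultimately show thesis
    by (rule that)
qed

lemma singular_simplex_antipode:
  "singular_simplex p (nsphere n) s \<Longrightarrow> singular_simplex p (nsphere n) (simplex_map p antipode s)"
  by (rule singular_simplex_simplex_map [OF _ continuous_map_antipode])

lemma singular_simplex_in: "singular_simplex p X s \<Longrightarrow> t \<in> standard_simplex p \<Longrightarrow> s t \<in> topspace X"
  by (auto simp: singular_simplex_def continuous_map_def Pi_iff)

lemma continuous_on_singular_simplex:
  assumes "singular_simplex p (nsphere n) s"
  shows "continuous_on (standard_simplex p) (\<lambda>t. s t i)"
proof -
  have "continuous_map (subtopology (powertop_real UNIV) (standard_simplex p)) euclideanreal ((\<lambda>x. x i) \<circ> s)"
    using assms by (intro continuous_map_compose [OF _ continuous_map_nsphere_projection [of n]])
      (simp add: singular_simplex_def)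
  then show ?thesis
    by (simp add: o_def euclidean_product_topology)
qed

text \<open>The inner product of two lifts is continuous and takes only the values 1 and -1, so it
  is constant on the connected simplex.\<close>

lemma lift_unique:
  assumes s: "singular_simplex p (nsphere n) s" and s': "singular_simplex p (nsphere n) s'"
    and eq: "simplex_map p antipodal_class s = simplex_map p antipodal_class s'"
  shows "s' = s \<or> s' = simplex_map p antipode s"
proof -
  let ?D = "standard_simplex p"
  have pm: "s' t = s t \<or> s' t = antipode (s t)" if "t \<in> ?D" for t
  proof -
    have "antipodal_class (s' t) = antipodal_class (s t)"
      using that fun_cong [OF eq, of t] by (simp add: simplex_map_def)
    then show ?thesis
      by (simp add: antipodal_class_eq_iff)
  qed
  have unit: "dot n (s t) (s t) = 1" if "t \<in> ?D" for t
    using singular_simplex_in [OF s that] by (simp add: nsphere_iff)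
  have "continuous_on ?D (\<lambda>t. dot n (s t) (s' t))"
    unfolding dot_def
    by (intro continuous_intros continuous_on_singular_simplex [OF s] continuous_on_singular_simplex [OF s'])
  moreover have "(\<lambda>t. dot n (s t) (s' t)) ` ?D \<subseteq> {1, -1}"
    using pm unit by fastforce
  ultimately have "(\<lambda>t. dot n (s t) (s' t)) constant_on ?D"
    by (intro continuous_finite_range_constant connected_standard_simplex)
      (auto intro: finite_subset [of _ "{1, -1}"])
  then obtain d where d: "\<And>t. t \<in> ?D \<Longrightarrow> dot n (s t) (s' t) = d"
    by (auto simp: constant_on_def)
  have ext: "s \<in> extensional ?D" "s' \<in> extensional ?D"
    using s s' by (auto simp: singular_simplex_def)
  show ?thesis
  proof (cases "d = 1")
    case True
    have "s' t = s t" if "t \<in> ?D" for t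
      using pm [OF that] d [OF that] unit [OF that] True by auto
    then show ?thesis
      using ext by (auto intro: extensionalityI)
  next
    case False
    have "s' t = antipode (s t)" if "t \<in> ?D" for t
      using pm [OF that] d [OF that] unit [OF that] False by auto
    then have "s' = simplex_map p antipode s"
      using ext(2) by (intro extensionalityI [of _ ?D]) (auto simp: simplex_map_def)
    then show ?thesis ..
  qed
qed

subsection \<open>Pulling cochains back\<close>

definition pullback :: "'b topology \<Rightarrow> ('b \<Rightarrow> 'a) \<Rightarrow> 'a cochain \<Rightarrow> 'b cochain" where
  "pullback X g c = (\<lambda>p s. if singular_simplex p X s then c p (simplex_map p g s) else 0)"

lemma pullback_cochains:
  assumes "c \<in> cochains Y"
  shows "pullback X g c \<in> cochains X"
proof (rule cochainsI_degrees)
  show "p \<in> {p. \<exists>f. c p f \<noteq> 0}" if "pullback X g c p f \<noteq> 0" for p f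
    using that by (auto simp: pullback_def split: if_splits)
qed (use assms in \<open>simp_all only: finite_cochain_degrees pullback_def if_False\<close>)

lemma pullback_add: "pullback X g (c + d) = pullback X g c + pullback X g d"
  by (auto simp: pullback_def fun_eq_iff)

lemma pullback_0 [simp]: "pullback X g 0 = 0"
  by (simp add: pullback_def fun_eq_iff)

lemma singular_face_simplex_map':
  assumes "1 \<le> p" "k \<le> p"
  shows "singular_face p k (simplex_map p g s) = simplex_map (p - Suc 0) g (singular_face p k s)"
  using singular_face_simplex_map [OF assms, of g s]
  by (auto simp: simplex_map_def singular_face_def)

lemma front_face_simplex_map:
  assumes "i \<le> p"
  shows "front_face i (simplex_map p g s) = simplex_map i g (front_face i s)"
  using standard_simplex_mono [OF assms] by (auto simp: front_face_def simplex_map_def fun_eq_iff)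

lemma back_face_simplex_map:
  assumes "i \<le> p"
  shows "back_face p i (simplex_map p g s) = simplex_map (p - i) g (back_face p i s)"
  using vertex_shift_in_standard_simplex [OF assms]
  by (auto simp: back_face_eq simplex_map_def fun_eq_iff)

lemma pullback_coboundary:
  assumes "continuous_map X Y g"
  shows "pullback X g (coboundary Y c) = coboundary X (pullback X g c)"
proof (intro ext)
  fix p s
  show "pullback X g (coboundary Y c) p s = coboundary X (pullback X g c) p s"
    using singular_simplex_singular_face [of p X s] singular_simplex_simplex_map [OF _ assms, of p s]
    by (auto simp: pullback_def coboundary_def singular_face_simplex_map')
qed

lemma pullback_cup:
  assumes "continuous_map X Y g"
  shows "pullback X g (cup Y c d) = cup X (pullback X g c) (pullback X g d)"
proof (intro ext)
  fix p s
  show "pullback X g (cup Y c d) p s = cup X (pullback X g c) (pullback X g d) p s"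
    using singular_simplex_front_face [of p X s] singular_simplex_back_face [of p X s]
      singular_simplex_simplex_map [OF _ assms, of p s]
    by (auto simp: pullback_def cup_def front_face_simplex_map back_face_simplex_map)
qed

subsection \<open>The transfer\<close>

definition lift :: "nat \<Rightarrow> nat \<Rightarrow> ((nat \<Rightarrow> real) \<Rightarrow> (nat \<Rightarrow> real) set) \<Rightarrow> (nat \<Rightarrow> real) \<Rightarrow> nat \<Rightarrow> real" where
  "lift n p \<sigma> = (SOME s. singular_simplex p (nsphere n) s \<and> simplex_map p antipodal_class s = \<sigma>)"

text \<open>The sum over the two lifts is symmetric, so the choice made by \<open>lift\<close> does
  not affect it.\<close>

definition transfer :: "nat \<Rightarrow> (nat \<Rightarrow> real) cochain \<Rightarrow> (nat \<Rightarrow> real) set cochain" where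
  "transfer n u = (\<lambda>p \<sigma>. if singular_simplex p (projective_space n) \<sigma>
     then u p (lift n p \<sigma>) + u p (simplex_map p antipode (lift n p \<sigma>)) else 0)"

definition descend :: "nat \<Rightarrow> (nat \<Rightarrow> real) cochain \<Rightarrow> (nat \<Rightarrow> real) set cochain" where
  "descend n u = (\<lambda>p \<sigma>. if singular_simplex p (projective_space n) \<sigma> then u p (lift n p \<sigma>) else 0)"

lemma lift:
  assumes "singular_simplex p (projective_space n) \<sigma>"
  shows "singular_simplex p (nsphere n) (lift n p \<sigma>)" "simplex_map p antipodal_class (lift n p \<sigma>) = \<sigma>"
proof -
  obtain s where "singular_simplex p (nsphere n) s \<and> simplex_map p antipodal_class s = \<sigma>"
    using lift_exists [OF assms] by metis
  then have "singular_simplex p (nsphere n) (lift n p \<sigma>) \<and> simplex_map p antipodal_class (lift n p \<sigma>) = \<sigma>"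
    unfolding lift_def
    by (rule someI [where P = "\<lambda>s. singular_simplex p (nsphere n) s \<and> simplex_map p antipodal_class s = \<sigma>"])
  then show "singular_simplex p (nsphere n) (lift n p \<sigma>)" "simplex_map p antipodal_class (lift n p \<sigma>) = \<sigma>"
    by auto
qed

lemma simplex_map_antipode_antipode:
  "singular_simplex p X s \<Longrightarrow> simplex_map p antipode (simplex_map p antipode s) = s"
  by (auto simp: simplex_map_def singular_simplex_def extensional_def fun_eq_iff)

lemma simplex_map_antipodal_class_antipode:
  "simplex_map p antipodal_class (simplex_map p antipode s) = simplex_map p antipodal_class s"
  by (auto simp: simplex_map_def fun_eq_iff)

lemma singular_simplex_antipodal_class:
  "singular_simplex p (nsphere n) s \<Longrightarrow> singular_simplex p (projective_space n) (simplex_map p antipodal_class s)"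
  by (rule singular_simplex_simplex_map [OF _ continuous_map_antipodal_class])

lemma lift_simplex_map:
  assumes "singular_simplex p (nsphere n) s"
  shows "lift n p (simplex_map p antipodal_class s) = s \<or>
    lift n p (simplex_map p antipodal_class s) = simplex_map p antipode s"
  using lift [OF singular_simplex_antipodal_class [OF assms]] lift_unique [OF assms] by metis

lemma transfer_simplex_map:
  assumes "singular_simplex p (nsphere n) s"
  shows "transfer n u p (simplex_map p antipodal_class s) = u p s + u p (simplex_map p antipode s)"
  using lift_simplex_map [OF assms] singular_simplex_antipodal_class [OF assms]
  by (auto simp: transfer_def simplex_map_antipode_antipode [OF assms] add.commute)

lemma pullback_antipodal_class_cochains [simp]:
  "c \<in> cochains (projective_space n) \<Longrightarrow> pullback (nsphere n) antipodal_class c \<in> cochains (nsphere n)"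
  by (rule pullback_cochains)

lemma projective_cochains_eqI:
  assumes "c \<in> cochains (projective_space n)" "d \<in> cochains (projective_space n)"
    and "\<And>p s. singular_simplex p (nsphere n) s \<Longrightarrow>
      c p (simplex_map p antipodal_class s) = d p (simplex_map p antipodal_class s)"
  shows "c = d"
  by (rule cochains_eqI [OF assms(1,2)]) (metis assms(3) lift)

lemma transfer_cochains [simp]:
  assumes "u \<in> cochains (nsphere n)"
  shows "transfer n u \<in> cochains (projective_space n)"
proof (rule cochainsI_degrees)
  show "p \<in> {p. \<exists>f. u p f \<noteq> 0}" if "transfer n u p f \<noteq> 0" for p f
    using that by (auto simp: transfer_def split: if_splits) (metis add_0 bit_not_zero_iff)
qed (use assms in \<open>simp_all only: finite_cochain_degrees transfer_def if_False\<close>)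

lemma descend_cochains [simp]:
  assumes "u \<in> cochains (nsphere n)"
  shows "descend n u \<in> cochains (projective_space n)"
proof (rule cochainsI_degrees)
  show "p \<in> {p. \<exists>f. u p f \<noteq> 0}" if "descend n u p f \<noteq> 0" for p f
    using that by (auto simp: descend_def split: if_splits)
qed (use assms in \<open>simp_all only: finite_cochain_degrees descend_def if_False\<close>)

lemma transfer_add: "transfer n (u + v) = transfer n u + transfer n v"
  by (auto simp: transfer_def fun_eq_iff algebra_simps)

lemma transfer_coboundary:
  assumes "u \<in> cochains (nsphere n)"
  shows "transfer n (coboundary (nsphere n) u) = coboundary (projective_space n) (transfer n u)"
proof (rule projective_cochains_eqI)
  fix p s assume s: "singular_simplex p (nsphere n) s"
  show "transfer n (coboundary (nsphere n) u) p (simplex_map p antipodal_class s)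
    = coboundary (projective_space n) (transfer n u) p (simplex_map p antipodal_class s)"
  proof (cases "1 \<le> p")
    case True
    then show ?thesis
      using s singular_simplex_singular_face [OF s True] singular_simplex_antipode [OF s]
        singular_simplex_antipodal_class [OF s]
      by (simp add: transfer_simplex_map coboundary_def singular_face_simplex_map' sum.distrib)
  next
    case False
    then show ?thesis
      using s by (simp add: transfer_simplex_map coboundary_def)
  qed
qed (use assms in auto)

lemma transfer_pullback [simp]:
  assumes "c \<in> cochains (projective_space n)"
  shows "transfer n (pullback (nsphere n) antipodal_class c) = 0"
proof (rule projective_cochains_eqI)
  fix p s assume s: "singular_simplex p (nsphere n) s"
  then show "transfer n (pullback (nsphere n) antipodal_class c) p (simplex_map p antipodal_class s)
    = 0 p (simplex_map p antipodal_class s)"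
    using singular_simplex_antipode [OF s]
    by (simp add: transfer_simplex_map pullback_def simplex_map_antipodal_class_antipode)
qed (use assms in auto)

text \<open>Modulo 2, zero transfer means invariance under the antipode, and then the value on the
  chosen lift is the value on either. This is the exactness of pullback followed by
  transfer.\<close>

lemma pullback_descend:
  assumes u: "u \<in> cochains (nsphere n)" and "transfer n u = 0"
  shows "pullback (nsphere n) antipodal_class (descend n u) = u"
proof (rule cochains_eqI)
  fix p s assume s: "singular_simplex p (nsphere n) s"
  have "u p s + u p (simplex_map p antipode s) = 0"
    using transfer_simplex_map [OF s, of u] assms(2) by simp
  then have "u p (simplex_map p antipode s) = u p s"
    by (simp add: bit_add_eq_0_iff)
  then show "pullback (nsphere n) antipodal_class (descend n u) p s = u p s"
    using lift_simplex_map [OF s] s singular_simplex_antipodal_class [OF s]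
    by (auto simp: pullback_def descend_def)
qed (use u in auto)

lemma pullback_antipodal_class_inj:
  assumes "c \<in> cochains (projective_space n)" "d \<in> cochains (projective_space n)"
    and "pullback (nsphere n) antipodal_class c = pullback (nsphere n) antipodal_class d"
  shows "c = d"
proof (rule projective_cochains_eqI [OF assms(1,2)])
  fix p s assume "singular_simplex p (nsphere n) s"
  then show "c p (simplex_map p antipodal_class s) = d p (simplex_map p antipodal_class s)"
    using fun_cong [OF fun_cong [OF assms(3)], of p s] by (simp add: pullback_def)
qed

text \<open>The indicator function of a fundamental domain of the antipodal action.\<close>

definition sheet :: "nat \<Rightarrow> (nat \<Rightarrow> real) cochain" where
  "sheet n = (\<lambda>p s. if p = 0 \<and> singular_simplex 0 (nsphere n) s \<and>
     s vertex0 = rep (antipodal_class (s vertex0)) then 1 else 0)"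

text \<open>The first Stiefel-Whitney class of the double cover.\<close>

definition sw :: "nat \<Rightarrow> (nat \<Rightarrow> real) set cochain" where
  "sw n = descend n (coboundary (nsphere n) (sheet n))"

lemma sheet_cochains [simp]: "sheet n \<in> cochains (nsphere n)"
  by (rule homogeneous_cochainsI [where p = 0]) (auto simp: sheet_def)

lemma sheet_antipode:
  assumes s: "singular_simplex 0 (nsphere n) s"
  shows "sheet n 0 s + sheet n 0 (simplex_map 0 antipode s) = 1"
proof -
  have "antipode (s vertex0) \<noteq> s vertex0"
    using singular_simplex_in [OF s vertex0_in_standard_simplex] by (rule antipode_neq)
  moreover have "simplex_map 0 antipode s vertex0 = antipode (s vertex0)"
    by (simp add: simplex_map_def)
  ultimately show ?thesis
    using s singular_simplex_antipode [OF s] rep_cases [of "s vertex0"] by (auto simp: sheet_def)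
qed

lemma cup_sheet:
  assumes "singular_simplex p (nsphere n) s"
  shows "cup (nsphere n) (sheet n) u p s = sheet n 0 (front_face 0 s) * u p s"
proof -
  have "cup (nsphere n) (sheet n) u p s
      = (\<Sum>i\<in>{0}. sheet n i (front_face i s) * u (p - i) (back_face p i s))"
    unfolding cup_def if_P [OF assms] by (rule sum.mono_neutral_right) (auto simp: sheet_def)
  then show ?thesis
    using assms by simp
qed

text \<open>Exactly one of the two lifts has its first vertex in the chosen sheet, so multiplication
  by \<open>sheet\<close> is a section of the transfer. It does not commute with the coboundary, and
  the defect is the product with \<open>sw\<close>.\<close>

lemma transfer_cup_sheet:
  assumes c: "c \<in> cochains (projective_space n)"
  shows "transfer n (cup (nsphere n) (sheet n) (pullback (nsphere n) antipodal_class c)) = c"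
proof (rule projective_cochains_eqI)
  fix p s assume s: "singular_simplex p (nsphere n) s"
  have "transfer n (cup (nsphere n) (sheet n) (pullback (nsphere n) antipodal_class c)) p (simplex_map p antipodal_class s)
    = (sheet n 0 (front_face 0 s) + sheet n 0 (simplex_map 0 antipode (front_face 0 s))) *
       c p (simplex_map p antipodal_class s)"
    using s singular_simplex_antipode [OF s]
    by (simp add: transfer_simplex_map cup_sheet front_face_simplex_map pullback_def
        simplex_map_antipodal_class_antipode distrib_right)
  then show "transfer n (cup (nsphere n) (sheet n) (pullback (nsphere n) antipodal_class c)) p (simplex_map p antipodal_class s)
    = c p (simplex_map p antipodal_class s)"
    using sheet_antipode [OF singular_simplex_front_face [OF s, of 0]] by simp
qed (use c in auto)

lemma transfer_sheet: "transfer n (sheet n) = unit_cochain (projective_space n)"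
proof (rule projective_cochains_eqI)
  fix p s assume s: "singular_simplex p (nsphere n) s"
  show "transfer n (sheet n) p (simplex_map p antipodal_class s) =
    unit_cochain (projective_space n) p (simplex_map p antipodal_class s)"
  proof (cases "p = 0")
    case True
    then show ?thesis
      using s sheet_antipode [of n s] singular_simplex_antipodal_class [OF s]
      by (simp add: transfer_simplex_map unit_cochain_def)
  next
    case False
    then show ?thesis
      using s by (simp add: transfer_simplex_map unit_cochain_def sheet_def)
  qed
qed auto

text \<open>The transfer of \<open>sheet\<close> is the unit, a cocycle; so the coboundary of
  \<open>sheet\<close> has zero transfer and descends to projective space.\<close>

lemma pullback_sw: "pullback (nsphere n) antipodal_class (sw n) = coboundary (nsphere n) (sheet n)"
  unfolding sw_def by (rule pullback_descend) (simp_all add: transfer_coboundary transfer_sheet)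

lemma sw_cochains [simp]: "sw n \<in> cochains (projective_space n)"
  by (simp add: sw_def)

lemma sw_degree: "q \<noteq> 1 \<Longrightarrow> sw n q f = 0"
  by (auto simp: sw_def descend_def coboundary_def sheet_def)

lemma coboundary_sw [simp]: "coboundary (projective_space n) (sw n) = 0"
proof (rule pullback_antipodal_class_inj [of _ n])
  show "pullback (nsphere n) antipodal_class (coboundary (projective_space n) (sw n))
      = pullback (nsphere n) antipodal_class 0"
    by (simp add: pullback_coboundary [OF continuous_map_antipodal_class] pullback_sw)
qed auto

lemma coboundary_cup_sheet:
  assumes c: "c \<in> cochains (projective_space n)" "coboundary (projective_space n) c = 0"
  shows "coboundary (nsphere n) (cup (nsphere n) (sheet n) (pullback (nsphere n) antipodal_class c))
    = pullback (nsphere n) antipodal_class (cup (projective_space n) (sw n) c)"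
proof -
  have "coboundary (nsphere n) (pullback (nsphere n) antipodal_class c) = 0"
    using c by (simp flip: pullback_coboundary [OF continuous_map_antipodal_class])
  then show ?thesis
    using c(1) by (simp add: coboundary_cup pullback_cup [OF continuous_map_antipodal_class] pullback_sw)
qed

text \<open>Correcting \<open>u\<close> by the section applied to its transfer makes the transfer
  zero, so the corrected cochain descends; the coboundary of the descended cochain is the asserted
  combination.\<close>

lemma gysin_pullback:
  assumes c: "c \<in> cochains (projective_space n)" and u: "u \<in> cochains (nsphere n)"
    and eq: "pullback (nsphere n) antipodal_class c = coboundary (nsphere n) u"
  shows "coboundary (projective_space n) (transfer n u) = 0"
    "c + cup (projective_space n) (sw n) (transfer n u) \<in> coboundary (projective_space n) ` cochains (projective_space n)"
proof -
  let ?S = "nsphere n" and ?P = "projective_space n" and ?\<pi> = "pullback (nsphere n) antipodal_class"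
  show cob: "coboundary ?P (transfer n u) = 0"
    using c u by (simp flip: transfer_coboundary eq)
  let ?v = "u + cup ?S (sheet n) (?\<pi> (transfer n u))"
  have v: "?v \<in> cochains ?S"
    using u by auto
  have "transfer n ?v = 0"
    using u by (simp add: transfer_add transfer_cup_sheet)
  then have b: "?\<pi> (descend n ?v) = ?v"
    by (rule pullback_descend [OF v])
  have "?\<pi> (coboundary ?P (descend n ?v)) = ?\<pi> (c + cup ?P (sw n) (transfer n u))"
    using u cob by (simp add: pullback_coboundary [OF continuous_map_antipodal_class] b pullback_add eq
        coboundary_cup_sheet)
  then have "coboundary ?P (descend n ?v) = c + cup ?P (sw n) (transfer n u)"
    using c u v by (intro pullback_antipodal_class_inj [of _ n]) auto
  then show "c + cup ?P (sw n) (transfer n u) \<in> coboundary ?P ` cochains ?P"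
    using descend_cochains [OF v] by (metis image_eqI)
qed

text \<open>If the product of \<open>sw\<close> and \<open>c\<close> is the coboundary of
  \<open>b\<close>, the pullback of \<open>b\<close> compensates the failure of \<open>sheet\<close>
  times the pullback of \<open>c\<close> to be a cocycle; adding a pullback leaves the transfer
  unchanged.\<close>

lemma gysin_transfer:
  assumes c: "c \<in> cochains (projective_space n)" "coboundary (projective_space n) c = 0"
    and b: "cup (projective_space n) (sw n) c \<in> coboundary (projective_space n) ` cochains (projective_space n)"
  obtains u where "u \<in> cochains (nsphere n)" "coboundary (nsphere n) u = 0" "transfer n u = c"
proof -
  let ?S = "nsphere n" and ?P = "projective_space n" and ?\<pi> = "pullback (nsphere n) antipodal_class"
  from b obtain b where b: "b \<in> cochains ?P" "coboundary ?P b = cup ?P (sw n) c"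
    by (metis imageE)
  show thesis
  proof
    show "cup ?S (sheet n) (?\<pi> c) + ?\<pi> b \<in> cochains ?S"
      using b c by auto
    show "coboundary ?S (cup ?S (sheet n) (?\<pi> c) + ?\<pi> b) = 0"
      using c b by (simp add: coboundary_cup_sheet flip: pullback_coboundary [OF continuous_map_antipodal_class])
    show "transfer n (cup ?S (sheet n) (?\<pi> c) + ?\<pi> b) = c"
      using c b by (simp add: transfer_add transfer_cup_sheet)
  qed
qed

subsection \<open>The cohomology of projective space\<close>

lemma zero_cochain_fold [simp]: "(\<lambda>p f. 0) = (0::'a cochain)"
  by (simp add: fun_eq_iff)

definition component :: "nat \<Rightarrow> 'a cochain \<Rightarrow> 'a cochain" where
  "component p c = (\<lambda>q f. if q = p then c p f else 0)"

abbreviation coboundaries :: "'a topology \<Rightarrow> 'a cochain set" where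
  "coboundaries X \<equiv> coboundary X ` cochains X"

lemma component_cochains [simp]: "c \<in> cochains X \<Longrightarrow> component p c \<in> cochains X"
  by (rule homogeneous_cochainsI [where p = p]) (auto simp: component_def cochains_def)

lemma component_degree: "q \<noteq> p \<Longrightarrow> component p c q f = 0"
  by (simp add: component_def)

lemma component_self: "(\<And>q f. q \<noteq> p \<Longrightarrow> c q f = 0) \<Longrightarrow> component p c = c"
  by (auto simp: component_def fun_eq_iff)

lemma coboundary_component: "coboundary X (component p c) = component (Suc p) (coboundary X c)"
proof (intro ext)
  fix q f
  show "coboundary X (component p c) q f = component (Suc p) (coboundary X c) q f"
    by (cases q) (auto simp: coboundary_def component_def)
qed

lemma coboundary_component_0:
  assumes "coboundary X c = 0"
  shows "coboundary X (component p c) = 0"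
  by (simp add: coboundary_component assms) (simp add: component_def fun_eq_iff)

lemma transfer_component: "transfer n (component p u) = component p (transfer n u)"
  by (auto simp: transfer_def component_def fun_eq_iff)

lemma coboundaries_0 [simp]: "0 \<in> coboundaries X"
  by (rule image_eqI [of _ _ 0]) simp_all

lemma coboundaries_add: "c \<in> coboundaries X \<Longrightarrow> d \<in> coboundaries X \<Longrightarrow> c + d \<in> coboundaries X"
proof (elim imageE)
  fix a b assume "c = coboundary X a" "a \<in> cochains X" "d = coboundary X b" "b \<in> cochains X"
  then show "c + d \<in> coboundaries X"
    by (intro image_eqI [of _ _ "a + b"]) simp_all
qed

lemma coboundaries_add_cancel:
  assumes "c \<in> coboundaries X" "c + d \<in> coboundaries X"
  shows "d \<in> coboundaries X"
  using coboundaries_add [OF assms] by simp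

lemma coboundaries_cup_left:
  assumes "a \<in> cochains X" "coboundary X a = 0" "c \<in> coboundaries X"
  shows "cup X a c \<in> coboundaries X"
proof -
  obtain b where b: "b \<in> cochains X" "c = coboundary X b"
    using assms(3) by blast
  then have "coboundary X (cup X a b) = cup X a c"
    using assms by (simp add: coboundary_cup)
  then show ?thesis
    using assms(1) b(1) by (metis cup_cochains image_eqI)
qed

lemma coboundaries_cup_right:
  assumes "a \<in> cochains X" "coboundary X a = 0" "c \<in> coboundaries X"
  shows "cup X c a \<in> coboundaries X"
proof -
  obtain b where b: "b \<in> cochains X" "c = coboundary X b"
    using assms(3) by blast
  then have "coboundary X (cup X b a) = cup X c a"
    using assms by (simp add: coboundary_cup)
  then show ?thesis
    using assms(1) b(1) by (metis cup_cochains image_eqI)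
qed

lemma transfer_coboundaries: "u \<in> coboundaries (nsphere n) \<Longrightarrow> transfer n u \<in> coboundaries (projective_space n)"
  by (auto simp: transfer_coboundary)

fun sw_power :: "nat \<Rightarrow> nat \<Rightarrow> (nat \<Rightarrow> real) set cochain" where
  "sw_power n 0 = unit_cochain (projective_space n)"
| "sw_power n (Suc p) = cup (projective_space n) (sw n) (sw_power n p)"

lemma sw_power_cochains [simp]: "sw_power n p \<in> cochains (projective_space n)"
  by (induction p) auto

lemma coboundary_sw_power [simp]: "coboundary (projective_space n) (sw_power n p) = 0"
proof (induction p)
  case (Suc p)
  show ?case
    by (simp add: coboundary_cup Suc.IH)
qed simp

lemma sw_power_degree: "q \<noteq> p \<Longrightarrow> sw_power n p q f = 0"
proof (induction p arbitrary: q f)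
  case 0
  then show ?case
    by (simp add: unit_cochain_def)
next
  case (Suc p)
  have "sw n i (front_face i f) * sw_power n p (q - i) (back_face q i f) = 0" if "i \<le> q" for i
    using sw_degree [of i n "front_face i f"] Suc that by (cases "i = 1") auto
  then have "(\<Sum>i\<le>q. sw n i (front_face i f) * sw_power n p (q - i) (back_face q i f)) = 0"
    by (intro sum.neutral) blast
  then show ?case
    by (simp add: cup_def)
qed

definition point_simplex :: "'a \<Rightarrow> (nat \<Rightarrow> real) \<Rightarrow> 'a" where
  "point_simplex x = restrict (\<lambda>_. x) (standard_simplex 0)"

lemma standard_simplex_0': "standard_simplex 0 = {vertex0}"
  by (simp add: standard_simplex_0 vertex0_def)

lemma singular_simplex_0_eq: "singular_simplex 0 X s \<Longrightarrow> s = point_simplex (s vertex0)"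
  by (intro ext) (auto simp: point_simplex_def singular_simplex_def standard_simplex_0' extensional_def)

lemma normalized_in_nsphere:
  assumes "\<And>i. i > n \<Longrightarrow> x i = 0" "dot n x x > 0"
  shows "(\<lambda>i. x i / sqrt (dot n x x)) \<in> topspace (nsphere n)"
proof -
  have "dot n (\<lambda>i. x i / sqrt (dot n x x)) (\<lambda>i. x i / sqrt (dot n x x)) = dot n x x / (sqrt (dot n x x))\<^sup>2"
    unfolding dot_def [of n "\<lambda>i. x i / sqrt (dot n x x)" "\<lambda>i. x i / sqrt (dot n x x)"]
    by (simp add: power2_eq_square dot_def flip: sum_divide_distrib)
  then show ?thesis
    using assms by (simp add: nsphere_iff)
qed

text \<open>The segment between two points at an angle of at most 90 degrees avoids the origin and
  can be normalized to the sphere; the resulting 1-simplex has the two points as its faces.\<close>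

lemma cocycle_0_nsphere:
  assumes cocycle: "coboundary (nsphere n) u = 0"
    and x: "x \<in> topspace (nsphere n)" and y: "y \<in> topspace (nsphere n)" and xy: "dot n x y \<ge> 0"
  shows "u 0 (point_simplex x) = u 0 (point_simplex y)"
proof -
  let ?D = "standard_simplex (Suc 0)"
  define z where "z t = (\<lambda>i. t 0 * x i + t 1 * y i)" for t :: "nat \<Rightarrow> real"
  define s where "s t = (\<lambda>i. z t i / sqrt (dot n (z t) (z t)))" for t
  have nz: "dot n (z t) (z t) > 0" if "t \<in> ?D" for t
  proof -
    have t: "t 0 \<ge> 0" "t 1 \<ge> 0" "t 0 + t 1 = 1"
      using that by (auto simp: standard_simplex_def)
    have "dot n (z t) (z t) = (t 0)\<^sup>2 * dot n x x + (t 1)\<^sup>2 * dot n y y + 2 * t 0 * t 1 * dot n x y"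
      by (simp add: dot_def z_def power2_eq_square sum_distrib_left algebra_simps flip: sum.distrib)
    then have eq: "dot n (z t) (z t) = (t 0)\<^sup>2 + (t 1)\<^sup>2 + 2 * t 0 * t 1 * dot n x y"
      using x y by (simp add: nsphere_iff)
    have "t 0 > 0 \<or> t 1 > 0"
      using t by linarith
    then have "(t 0)\<^sup>2 + (t 1)\<^sup>2 > 0"
      by (auto intro: add_pos_nonneg add_nonneg_pos)
    moreover have "2 * t 0 * t 1 * dot n x y \<ge> 0"
      using t xy by simp
    ultimately show ?thesis
      using eq by linarith
  qed
  have zn: "z t i = 0" if "i > n" for t i
    using x y that by (simp add: z_def nsphere_iff)
  have "continuous_on ?D (\<lambda>t. s t i)" for i
  proof -
    have "continuous_on ?D (\<lambda>t::nat \<Rightarrow> real. t j)" for j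
      by (rule continuous_on_product_then_coordinatewise [OF continuous_on_id])
    then have z: "continuous_on ?D (\<lambda>t. z t i)" for i
      unfolding z_def by (intro continuous_intros) auto
    show ?thesis
      unfolding s_def dot_def
      by (intro continuous_intros z) (use nz in \<open>force simp: dot_def\<close>)
  qed
  then have "continuous_map (subtopology (powertop_real UNIV) ?D) (powertop_real UNIV) s"
    by (auto simp: euclidean_product_topology intro: continuous_on_coordinatewise_then_product)
  moreover have "s t \<in> topspace (nsphere n)" if "t \<in> ?D" for t
    unfolding s_def by (rule normalized_in_nsphere) (use zn nz that in auto)
  ultimately have "continuous_map (subtopology (powertop_real UNIV) ?D) (nsphere n) s"
    by (auto simp: nsphere continuous_map_in_subtopology)
  then have sing: "singular_simplex (Suc 0) (nsphere n) (restrict s ?D)"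
    by (simp add: singular_simplex_def continuous_map_eq [of _ _ s])
  have "simplical_face 0 vertex0 = (\<lambda>j. if j = 1 then 1 else 0)" "simplical_face (Suc 0) vertex0 = vertex0"
    by (auto simp: simplical_face_def vertex0_def fun_eq_iff)
  moreover have "s (\<lambda>j. if j = 1 then 1 else 0) = y" "s vertex0 = x"
    using x y by (auto simp: s_def z_def vertex0_def nsphere_iff)
  ultimately have "singular_face (Suc 0) 0 (restrict s ?D) = point_simplex y"
    "singular_face (Suc 0) (Suc 0) (restrict s ?D) = point_simplex x"
    by (auto simp: singular_face_def point_simplex_def standard_simplex_0' intro!: restrict_ext)
  then have "u 0 (point_simplex y) + u 0 (point_simplex x) = 0"
    using sing fun_cong [OF fun_cong [OF cocycle], of 1 "restrict s ?D"] by (simp add: coboundary_def)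
  then show ?thesis
    by (simp add: bit_add_eq_0_iff)
qed

lemma dot_commute: "dot n x y = dot n y x"
  by (simp add: dot_def mult.commute)

text \<open>Both \<open>x\<close> and its antipode make a right angle with a third point
  \<open>z\<close>, which exists from dimension 1 on.\<close>

lemma cocycle_0_nsphere_antipode:
  assumes cocycle: "coboundary (nsphere n) u = 0" and x: "x \<in> topspace (nsphere n)" and n: "n \<noteq> 0"
  shows "u 0 (point_simplex (antipode x)) = u 0 (point_simplex x)"
proof -
  obtain z where z: "z \<in> topspace (nsphere n)" "dot n x z = 0"
  proof (cases "x 0 = 0")
    case True
    have "dot n x vertex0 = (\<Sum>i\<in>{0}. x i * vertex0 i)" "dot n vertex0 vertex0 = (\<Sum>i\<in>{0}. vertex0 i * vertex0 i)"
      unfolding dot_def by (rule sum.mono_neutral_right; auto simp: vertex0_def)+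
    then show thesis
      using True by (intro that [of vertex0]) (auto simp: nsphere_iff vertex0_def)
  next
    case False
    \<comment> \<open>The first two coordinates of \<open>x\<close> turned by a right angle;
      coordinate 1 is available because \<open>n \<noteq> 0\<close>.\<close>
    define w where "w i = (if i = 0 then x 1 else if i = 1 then - x 0 else 0)" for i :: nat
    have sub: "{0, Suc 0} \<subseteq> {..n}"
      using n by auto
    have "dot n w w = (\<Sum>i\<in>{0, Suc 0}. w i * w i)" "dot n x w = (\<Sum>i\<in>{0, Suc 0}. x i * w i)"
      unfolding dot_def by (rule sum.mono_neutral_right; use sub in \<open>auto simp: w_def\<close>)+
    then have w: "dot n w w > 0" "dot n x w = 0"
      using False by (auto simp: w_def intro!: add_nonneg_pos) (simp add: power2_eq_square [symmetric])
    have "dot n x (\<lambda>i. w i / sqrt (dot n w w)) = dot n x w / sqrt (dot n w w)"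
      unfolding dot_def [of n x] by (simp add: sum_divide_distrib)
    then show thesis
      using w n by (intro that [OF normalized_in_nsphere [of n w]]) (auto simp: w_def)
  qed
  have "u 0 (point_simplex x) = u 0 (point_simplex z)"
    using z by (intro cocycle_0_nsphere [OF cocycle x]) auto
  also have "\<dots> = u 0 (point_simplex (antipode x))"
    using z x by (intro cocycle_0_nsphere [OF cocycle] antipode_in_nsphere) (auto simp: dot_commute [of n z x])
  finally show ?thesis
    by simp
qed

text \<open>The two lifts of a point are antipodal, and a degree 0 cocycle takes equal values there.
  This starts the nonvanishing of the powers of \<open>sw\<close>, in the degree where the sphere
  has cohomology of its own.\<close>

lemma transfer_cocycle_degree_0:
  assumes cocycle: "coboundary (nsphere n) u = 0" and n: "n \<noteq> 0"
  shows "transfer n u 0 \<sigma> = 0"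
proof (cases "singular_simplex 0 (projective_space n) \<sigma>")
  case True
  define s where "s = lift n 0 \<sigma>"
  have s: "singular_simplex 0 (nsphere n) s" "\<sigma> = simplex_map 0 antipodal_class s"
    using lift [OF True] by (auto simp: s_def)
  have "s = point_simplex (s vertex0)"
    by (rule singular_simplex_0_eq [OF s(1)])
  moreover have "simplex_map 0 antipode s = point_simplex (antipode (s vertex0))"
    using singular_simplex_0_eq [OF singular_simplex_antipode [OF s(1)]] by (simp add: simplex_map_def)
  ultimately have "u 0 (simplex_map 0 antipode s) = u 0 s"
    using cocycle_0_nsphere_antipode [OF cocycle _ n, of "s vertex0"] singular_simplex_in [OF s(1)] by simp
  then show ?thesis
    unfolding s(2) using transfer_simplex_map [OF s(1), of u] by simp
qed (simp add: transfer_def)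

lemma unit_cochain_projective_neq_0: "unit_cochain (projective_space n) 0 (point_simplex (antipodal_class vertex0)) = 1"
proof -
  have "vertex0 \<in> topspace (nsphere n)"
    using in_topspace_nsphere by (simp add: vertex0_def)
  then have "singular_simplex 0 (projective_space n) (point_simplex (antipodal_class vertex0))"
    by (simp add: singular_simplex_def point_simplex_def topspace_projective_space)
  then show ?thesis
    by (simp add: unit_cochain_def)
qed

text \<open>If the power \<open>p + 1\<close> bounded, the power \<open>p\<close> would be the
  transfer of a cocycle of degree \<open>p < n\<close> on the sphere. For \<open>p > 0\<close> this
  cocycle bounds, and the power \<open>p\<close> would bound as well; for \<open>p = 0\<close> the
  transfer is zero, but the unit is not.\<close>

lemma sw_power_not_coboundary: "p \<le> n \<Longrightarrow> sw_power n p \<notin> coboundaries (projective_space n)"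
proof (induction p)
  case 0
  show ?case
    using unit_cochain_projective_neq_0 [of n] by (auto simp: coboundary_def)
next
  case (Suc p)
  then have IH: "sw_power n p \<notin> coboundaries (projective_space n)" and pn: "Suc p \<le> n"
    by auto
  show ?case
  proof
    assume "sw_power n (Suc p) \<in> coboundaries (projective_space n)"
    then obtain u where u: "u \<in> cochains (nsphere n)" "coboundary (nsphere n) u = 0" "transfer n u = sw_power n p"
      using gysin_transfer [of "sw_power n p" n] by auto
    show False
    proof (cases p)
      case 0
      have "unit_cochain (projective_space n) 0 (point_simplex (antipodal_class vertex0)) = 0"
        using transfer_cocycle_degree_0 [OF u(2)] u(3) pn 0 by auto
      then show False
        using unit_cochain_projective_neq_0 [of n] by simp
    next
      case (Suc m)
      have "component p u \<in> coboundaries (nsphere n)"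
        unfolding Suc using pn Suc u(1,2)
        by (intro nsphere_cohomology_trivial [where p = m]) (auto simp: component_degree coboundary_component_0)
      then have "transfer n (component p u) \<in> coboundaries (projective_space n)"
        by (rule transfer_coboundaries)
      then show False
        using IH u(3) by (simp add: transfer_component component_self sw_power_degree)
    qed
  qed
qed

text \<open>On this open set the sign of the coordinate \<open>x\<^sub>i\<close> trivializes the double cover.\<close>

definition chart :: "nat \<Rightarrow> nat \<Rightarrow> (nat \<Rightarrow> real) set set" where
  "chart n i = {l \<in> topspace (projective_space n). rep l i \<noteq> 0}"

text \<open>Where coordinate \<open>i\<close> is nonzero, this is the difference between the sheet
  selected by \<open>rep\<close> and the sheet on which that coordinate is positive; adding its
  coboundary moves \<open>sw\<close> to the representative that belongs to the latter.\<close>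

definition chart_sign :: "nat \<Rightarrow> nat \<Rightarrow> (nat \<Rightarrow> real) set cochain" where
  "chart_sign n i = (\<lambda>p \<sigma>. if p = 0 \<and> singular_simplex 0 (projective_space n) \<sigma> then
     (if rep (\<sigma> vertex0) i > 0 then 0 else 1) else 0)"

definition sw_chart :: "nat \<Rightarrow> nat \<Rightarrow> (nat \<Rightarrow> real) set cochain" where
  "sw_chart n i = sw n + coboundary (projective_space n) (chart_sign n i)"

lemma openin_chart: "openin (projective_space n) (chart n i)"
proof -
  have "openin (projective_space n) {l \<in> topspace (projective_space n). rep l i * rep l i \<in> - {0}}"
    by (rule openin_continuous_map_preimage [OF continuous_map_rep_product]) (simp add: open_Compl)
  then show ?thesis
    by (simp add: chart_def)
qed

lemma charts_cover: "topspace (projective_space n) \<subseteq> \<Union> (chart n ` {..n})"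
proof
  fix l assume l: "l \<in> topspace (projective_space n)"
  have "\<exists>i\<le>n. rep l i \<noteq> 0"
  proof (rule ccontr)
    assume "\<not> (\<exists>i\<le>n. rep l i \<noteq> 0)"
    then have "dot n (rep l) (rep l) = 0"
      by (simp add: dot_def)
    then show False
      using antipodal_class_rep(2) [OF l] by (simp add: nsphere_iff)
  qed
  then show "l \<in> \<Union> (chart n ` {..n})"
    using l by (auto simp: chart_def)
qed

lemma chart_sign_cochains [simp]: "chart_sign n i \<in> cochains (projective_space n)"
  by (rule homogeneous_cochainsI [where p = 0]) (auto simp: chart_sign_def)

lemma sw_chart_cochains [simp]: "sw_chart n i \<in> cochains (projective_space n)"
  by (simp add: sw_chart_def)

lemma coboundary_sw_chart [simp]: "coboundary (projective_space n) (sw_chart n i) = 0"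
  by (simp add: sw_chart_def)

lemma sw_chart_degree: "q \<noteq> 1 \<Longrightarrow> sw_chart n i q f = 0"
  by (auto simp: sw_chart_def sw_degree coboundary_def chart_sign_def)

text \<open>On a lift, \<open>sheet\<close> plus the pulled back \<open>chart_sign\<close> is the
  indicator of a positive coordinate \<open>i\<close>. Over the chart this coordinate has no zero,
  so it keeps its sign along the lifted path, and the two end points cancel.\<close>

lemma sw_chart_vanishes:
  assumes \<sigma>: "singular_simplex 1 (projective_space n) \<sigma>" and U: "\<sigma> ` standard_simplex 1 \<subseteq> chart n i"
  shows "sw_chart n i 1 \<sigma> = 0"
proof -
  define s where "s = lift n 1 \<sigma>"
  have s: "singular_simplex 1 (nsphere n) s" "simplex_map 1 antipodal_class s = \<sigma>"
    using lift [OF \<sigma>] by (auto simp: s_def)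
  have nz: "s t i \<noteq> 0" if "t \<in> standard_simplex 1" for t
  proof -
    have "rep (\<sigma> t) i \<noteq> 0" "\<sigma> t = antipodal_class (s t)"
      using U that s(2) by (auto simp: chart_def simplex_map_def)
    then show ?thesis
      using rep_cases [of "s t"] by (auto simp: antipode_def)
  qed
  have const: "s t i > 0 \<longleftrightarrow> s t' i > 0" if t: "t \<in> standard_simplex 1" "t' \<in> standard_simplex 1" for t t'
  proof -
    have "connected ((\<lambda>t. s t i) ` standard_simplex 1)"
      by (rule connected_continuous_image [OF continuous_on_singular_simplex [OF s(1)] connected_standard_simplex])
    moreover have "0 \<notin> (\<lambda>t. s t i) ` standard_simplex 1"
      using nz by auto
    ultimately show ?thesis
      using t unfolding connected_iff_interval by (metis image_eqI linorder_not_less less_imp_le)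
  qed
  let ?f = "\<lambda>k. singular_face 1 k s"
  have face: "singular_simplex 0 (nsphere n) (?f k)" "?f k vertex0 \<in> s ` standard_simplex 1" if "k \<le> 1" for k
    using singular_simplex_singular_face [OF s(1) order_refl that] that
      simplical_face_in_standard_simplex [of 1 k vertex0] by (auto simp: singular_face_def)
  have sum: "sheet n 0 (?f k) + chart_sign n i 0 (simplex_map 0 antipodal_class (?f k))
    = (if ?f k vertex0 i > 0 then 1 else 0)" if k: "k \<le> 1" for k
  proof -
    have x: "?f k vertex0 i \<noteq> 0" "?f k vertex0 \<in> topspace (nsphere n)"
      using face [OF k] nz singular_simplex_in [OF s(1)] by auto
    have "singular_simplex 0 (projective_space n) (simplex_map 0 antipodal_class (?f k))"
      using face(1) [OF k] by (rule singular_simplex_antipodal_class)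
    moreover have "simplex_map 0 antipodal_class (?f k) vertex0 = antipodal_class (?f k vertex0)"
      by (simp add: simplex_map_def)
    ultimately show ?thesis
      using face(1) [OF k] rep_cases [of "?f k vertex0"] antipode_neq [OF x(2)] x(1)
      by (auto simp: sheet_def chart_sign_def antipode_def)
  qed
  have "sw n 1 \<sigma> = coboundary (nsphere n) (sheet n) 1 s"
    using fun_cong [OF fun_cong [OF pullback_sw], of n 1 s] s by (simp add: pullback_def)
  then have "sw n 1 \<sigma> = (\<Sum>k\<le>1. sheet n 0 (?f k))"
    using s by (simp add: coboundary_def)
  moreover have "coboundary (projective_space n) (chart_sign n i) 1 \<sigma>
      = (\<Sum>k\<le>1. chart_sign n i 0 (simplex_map 0 antipodal_class (?f k)))"
    using \<sigma> s(2) singular_face_simplex_map' [of 1 _ antipodal_class s] by (auto simp: coboundary_def)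
  ultimately have "sw_chart n i 1 \<sigma> =
      (\<Sum>k\<le>1. sheet n 0 (?f k) + chart_sign n i 0 (simplex_map 0 antipodal_class (?f k)))"
    by (simp only: sw_chart_def plus_fun_apply sum.distrib)
  also have "\<dots> = (\<Sum>k\<le>1. if ?f k vertex0 i > 0 then 1 else 0)"
    by (rule sum.cong [OF refl]) (simp only: sum atMost_iff)
  finally have "sw_chart n i 1 \<sigma> = (\<Sum>k\<le>1. if ?f k vertex0 i > 0 then 1 else 0)" .
  moreover have "?f 0 vertex0 i > 0 \<longleftrightarrow> ?f 1 vertex0 i > 0"
  proof -
    obtain t t' where "t \<in> standard_simplex 1" "?f 0 vertex0 = s t" "t' \<in> standard_simplex 1" "?f 1 vertex0 = s t'"
      using face(2) [of 0] face(2) [of 1] by blast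
    then show ?thesis
      using const [of t t'] by (simp only:)
  qed
  ultimately show ?thesis
    by simp
qed

fun chart_product :: "nat \<Rightarrow> nat \<Rightarrow> (nat \<Rightarrow> real) set cochain" where
  "chart_product n 0 = unit_cochain (projective_space n)"
| "chart_product n (Suc p) = cup (projective_space n) (sw_chart n p) (chart_product n p)"

lemma chart_product_cochains [simp]: "chart_product n p \<in> cochains (projective_space n)"
  by (induction p) auto

lemma coboundary_chart_product [simp]: "coboundary (projective_space n) (chart_product n p) = 0"
proof (induction p)
  case (Suc p)
  show ?case
    by (simp add: coboundary_cup Suc.IH)
qed simp

lemma cup_degree_1:
  assumes "\<And>q f. q \<noteq> 1 \<Longrightarrow> a q f = 0" and f: "singular_simplex (Suc p) X f"
  shows "cup X a b (Suc p) f = a 1 (front_face 1 f) * b p (back_face (Suc p) 1 f)"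
proof -
  have "cup X a b (Suc p) f = (\<Sum>i\<in>{1}. a i (front_face i f) * b (Suc p - i) (back_face (Suc p) i f))"
    unfolding cup_def if_P [OF f] by (rule sum.mono_neutral_right) (auto simp: assms(1))
  then show ?thesis
    by simp
qed

lemma chart_product_degree: "q \<noteq> p \<Longrightarrow> chart_product n p q f = 0"
proof (induction p arbitrary: q f)
  case 0
  then show ?case
    by (simp add: unit_cochain_def)
next
  case (Suc p)
  have "sw_chart n p i (front_face i f) * chart_product n p (q - i) (back_face q i f) = 0" if "i \<le> q" for i
    using sw_chart_degree [of i n p "front_face i f"] Suc that by (cases "i = 1") auto
  then have "(\<Sum>i\<le>q. sw_chart n p i (front_face i f) * chart_product n p (q - i) (back_face q i f)) = 0"
    by (intro sum.neutral) blast
  then show ?case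
    by (simp add: cup_def)
qed

text \<open>The cup product evaluates its factors on successive edges of the simplex, and the factor
  belonging to chart \<open>j\<close> vanishes on every edge inside that chart.\<close>

lemma chart_product_vanishes:
  assumes "singular_simplex p (projective_space n) f" "f ` standard_simplex p \<subseteq> chart n j" "j < p"
  shows "chart_product n p p f = 0"
  using assms
proof (induction p arbitrary: f)
  case (Suc p)
  have front: "singular_simplex 1 (projective_space n) (front_face 1 f)"
     "front_face 1 f ` standard_simplex 1 \<subseteq> chart n j"
    using singular_simplex_front_face [OF Suc.prems(1), of 1] Suc.prems(2) standard_simplex_mono [of 1 "Suc p"]
    by (auto simp: front_face_def)
  have bf: "singular_simplex p (projective_space n) (back_face (Suc p) 1 f)"
     "back_face (Suc p) 1 f ` standard_simplex p \<subseteq> chart n j"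
    using singular_simplex_back_face [OF Suc.prems(1), of 1] Suc.prems(2)
      vertex_shift_in_standard_simplex [of 1 "Suc p"]
    by (auto simp: back_face_eq image_subset_iff)
  have "sw_chart n p 1 (front_face 1 f) * chart_product n p p (back_face (Suc p) 1 f) = 0"
  proof (cases "j = p")
    case True
    then show ?thesis
      using sw_chart_vanishes [OF front] by simp
  next
    case False
    then show ?thesis
      using Suc.IH [OF bf] Suc.prems(3) by simp
  qed
  then show ?case
    using cup_degree_1 [OF sw_chart_degree Suc.prems(1)] by simp
qed simp

lemma chart_product_cohomologous: "chart_product n p + sw_power n p \<in> coboundaries (projective_space n)"
proof (induction p)
  case 0
  show ?case
    by simp
next
  case (Suc p)
  let ?P = "projective_space n"
  have 1: "cup ?P (sw n) (chart_product n p + sw_power n p) \<in> coboundaries ?P"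
    by (rule coboundaries_cup_left) (simp_all add: Suc.IH del: image_iff)
  have 2: "cup ?P (coboundary ?P (chart_sign n p)) (chart_product n p) \<in> coboundaries ?P"
    by (rule coboundaries_cup_right) simp_all
  have "chart_product n (Suc p) + sw_power n (Suc p) =
     cup ?P (sw n) (chart_product n p + sw_power n p) +
     cup ?P (coboundary ?P (chart_sign n p)) (chart_product n p)"
    by (simp add: sw_chart_def cup_add_left cup_add_right ac_simps)
  then show ?case
    using coboundaries_add [OF 1 2] by (simp only:)
qed

text \<open>The product with one representative for each of the charts \<open>0, ..., n\<close> is
  zero on every simplex lying in a single chart, which is what the subdivision criterion asks
  for.\<close>

lemma sw_power_top: "sw_power n (Suc n) \<in> coboundaries (projective_space n)"
proof -
  have "chart_product n (Suc n) \<in> coboundaries (projective_space n)"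
  proof (rule coboundary_if_vanishes_on_cover [where \<C> = "chart n ` {..n}" and p = n])
    show "topspace (projective_space n) \<subseteq> \<Union> (chart n ` {..n})"
      by (rule charts_cover)
  next
    fix f U assume "U \<in> chart n ` {..n}" "singular_simplex (Suc n) (projective_space n) f"
      "f ` standard_simplex (Suc n) \<subseteq> U"
    then show "chart_product n (Suc n) (Suc n) f = 0"
      by (metis atMost_iff chart_product_vanishes imageE less_Suc_eq_le)
  qed (auto simp: openin_chart chart_product_degree simp del: chart_product.simps)
  then show ?thesis
    using chart_product_cohomologous coboundaries_add_cancel by blast
qed

text \<open>Every point has a lift in the closed hemisphere around \<open>vertex0\<close>, where the
  pulled back cocycle is constant; this treats all \<open>n\<close> at once, including
  \<open>n = 0\<close>.\<close>

lemma projective_cocycle_degree_0: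
  assumes c: "c \<in> cochains (projective_space n)" "\<And>q f. q \<noteq> 0 \<Longrightarrow> c q f = 0"
    and cocycle: "coboundary (projective_space n) c = 0"
  shows "c = 0 \<or> c = unit_cochain (projective_space n)"
proof -
  let ?u = "pullback (nsphere n) antipodal_class c"
  have u: "coboundary (nsphere n) ?u = 0"
    by (simp add: cocycle flip: pullback_coboundary [OF continuous_map_antipodal_class])
  have val: "c 0 (simplex_map 0 antipodal_class s) = ?u 0 (point_simplex vertex0)"
    if s: "singular_simplex 0 (nsphere n) s" for s
  proof -
    have v: "vertex0 \<in> topspace (nsphere n)"
      using in_topspace_nsphere by (simp add: vertex0_def)
    obtain s' where s': "singular_simplex 0 (nsphere n) s'" "dot n (s' vertex0) vertex0 \<ge> 0"
       "simplex_map 0 antipodal_class s' = simplex_map 0 antipodal_class s"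
    proof (cases "dot n (s vertex0) vertex0 \<ge> 0")
      case True
      then show thesis
        using s that by blast
    next
      case False
      then show thesis
        using singular_simplex_antipode [OF s] simplex_map_antipodal_class_antipode
        by (intro that [of "simplex_map 0 antipode s"]) (auto simp: simplex_map_def)
    qed
    have "?u 0 (point_simplex (s' vertex0)) = ?u 0 (point_simplex vertex0)"
      using singular_simplex_in [OF s'(1)] s'(2) v by (intro cocycle_0_nsphere [OF u]) auto
    then have "?u 0 s' = ?u 0 (point_simplex vertex0)"
      using singular_simplex_0_eq [OF s'(1)] by metis
    then show ?thesis
      using s' by (simp add: pullback_def)
  qed
  show ?thesis
  proof (cases "?u 0 (point_simplex vertex0)")
    case zero
    have "c = 0"
    proof (rule projective_cochains_eqI [OF c(1)])
      fix p s assume "singular_simplex p (nsphere n) s"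
      then show "c p (simplex_map p antipodal_class s) = 0 p (simplex_map p antipodal_class s)"
        using c(2) val [of s] zero by (cases "p = 0") auto
    qed simp
    then show ?thesis ..
  next
    case one
    have "c = unit_cochain (projective_space n)"
    proof (rule projective_cochains_eqI [OF c(1)])
      fix p s assume "singular_simplex p (nsphere n) s"
      then show "c p (simplex_map p antipodal_class s) = unit_cochain (projective_space n) p (simplex_map p antipodal_class s)"
        using c(2) val [of s] one singular_simplex_antipodal_class [of p n s]
        by (cases "p = 0") (auto simp: unit_cochain_def)
    qed simp
    then show ?thesis ..
  qed
qed

text \<open>Only degree \<open>n\<close> needs an argument. There the power \<open>n\<close> of
  \<open>sw\<close> is the transfer of some \<open>v\<close>, since the next power bounds, and
  \<open>v\<close> represents the nonzero top class of the sphere. Were the pullback of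
  \<open>c\<close> nonzero, it would be cohomologous to \<open>v\<close>, and its transfer, which is
  zero, to the power \<open>n\<close> of \<open>sw\<close>.\<close>

lemma pullback_projective_cocycle:
  assumes c: "c \<in> cochains (projective_space n)" "\<And>q f. q \<noteq> Suc p \<Longrightarrow> c q f = 0"
    and cocycle: "coboundary (projective_space n) c = 0"
  shows "pullback (nsphere n) antipodal_class c \<in> coboundaries (nsphere n)"
proof -
  let ?u = "pullback (nsphere n) antipodal_class c"
  have cu: "coboundary (nsphere n) ?u = 0"
    by (simp add: cocycle flip: pullback_coboundary [OF continuous_map_antipodal_class])
  have u: "?u \<in> cochains (nsphere n)" "\<And>q f. q \<noteq> Suc p \<Longrightarrow> ?u q f = 0"
    using c(1) by simp (simp add: pullback_def c(2))
  show ?thesis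
  proof (cases "Suc p = n")
    case False
    then show ?thesis
      using nsphere_cohomology_trivial [OF u cu] by blast
  next
    case n: True
    obtain v where v: "v \<in> cochains (nsphere n)" "coboundary (nsphere n) v = 0" "transfer n v = sw_power n n"
      using gysin_transfer [of "sw_power n n" n] sw_power_top [of n] by auto
    let ?v = "component n v"
    have tv: "transfer n ?v = sw_power n n"
      by (simp add: transfer_component v component_self sw_power_degree)
    have vn: "?v \<notin> coboundaries (nsphere n)"
      using transfer_coboundaries [of ?v n] tv sw_power_not_coboundary [of n n] by auto
    show ?thesis
    proof (rule ccontr)
      assume "?u \<notin> coboundaries (nsphere n)"
      then have "?u + ?v \<in> coboundaries (nsphere n)"
        using nsphere_cohomology_top [of ?u p ?v] u cu v vn n
        by (auto simp: component_degree coboundary_component_0)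
      then have "transfer n (?u + ?v) \<in> coboundaries (projective_space n)"
        by (rule transfer_coboundaries)
      then show False
        using sw_power_not_coboundary [of n n] c(1) by (simp add: transfer_add tv)
    qed
  qed
qed

text \<open>In positive degree the pullback to the sphere bounds, so \<open>c\<close> is
  cohomologous to \<open>sw\<close> times a class of one degree less, which the induction hypothesis
  identifies.\<close>

lemma projective_cohomology_degree:
  assumes "c \<in> cochains (projective_space n)" "\<And>q f. q \<noteq> p \<Longrightarrow> c q f = 0"
    and "coboundary (projective_space n) c = 0"
  shows "c \<in> coboundaries (projective_space n) \<or> c + sw_power n p \<in> coboundaries (projective_space n)"
  using assms
proof (induction p arbitrary: c)
  case 0
  then have "c = 0 \<or> c = unit_cochain (projective_space n)"
    by (intro projective_cocycle_degree_0) auto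
  then show ?case
    by (elim disjE) simp_all
next
  case (Suc p)
  let ?P = "projective_space n"
  obtain u where u: "u \<in> cochains (nsphere n)" "pullback (nsphere n) antipodal_class c = coboundary (nsphere n) u"
    using pullback_projective_cocycle [OF Suc.prems] by blast
  let ?u = "component p u"
  have "component (Suc p) (pullback (nsphere n) antipodal_class c) = pullback (nsphere n) antipodal_class c"
    using Suc.prems(2) by (intro component_self) (simp add: pullback_def)
  then have eq: "pullback (nsphere n) antipodal_class c = coboundary (nsphere n) ?u"
    by (simp add: coboundary_component u(2))
  have u': "?u \<in> cochains (nsphere n)"
    using u(1) by simp
  note g = gysin_pullback [OF Suc.prems(1) u' eq]
  have "transfer n ?u \<in> coboundaries ?P \<or> transfer n ?u + sw_power n p \<in> coboundaries ?P"
    by (rule Suc.IH [OF transfer_cochains [OF u'] _ g(1)]) (simp add: transfer_component component_degree)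
  then show ?case
  proof
    assume "transfer n ?u \<in> coboundaries ?P"
    then have "cup ?P (sw n) (transfer n ?u) \<in> coboundaries ?P"
      by (intro coboundaries_cup_left) simp_all
    then have "c \<in> coboundaries ?P"
      using g(2) by (metis add.commute coboundaries_add_cancel)
    then show ?case ..
  next
    assume "transfer n ?u + sw_power n p \<in> coboundaries ?P"
    then have "cup ?P (sw n) (transfer n ?u + sw_power n p) \<in> coboundaries ?P"
      by (intro coboundaries_cup_left) simp_all
    then have "(c + cup ?P (sw n) (transfer n ?u)) + cup ?P (sw n) (transfer n ?u + sw_power n p) \<in> coboundaries ?P"
      by (rule coboundaries_add [OF g(2)])
    moreover have "(c + cup ?P (sw n) (transfer n ?u)) + cup ?P (sw n) (transfer n ?u + sw_power n p)
       = c + sw_power n (Suc p)"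
      by (simp add: cup_add_right add.assoc)
    ultimately show ?case
      by (simp only: simp_thms)
  qed
qed

subsection \<open>The cohomology ring\<close>

lemma cocycle_ring_simps:
  "carrier (cocycle_ring X) = {c \<in> cochains X. coboundary X c = 0}"
  "c \<otimes>\<^bsub>cocycle_ring X\<^esub> d = cup X c d"
  "\<one>\<^bsub>cocycle_ring X\<^esub> = unit_cochain X"
  "\<zero>\<^bsub>cocycle_ring X\<^esub> = 0"
  "c \<oplus>\<^bsub>cocycle_ring X\<^esub> d = c + d"
  by (simp_all add: cocycle_ring_def cochain_ring_def unit_cochain_def zero_fun_def plus_fun_def
      del: zero_cochain_fold)

lemma ring_cocycle_ring: "ring (cocycle_ring X)"
proof (rule ringI)
  show "abelian_group (cocycle_ring X)"
  proof (rule abelian_groupI)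
    fix c assume "c \<in> carrier (cocycle_ring X)"
    then show "\<exists>d\<in>carrier (cocycle_ring X). d \<oplus>\<^bsub>cocycle_ring X\<^esub> c = \<zero>\<^bsub>cocycle_ring X\<^esub>"
      by (intro bexI [of _ c]) (simp_all only: cocycle_ring_simps cochain_add_self)
  qed (simp_all add: cocycle_ring_simps ac_simps)
  show "monoid (cocycle_ring X)"
    by (rule monoidI) (simp_all add: cocycle_ring_simps coboundary_cup cup_assoc)
qed (simp_all add: cocycle_ring_simps cup_add_left cup_add_right)

lemma coboundaries_subset: "coboundaries X \<subseteq> {c \<in> cochains X. coboundary X c = 0}"
  by auto

lemma ideal_coboundaries: "ideal (coboundaries X) (cocycle_ring X)"
proof (rule idealI [OF ring_cocycle_ring])
  interpret ring "cocycle_ring X"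
    by (rule ring_cocycle_ring)
  show "subgroup (coboundaries X) (add_monoid (cocycle_ring X))"
  proof (rule add.subgroupI)
    show "coboundaries X \<subseteq> carrier (cocycle_ring X)"
      using coboundaries_subset [of X] by (simp only: cocycle_ring_simps)
    show "coboundaries X \<noteq> {}"
      using coboundaries_0 [of X] by blast
    fix c assume c: "c \<in> coboundaries X"
    then have cc: "c \<in> carrier (cocycle_ring X)"
      using coboundaries_subset [of X] by (auto simp only: cocycle_ring_simps)
    moreover have "c \<oplus>\<^bsub>cocycle_ring X\<^esub> c = \<zero>\<^bsub>cocycle_ring X\<^esub>"
      by (simp only: cocycle_ring_simps cochain_add_self)
    ultimately have "\<ominus>\<^bsub>cocycle_ring X\<^esub> c = c"
      by (simp add: minus_equality)
    then show "\<ominus>\<^bsub>cocycle_ring X\<^esub> c \<in> coboundaries X"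
      using c by (simp only:)
    fix d assume "d \<in> coboundaries X"
    then show "c \<oplus>\<^bsub>cocycle_ring X\<^esub> d \<in> coboundaries X"
      using coboundaries_add [OF c] by (simp only: cocycle_ring_simps)
  qed
qed (simp_all only: cocycle_ring_simps mem_Collect_eq coboundaries_cup_left coboundaries_cup_right)

definition cohomology_class :: "'a topology \<Rightarrow> 'a cochain \<Rightarrow> 'a cochain set" where
  "cohomology_class X c = coboundaries X +>\<^bsub>cocycle_ring X\<^esub> c"

abbreviation cocycles :: "'a topology \<Rightarrow> 'a cochain set" where
  "cocycles X \<equiv> {c \<in> cochains X. coboundary X c = 0}"

lemma ring_cohomology_ring: "ring (cohomology_ring X)"
  unfolding cohomology_ring_def by (rule ideal.quotient_is_ring [OF ideal_coboundaries])

lemma cohomology_class_hom: "cohomology_class X \<in> ring_hom (cocycle_ring X) (cohomology_ring X)"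
  unfolding cohomology_ring_def cohomology_class_def by (rule ideal.rcos_ring_hom [OF ideal_coboundaries])

lemma carrier_cohomology_ring: "carrier (cohomology_ring X) = cohomology_class X ` cocycles X"
  by (auto simp: cohomology_ring_def FactRing_def A_RCOSETS_def' cohomology_class_def cocycle_ring_simps)

lemma cohomology_class_carrier: "c \<in> cocycles X \<Longrightarrow> cohomology_class X c \<in> carrier (cohomology_ring X)"
  by (simp only: carrier_cohomology_ring imageI)

lemma cohomology_class_add:
  "c \<in> cocycles X \<Longrightarrow> d \<in> cocycles X \<Longrightarrow>
    cohomology_class X (c + d) = cohomology_class X c \<oplus>\<^bsub>cohomology_ring X\<^esub> cohomology_class X d"
  using ring_hom_add [OF cohomology_class_hom, of c X d] by (simp only: cocycle_ring_simps)

lemma cohomology_class_cup: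
  "c \<in> cocycles X \<Longrightarrow> d \<in> cocycles X \<Longrightarrow>
    cohomology_class X (cup X c d) = cohomology_class X c \<otimes>\<^bsub>cohomology_ring X\<^esub> cohomology_class X d"
  using ring_hom_mult [OF cohomology_class_hom, of c X d] by (simp only: cocycle_ring_simps)

lemma cohomology_class_unit: "cohomology_class X (unit_cochain X) = \<one>\<^bsub>cohomology_ring X\<^esub>"
  using ring_hom_one [OF cohomology_class_hom, of X] by (simp only: cocycle_ring_simps)

lemma mem_cohomology_class: "d \<in> cohomology_class X c \<longleftrightarrow> (\<exists>b\<in>coboundaries X. d = b + c)"
  unfolding cohomology_class_def a_r_coset_def' by (auto simp only: cocycle_ring_simps)

lemma zero_cohomology_ring: "\<zero>\<^bsub>cohomology_ring X\<^esub> = coboundaries X"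
  by (simp add: cohomology_ring_def FactRing_def)

lemma cohomology_class_eq_zero:
  assumes "c \<in> coboundaries X"
  shows "cohomology_class X c = \<zero>\<^bsub>cohomology_ring X\<^esub>"
proof -
  interpret ideal "coboundaries X" "cocycle_ring X"
    by (rule ideal_coboundaries)
  show ?thesis
    unfolding zero_cohomology_ring cohomology_class_def
    using assms a_subset by (intro a_coset_join2 is_additive_subgroup [THEN additive_subgroup.a_subgroup]) auto
qed

text \<open>All that the algebra uses of the cohomology ring. Generation by the powers of
  \<open>X\<close> is phrased as an induction principle and their linear independence through
  additive coefficient functionals, so no normal form of elements has to be chosen.\<close>

locale truncated_polynomial_ring = cring R for R (structure) +
  fixes X n and coeff :: "nat \<Rightarrow> 'a \<Rightarrow> bit"
  assumes X_carrier [simp]: "X \<in> carrier R"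
    and char2: "r \<in> carrier R \<Longrightarrow> r \<oplus> r = \<zero>"
    and X_nilpotent: "X [^] Suc n = \<zero>"
    and powers_induct: "r \<in> carrier R \<Longrightarrow> P \<zero> \<Longrightarrow> (\<And>i. P (X [^] (i::nat))) \<Longrightarrow>
      (\<And>r s. r \<in> carrier R \<Longrightarrow> s \<in> carrier R \<Longrightarrow> P r \<Longrightarrow> P s \<Longrightarrow> P (r \<oplus> s)) \<Longrightarrow> P r"
    and coeff_add: "r \<in> carrier R \<Longrightarrow> s \<in> carrier R \<Longrightarrow> coeff i (r \<oplus> s) = coeff i r + coeff i s"
    and coeff_power: "i \<le> n \<Longrightarrow> j \<le> n \<Longrightarrow> coeff i (X [^] j) = (if i = j then 1 else 0)"

text \<open>Independent of the representative because the components of a coboundary are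
  coboundaries, and additive on projective space because each degree carries at most one nonzero
  class.\<close>

definition cohomology_coeff :: "'a topology \<Rightarrow> nat \<Rightarrow> 'a cochain set \<Rightarrow> bit" where
  "cohomology_coeff X i r = (if component i (SOME c. c \<in> r) \<in> coboundaries X then 0 else 1)"

lemma component_add: "component i (c + d) = component i c + component i d"
  by (auto simp: component_def fun_eq_iff)

lemma component_coboundaries:
  assumes "b \<in> coboundaries X"
  shows "component i b \<in> coboundaries X"
proof -
  obtain a where a: "a \<in> cochains X" "b = coboundary X a"
    using assms by blast
  show ?thesis
  proof (cases i)
    case 0
    have "component i b = 0"
      unfolding a(2) 0 by (simp add: component_def coboundary_def fun_eq_iff)
    then show ?thesis
      by (simp only: coboundaries_0)
  next
    case (Suc j)
    have "component i b = coboundary X (component j a)"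
      by (simp only: a(2) Suc coboundary_component)
    then show ?thesis
      using a(1) by (metis component_cochains image_eqI)
  qed
qed

lemma cohomology_coeff_class:
  assumes "c \<in> cocycles X"
  shows "cohomology_coeff X i (cohomology_class X c) = (if component i c \<in> coboundaries X then 0 else 1)"
proof -
  have "c \<in> cohomology_class X c"
    unfolding mem_cohomology_class by (rule bexI [of _ 0]) simp_all
  then have "(SOME d. d \<in> cohomology_class X c) \<in> cohomology_class X c"
    by (rule someI [where P = "\<lambda>d. d \<in> cohomology_class X c"])
  then obtain b where b: "b \<in> coboundaries X" "(SOME d. d \<in> cohomology_class X c) = b + c"
    unfolding mem_cohomology_class by blast
  have cb: "component i b \<in> coboundaries X"
    by (rule component_coboundaries [OF b(1)])
  have "component i b + component i c \<in> coboundaries X \<longleftrightarrow> component i c \<in> coboundaries X"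
    using coboundaries_add [OF cb] coboundaries_add_cancel [OF cb] by blast
  then show ?thesis
    unfolding cohomology_coeff_def b(2) component_add by simp
qed

lemma component_sum: "finite D \<Longrightarrow> (\<And>p f. p \<notin> D \<Longrightarrow> c p f = 0) \<Longrightarrow> c = (\<Sum>p\<in>D. component p c)"
proof -
  assume D: "finite D" "\<And>p f. p \<notin> D \<Longrightarrow> c p f = 0"
  have "(\<Sum>p\<in>D. component p c) q f = (\<Sum>p\<in>D. component p c q f)" for q f
    using D(1) by (induction D) simp_all
  then show ?thesis
    using D by (intro ext) (simp add: component_def sum.delta)
qed

lemma component_sw_power: "component i (sw_power n j) = (if i = j then sw_power n j else 0)"
  using sw_power_degree [of _ j n] by (auto simp: component_def fun_eq_iff)

lemma cocycles_component: "c \<in> cocycles X \<Longrightarrow> component i c \<in> cocycles X"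
  by (simp add: coboundary_component_0)

theorem truncated_polynomial_ring_cohomology_ring:
  "truncated_polynomial_ring (cohomology_ring (projective_space n))
    (cohomology_class (projective_space n) (sw n)) n (cohomology_coeff (projective_space n))"
proof -
  let ?P = "projective_space n"
  let ?R = "cohomology_ring ?P" and ?X = "cohomology_class ?P (sw n)" and ?cl = "cohomology_class ?P"
  interpret R: ring ?R
    by (rule ring_cohomology_ring)
  have sw: "sw n \<in> cocycles ?P" and swp: "\<And>p. sw_power n p \<in> cocycles ?P"
    by simp_all
  have X: "?X \<in> carrier ?R"
    by (rule cohomology_class_carrier [OF sw])
  have pow: "?X [^]\<^bsub>?R\<^esub> p = ?cl (sw_power n p)" for p :: nat
  proof (induction p)
    case 0
    show ?case
      by (simp add: cohomology_class_unit)
  next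
    case (Suc p)
    have "?cl (sw_power n (Suc p)) = ?X \<otimes>\<^bsub>?R\<^esub> ?cl (sw_power n p)"
      unfolding sw_power.simps by (rule cohomology_class_cup [OF sw swp])
    then show ?case
      using R.nat_pow_Suc2 [OF X, of p] Suc.IH by simp
  qed
  have ind: "Q r" if r: "r \<in> carrier ?R" and Q0: "Q \<zero>\<^bsub>?R\<^esub>" and QX: "\<And>i. Q (?X [^]\<^bsub>?R\<^esub> (i::nat))"
    and Qadd: "\<And>r s. r \<in> carrier ?R \<Longrightarrow> s \<in> carrier ?R \<Longrightarrow> Q r \<Longrightarrow> Q s \<Longrightarrow> Q (r \<oplus>\<^bsub>?R\<^esub> s)" for Q r
  proof -
    obtain c where c: "c \<in> cocycles ?P" "r = ?cl c"
      using r unfolding carrier_cohomology_ring by blast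
    have comp: "Q (?cl (component p c))" for p
    proof -
      have "component p c \<in> coboundaries ?P \<or> component p c + sw_power n p \<in> coboundaries ?P"
        using c(1) by (intro projective_cohomology_degree) (simp_all add: component_degree coboundary_component_0)
      then show ?thesis
      proof
        assume "component p c \<in> coboundaries ?P"
        then show ?thesis
          using Q0 by (simp only: cohomology_class_eq_zero)
      next
        assume b: "component p c + sw_power n p \<in> coboundaries ?P"
        then have bc: "component p c + sw_power n p \<in> cocycles ?P"
          using coboundaries_subset by blast
        have "component p c = (component p c + sw_power n p) + sw_power n p"
          by (simp only: add.assoc cochain_add_self add_0_right)
        then have "?cl (component p c) = ?cl (component p c + sw_power n p) \<oplus>\<^bsub>?R\<^esub> ?cl (sw_power n p)"
          using cohomology_class_add [OF bc swp, of p] by (simp only:)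
        also have "\<dots> = ?X [^]\<^bsub>?R\<^esub> p"
          using cohomology_class_eq_zero [OF b] cohomology_class_carrier [OF swp, of p] by (simp add: pow)
        finally show ?thesis
          using QX by (simp only:)
      qed
    qed
    have sums: "(\<Sum>p\<in>D. component p c) \<in> cocycles ?P \<and> Q (?cl (\<Sum>p\<in>D. component p c))" if "finite D" for D
      using that
    proof (induction D)
      case empty
      show ?case
        using Q0 cohomology_class_eq_zero [OF coboundaries_0, of ?P] by simp
    next
      case (insert p D)
      have a: "component p c \<in> cocycles ?P" "(\<Sum>p\<in>D. component p c) \<in> cocycles ?P"
        using cocycles_component [OF c(1)] insert.IH by blast+
      have "?cl (\<Sum>p\<in>insert p D. component p c) = ?cl (component p c) \<oplus>\<^bsub>?R\<^esub> ?cl (\<Sum>p\<in>D. component p c)"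
        using cohomology_class_add [OF a] insert.hyps by (simp only: sum.insert not_False_eq_True)
      moreover have "Q (?cl (component p c) \<oplus>\<^bsub>?R\<^esub> ?cl (\<Sum>p\<in>D. component p c))"
        using a comp insert.IH by (intro Qadd cohomology_class_carrier) blast+
      moreover have "(\<Sum>p\<in>insert p D. component p c) \<in> cocycles ?P"
        using a insert.hyps by simp
      ultimately show ?case
        by (simp only: simp_thms)
    qed
    define D where "D = {p. \<exists>f. c p f \<noteq> 0}"
    have D: "finite D"
      using c(1) by (simp add: cochains_def D_def)
    have "c = (\<Sum>p\<in>D. component p c)"
      by (rule component_sum [OF D]) (auto simp: D_def)
    moreover have "Q (?cl (\<Sum>p\<in>D. component p c))"
      using sums [OF D] by (rule conjunct2)
    ultimately show ?thesis
      unfolding c(2) by (rule ssubst [where P = "\<lambda>c. Q (?cl c)"])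
  qed
  \<comment> \<open>Commutativity is read off from generation: by distributivity it is enough to
    compare powers of one element.\<close>
  have pow_comm: "r \<otimes>\<^bsub>?R\<^esub> ?X [^]\<^bsub>?R\<^esub> j = ?X [^]\<^bsub>?R\<^esub> j \<otimes>\<^bsub>?R\<^esub> r" if "r \<in> carrier ?R" for r and j :: nat
    using that
    by (rule ind) (use X in \<open>simp_all add: R.nat_pow_mult add.commute R.l_distr R.r_distr\<close>)
  have comm: "r \<otimes>\<^bsub>?R\<^esub> s = s \<otimes>\<^bsub>?R\<^esub> r" if "r \<in> carrier ?R" "s \<in> carrier ?R" for r s
    using that(2) by (rule ind) (use that(1) in \<open>simp_all add: pow_comm R.l_distr R.r_distr\<close>)
  interpret R: cring ?R
    by unfold_locales (rule comm)
  show ?thesis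
  proof (unfold_locales, goal_cases)
    case 1
    show ?case by (rule X)
  next
    case (2 r)
    then obtain c where c: "c \<in> cocycles ?P" "r = ?cl c"
      unfolding carrier_cohomology_ring by blast
    show ?case
      using cohomology_class_add [OF c(1) c(1)] cohomology_class_eq_zero [OF coboundaries_0, of ?P]
      by (simp add: c(2))
  next
    case 3
    show ?case
      unfolding pow by (rule cohomology_class_eq_zero [OF sw_power_top])
  next
    case (4 r Q)
    then show ?case by (rule ind)
  next
    case (5 r s i)
    obtain c d where c: "c \<in> cocycles ?P" "r = ?cl c" and d: "d \<in> cocycles ?P" "s = ?cl d"
      using 5 unfolding carrier_cohomology_ring by blast
    have cd: "c + d \<in> cocycles ?P"
      using c(1) d(1) by simp
    have dich: "component i e \<in> coboundaries ?P \<or> component i e + sw_power n i \<in> coboundaries ?P"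
      if "e \<in> cocycles ?P" for e
      using that by (intro projective_cohomology_degree) (simp_all add: component_degree coboundary_component_0)
    \<comment> \<open>Two components that do not bound are both cohomologous to the same power of
      \<open>sw\<close>, which cancels in their sum: the case 1 + 1 = 0 of additivity.\<close>
    have "component i c + component i d = (component i c + sw_power n i) + (component i d + sw_power n i)"
      by (simp add: ac_simps)
    then have both: "component i c + component i d \<in> coboundaries ?P"
      if "component i c \<notin> coboundaries ?P" "component i d \<notin> coboundaries ?P"
      using that dich [OF c(1)] dich [OF d(1)] coboundaries_add by (metis (no_types, lifting))
    have one: "component i c + component i d \<in> coboundaries ?P \<longleftrightarrow> component i d \<in> coboundaries ?P"
      if "component i c \<in> coboundaries ?P"
      using coboundaries_add [OF that] coboundaries_add_cancel [OF that] by blast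
    have two: "component i c + component i d \<in> coboundaries ?P \<longleftrightarrow> component i c \<in> coboundaries ?P"
      if "component i d \<in> coboundaries ?P"
      using coboundaries_add [OF _ that] coboundaries_add_cancel [OF that] by (metis add.commute)
    show ?case
      unfolding c(2) d(2) cohomology_class_add [OF c(1) d(1), symmetric]
        cohomology_coeff_class [OF c(1)] cohomology_coeff_class [OF d(1)] cohomology_coeff_class [OF cd] component_add
      using both one two by simp
  next
    case (6 i j)
    then show ?case
      using sw_power_not_coboundary [of j n] coboundaries_0 [of ?P]
      by (simp add: pow cohomology_coeff_class [OF swp] component_sw_power del: image_iff)
  qed
qed

subsection \<open>Tensor powers\<close>

lemma pure_nonzero [simp]: "{s. pure t s = 1} = {t}" "{s. pure t s \<noteq> 0} = {t}"
  by (auto simp: pure_def)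

lemma bit_mult_eq_1_iff [simp]: "a * b = 1 \<longleftrightarrow> a = 1 \<and> b = (1::bit)"
  by (cases a) auto

locale tensor_power_ring = truncated_polynomial_ring +
  fixes k :: nat
  assumes k_pos: "0 < k"
begin

abbreviation F :: "((nat \<Rightarrow> 'a) \<Rightarrow> bit) ring" where "F \<equiv> free_tuple_ring k R"

abbreviation T :: "((nat \<Rightarrow> 'a) \<Rightarrow> bit) set ring" where "T \<equiv> tensor_power k R"

definition tuple_mult :: "(nat \<Rightarrow> 'a) \<Rightarrow> (nat \<Rightarrow> 'a) \<Rightarrow> nat \<Rightarrow> 'a" where
  "tuple_mult s t = (\<lambda>i\<in>{..<k}. s i \<otimes> t i)"

lemma F_simps:
  "carrier F = {u. finite {t. u t \<noteq> 0} \<and> {t. u t \<noteq> 0} \<subseteq> tuples k R}"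
  "\<one>\<^bsub>F\<^esub> = pure (\<lambda>i\<in>{..<k}. \<one>)" "\<zero>\<^bsub>F\<^esub> = 0" "u \<oplus>\<^bsub>F\<^esub> v = u + v"
  by (simp_all add: free_tuple_ring_def zero_fun_def plus_fun_def)

lemma F_mult: "u \<otimes>\<^bsub>F\<^esub> v = (\<lambda>t. \<Sum>s\<in>{s. u s \<noteq> 0}. \<Sum>s'\<in>{s'. v s' \<noteq> 0}.
    if t = tuple_mult s s' then u s * v s' else 0)"
  by (simp add: free_tuple_ring_def tuple_mult_def)

lemma F_mult_superset:
  assumes "finite A" "finite B" "{s. u s \<noteq> 0} \<subseteq> A" "{s. v s \<noteq> 0} \<subseteq> B"
  shows "(u \<otimes>\<^bsub>F\<^esub> v) t = (\<Sum>s\<in>A. \<Sum>s'\<in>B. if t = tuple_mult s s' then u s * v s' else 0)"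
proof -
  have "(\<Sum>s'\<in>{s'. v s' \<noteq> 0}. if t = tuple_mult s s' then u s * v s' else 0) =
      (\<Sum>s'\<in>B. if t = tuple_mult s s' then u s * v s' else 0)" for s
    using assms by (intro sum.mono_neutral_left) auto
  then have "(u \<otimes>\<^bsub>F\<^esub> v) t = (\<Sum>s\<in>{s. u s \<noteq> 0}. \<Sum>s'\<in>B. if t = tuple_mult s s' then u s * v s' else 0)"
    unfolding F_mult by simp
  also have "\<dots> = (\<Sum>s\<in>A. \<Sum>s'\<in>B. if t = tuple_mult s s' then u s * v s' else 0)"
    using assms by (intro sum.mono_neutral_left) (auto intro!: sum.neutral split: if_splits)
  finally show ?thesis .
qed

lemma pure_mult: "pure s \<otimes>\<^bsub>F\<^esub> pure t = pure (tuple_mult s t)"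
  unfolding F_mult by (intro ext) (simp add: fun_cong [OF pure_def [of s], of s] fun_cong [OF pure_def [of t], of t]
      fun_cong [OF pure_def [of "tuple_mult s t"]])

lemma pure_carrier: "t \<in> tuples k R \<Longrightarrow> pure t \<in> carrier F"
  by (simp add: F_simps)

lemma tuple_mult_tuples: "s \<in> tuples k R \<Longrightarrow> t \<in> tuples k R \<Longrightarrow> tuple_mult s t \<in> tuples k R"
  by (auto simp: tuples_def tuple_mult_def PiE_iff)

lemma F_add_closed:
  assumes "u \<in> carrier F" "v \<in> carrier F"
  shows "u + v \<in> carrier F"
proof -
  have "{t. (u + v) t \<noteq> 0} \<subseteq> {t. u t \<noteq> 0} \<union> {t. v t \<noteq> 0}"
    by auto
  then show ?thesis
    using assms unfolding F_simps by (blast intro: finite_subset)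
qed

lemma F_add_self: "(u :: (nat \<Rightarrow> 'a) \<Rightarrow> bit) + u = 0"
  by (simp add: fun_eq_iff)

text \<open>A finitely supported function into \<open>bit\<close> is the sum of
  \<open>pure t\<close> over its support, all coefficients being 1. Identities that are additive in
  each argument can therefore be checked on tuples, which is how the ring axioms are proved.\<close>

lemma F_induct [consumes 1, case_names zero pure add]:
  assumes u: "u \<in> carrier F" and zero: "P 0" and pure: "\<And>t. t \<in> tuples k R \<Longrightarrow> P (pure t)"
    and add: "\<And>u v. u \<in> carrier F \<Longrightarrow> v \<in> carrier F \<Longrightarrow> P u \<Longrightarrow> P v \<Longrightarrow> P (u + v)"
  shows "P u"
proof -
  have fin: "finite {t. u t \<noteq> 0}" "{t. u t \<noteq> 0} \<subseteq> tuples k R"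
    using u by (simp_all add: F_simps)
  have zc: "0 \<in> carrier F"
    by (simp add: F_simps)
  have sums: "(\<Sum>t\<in>D. pure t) \<in> carrier F \<and> P (\<Sum>t\<in>D. pure t)"
    if "finite D" "D \<subseteq> tuples k R" for D
    using that
  proof (induction D)
    case empty
    show ?case
      using zero zc by (simp only: sum.empty simp_thms)
  next
    case (insert t D)
    then have "pure t \<in> carrier F" "(\<Sum>t\<in>D. pure t) \<in> carrier F" "P (pure t)" "P (\<Sum>t\<in>D. pure t)"
      using pure pure_carrier by auto
    then show ?case
      using insert.hyps add F_add_closed by (simp only: sum.insert not_False_eq_True simp_thms)
  qed
  have "u = (\<Sum>t\<in>{t. u t \<noteq> 0}. pure t)"
  proof
    fix s
    have "(\<Sum>t\<in>{t. u t \<noteq> 0}. pure t) s = (\<Sum>t\<in>{t. u t \<noteq> 0}. pure t s)"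
      using fin(1) by (induction rule: finite_induct) simp_all
    also have "\<dots> = u s"
      using fin(1) by (simp add: pure_def)
    finally show "u s = (\<Sum>t\<in>{t. u t \<noteq> 0}. pure t) s" ..
  qed
  with sums [OF fin] show ?thesis
    by (metis (no_types, lifting))
qed

lemma F_l_distr:
  assumes "u \<in> carrier F" "v \<in> carrier F" "w \<in> carrier F"
  shows "(u + v) \<otimes>\<^bsub>F\<^esub> w = u \<otimes>\<^bsub>F\<^esub> w + v \<otimes>\<^bsub>F\<^esub> w"
proof
  fix t
  let ?A = "{t. u t \<noteq> 0} \<union> {t. v t \<noteq> 0}" and ?B = "{t. w t \<noteq> 0}"
  have fin: "finite ?A" "finite ?B"
    using assms by (simp_all add: F_simps)
  have "((u + v) \<otimes>\<^bsub>F\<^esub> w) t = (\<Sum>s\<in>?A. \<Sum>s'\<in>?B. if t = tuple_mult s s' then (u + v) s * w s' else 0)"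
    by (rule F_mult_superset [OF fin]) auto
  moreover have "(u \<otimes>\<^bsub>F\<^esub> w) t = (\<Sum>s\<in>?A. \<Sum>s'\<in>?B. if t = tuple_mult s s' then u s * w s' else 0)"
    by (rule F_mult_superset [OF fin]) auto
  moreover have "(v \<otimes>\<^bsub>F\<^esub> w) t = (\<Sum>s\<in>?A. \<Sum>s'\<in>?B. if t = tuple_mult s s' then v s * w s' else 0)"
    by (rule F_mult_superset [OF fin]) auto
  moreover have "(if c then (u + v) s * w s' else 0) = (if c then u s * w s' else 0) + (if c then v s * w s' else 0)"
    for c s s'
    by (simp add: distrib_right)
  ultimately show "((u + v) \<otimes>\<^bsub>F\<^esub> w) t = (u \<otimes>\<^bsub>F\<^esub> w + v \<otimes>\<^bsub>F\<^esub> w) t"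
    by (simp only: plus_fun_apply sum.distrib)
qed

lemma F_comm:
  assumes "u \<in> carrier F" "v \<in> carrier F"
  shows "u \<otimes>\<^bsub>F\<^esub> v = v \<otimes>\<^bsub>F\<^esub> u"
proof
  fix t
  let ?A = "{t. u t \<noteq> 0}" and ?B = "{t. v t \<noteq> 0}"
  have AB: "s i \<in> carrier R" if "s \<in> ?A \<union> ?B" "i < k" for s i
    using that assms by (auto simp: F_simps tuples_def)
  have eq: "(if t = tuple_mult s s' then u s * v s' else 0) = (if t = tuple_mult s' s then v s' * u s else 0)"
    if "s \<in> ?A" "s' \<in> ?B" for s s'
  proof -
    have "tuple_mult s s' = tuple_mult s' s"
      unfolding tuple_mult_def using AB that by (intro restrict_ext m_comm) auto
    then show ?thesis
      by (simp add: mult.commute)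
  qed
  have "(u \<otimes>\<^bsub>F\<^esub> v) t = (\<Sum>s\<in>?A. \<Sum>s'\<in>?B. if t = tuple_mult s' s then v s' * u s else 0)"
    unfolding F_mult by (intro sum.cong refl eq)
  also have "\<dots> = (v \<otimes>\<^bsub>F\<^esub> u) t"
    unfolding F_mult by (rule sum.swap)
  finally show "(u \<otimes>\<^bsub>F\<^esub> v) t = (v \<otimes>\<^bsub>F\<^esub> u) t" .
qed

lemma F_mult_closed:
  assumes "u \<in> carrier F" "v \<in> carrier F"
  shows "u \<otimes>\<^bsub>F\<^esub> v \<in> carrier F"
proof -
  have "t \<in> (\<lambda>(s, s'). tuple_mult s s') ` ({s. u s \<noteq> 0} \<times> {s. v s \<noteq> 0})" if "(u \<otimes>\<^bsub>F\<^esub> v) t \<noteq> 0" for t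
  proof -
    from that obtain s where s: "s \<in> {s. u s \<noteq> 0}"
      "(\<Sum>s'\<in>{s'. v s' \<noteq> 0}. if t = tuple_mult s s' then u s * v s' else 0) \<noteq> 0"
      unfolding F_mult by (rule sum.not_neutral_contains_not_neutral)
    from s(2) obtain s' where s': "s' \<in> {s. v s \<noteq> 0}" "(if t = tuple_mult s s' then u s * v s' else 0) \<noteq> 0"
      by (rule sum.not_neutral_contains_not_neutral)
    then have "t = tuple_mult s s'"
      by presburger
    with s(1) s'(1) show ?thesis
      by (intro image_eqI [of _ _ "(s, s')"]) simp_all
  qed
  then have sub: "{t. (u \<otimes>\<^bsub>F\<^esub> v) t \<noteq> 0} \<subseteq> (\<lambda>(s, s'). tuple_mult s s') ` ({s. u s \<noteq> 0} \<times> {s. v s \<noteq> 0})"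
    by blast
  have uv: "finite ({s. u s \<noteq> 0} \<times> {s. v s \<noteq> 0})" "{s. u s \<noteq> 0} \<subseteq> tuples k R" "{s. v s \<noteq> 0} \<subseteq> tuples k R"
    using assms by (simp_all add: F_simps)
  have "finite {t. (u \<otimes>\<^bsub>F\<^esub> v) t \<noteq> 0}"
    by (rule finite_subset [OF sub finite_imageI [OF uv(1)]])
  moreover have "(\<lambda>(s, s'). tuple_mult s s') ` ({s. u s \<noteq> 0} \<times> {s. v s \<noteq> 0}) \<subseteq> tuples k R"
  proof (rule image_subsetI)
    fix x assume "x \<in> {s. u s \<noteq> 0} \<times> {s. v s \<noteq> 0}"
    then show "(case x of (s, s') \<Rightarrow> tuple_mult s s') \<in> tuples k R"
      using uv(2,3) by (cases x) (simp add: tuple_mult_tuples subset_iff)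
  qed
  then have "{t. (u \<otimes>\<^bsub>F\<^esub> v) t \<noteq> 0} \<subseteq> tuples k R"
    using sub by (rule order_trans [rotated])
  ultimately show ?thesis
    by (simp only: F_simps mem_Collect_eq simp_thms)
qed

lemma F_zero_mult [simp]: "0 \<otimes>\<^bsub>F\<^esub> w = 0"
  unfolding F_mult by (simp add: fun_eq_iff)

lemma F_r_distr:
  assumes "u \<in> carrier F" "v \<in> carrier F" "w \<in> carrier F"
  shows "w \<otimes>\<^bsub>F\<^esub> (u + v) = w \<otimes>\<^bsub>F\<^esub> u + w \<otimes>\<^bsub>F\<^esub> v"
  using F_l_distr [OF assms] F_comm [OF assms(3) F_add_closed [OF assms(1,2)]]
    F_comm [OF assms(3,1)] F_comm [OF assms(3,2)] by (simp only:)

lemma F_mult_zero [simp]: "w \<otimes>\<^bsub>F\<^esub> 0 = 0"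
  unfolding F_mult by (simp add: fun_eq_iff)

lemma one_tuple: "(\<lambda>i\<in>{..<k}. \<one>) \<in> tuples k R"
  by (auto simp: tuples_def)

lemma F_assoc:
  assumes u: "u \<in> carrier F" and v: "v \<in> carrier F" and w: "w \<in> carrier F"
  shows "(u \<otimes>\<^bsub>F\<^esub> v) \<otimes>\<^bsub>F\<^esub> w = u \<otimes>\<^bsub>F\<^esub> (v \<otimes>\<^bsub>F\<^esub> w)"
proof -
  have ppp: "tuple_mult (tuple_mult r s) t = tuple_mult r (tuple_mult s t)"
    if "r \<in> tuples k R" "s \<in> tuples k R" "t \<in> tuples k R" for r s t
    using that unfolding tuple_mult_def by (intro restrict_ext) (auto simp: tuples_def PiE_iff m_assoc)
  have pp: "(pure r \<otimes>\<^bsub>F\<^esub> pure s) \<otimes>\<^bsub>F\<^esub> w = pure r \<otimes>\<^bsub>F\<^esub> (pure s \<otimes>\<^bsub>F\<^esub> w)"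
    if "r \<in> tuples k R" "s \<in> tuples k R" for r s
    using w
  proof (induction rule: F_induct)
    case (add w w')
    then show ?case
      using that by (simp only: F_r_distr F_mult_closed pure_carrier)
  qed (use that in \<open>simp_all only: pure_mult ppp F_mult_zero\<close>)
  have p: "(pure r \<otimes>\<^bsub>F\<^esub> v) \<otimes>\<^bsub>F\<^esub> w = pure r \<otimes>\<^bsub>F\<^esub> (v \<otimes>\<^bsub>F\<^esub> w)" if "r \<in> tuples k R" for r
    using v
  proof (induction rule: F_induct)
    case (add v v')
    then show ?case
      using that w by (simp only: F_r_distr F_l_distr F_mult_closed pure_carrier)
  qed (use that pp in \<open>simp_all only: F_zero_mult F_mult_zero\<close>)
  show ?thesis
    using u
  proof (induction rule: F_induct)
    case (add u u')
    then show ?case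
      using v w by (simp only: F_l_distr F_mult_closed)
  qed (use p in \<open>simp_all only: F_zero_mult\<close>)
qed

lemma F_one_mult:
  assumes "u \<in> carrier F"
  shows "\<one>\<^bsub>F\<^esub> \<otimes>\<^bsub>F\<^esub> u = u"
  using assms
proof (induction rule: F_induct)
  case (pure t)
  then have "tuple_mult (\<lambda>i\<in>{..<k}. \<one>) t = t"
    by (intro ext) (auto simp: tuple_mult_def tuples_def PiE_iff extensional_def)
  then show ?case
    by (simp only: F_simps pure_mult)
next
  case (add u v)
  then show ?case
    using one_tuple by (simp only: F_r_distr F_simps(2) pure_carrier)
qed (rule F_mult_zero)

sublocale F: cring F
proof (rule cringI)
  show "abelian_group F"
  proof (rule abelian_groupI)
    fix u assume "u \<in> carrier F"
    then show "\<exists>v\<in>carrier F. v \<oplus>\<^bsub>F\<^esub> u = \<zero>\<^bsub>F\<^esub>"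
      by (intro bexI [of _ u]) (simp_all only: F_simps(3,4) F_add_self)
  next
    show "\<zero>\<^bsub>F\<^esub> \<in> carrier F"
      by (simp add: F_simps)
  qed (simp_all add: F_simps(3,4) F_add_closed ac_simps del: plus_fun_apply)
  have one: "\<one>\<^bsub>F\<^esub> \<in> carrier F"
    unfolding F_simps(2) by (rule pure_carrier [OF one_tuple])
  show "comm_monoid F"
    by (rule comm_monoidI [OF F_mult_closed one F_assoc F_one_mult F_comm])
qed (simp only: F_simps F_l_distr)

end

section \<open>Additive spans in commutative rings\<close>

inductive_set addspan :: "('b, 'm) ring_scheme \<Rightarrow> 'b set \<Rightarrow> 'b set" for S G where
  zero: "\<zero>\<^bsub>S\<^esub> \<in> addspan S G"
| generator: "g \<in> G \<Longrightarrow> g \<in> addspan S G"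
| add: "x \<in> addspan S G \<Longrightarrow> y \<in> addspan S G \<Longrightarrow> x \<oplus>\<^bsub>S\<^esub> y \<in> addspan S G"

context cring
begin

lemma addspan_closed: "x \<in> addspan R G \<Longrightarrow> G \<subseteq> carrier R \<Longrightarrow> x \<in> carrier R"
  by (induction rule: addspan.induct) auto

lemma addspan_trivial: "x \<in> addspan R G \<Longrightarrow> (\<And>g. g \<in> G \<Longrightarrow> g = \<zero>) \<Longrightarrow> x = \<zero>"
  by (induction rule: addspan.induct) auto

lemma addspan_mult:
  assumes x: "x \<in> addspan R G" and y: "y \<in> addspan R H" and G: "G \<subseteq> carrier R" and H: "H \<subseteq> carrier R"
    and gen: "\<And>g h. g \<in> G \<Longrightarrow> h \<in> H \<Longrightarrow> g \<otimes> h \<in> addspan R K"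
  shows "x \<otimes> y \<in> addspan R K"
  using x
proof (induction rule: addspan.induct)
  case zero
  then show ?case
    using addspan_closed [OF y H] by (simp add: addspan.zero)
next
  case (generator g)
  show ?case
    using y
  proof (induction rule: addspan.induct)
    case zero
    then show ?case
      using generator G by (simp add: addspan.zero subset_iff)
  next
    case (generator h)
    then show ?case
      using gen \<open>g \<in> G\<close> by blast
  next
    case (add u v)
    then show ?case
      using \<open>g \<in> G\<close> G addspan_closed [OF add.hyps(1) H] addspan_closed [OF add.hyps(2) H]
      by (simp add: r_distr addspan.add subset_iff)
  qed
next
  case (add u v)
  then show ?case
    using addspan_closed [OF y H] addspan_closed [OF add.hyps(1) G] addspan_closed [OF add.hyps(2) G]
    by (simp add: l_distr addspan.add)
qed

text \<open>Closure under sums absorbs the binomial coefficients as multiplicities, so membership in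
  the span records only which monomials may occur. In characteristic two the span is the additive
  subgroup.\<close>

lemma power_add_addspan:
  assumes x: "x \<in> carrier R" and y: "y \<in> carrier R"
  shows "(x \<oplus> y) [^] (m::nat) \<in> addspan R {x [^] i \<otimes> y [^] (m - i) | i. i \<le> m}"
proof (induction m)
  case 0
  show ?case
    by (rule addspan.generator) (auto intro: exI [of _ "0::nat"])
next
  case (Suc m)
  have "x \<oplus> y \<in> addspan R {x, y}"
    by (intro addspan.add addspan.generator) auto
  have "(x \<oplus> y) [^] m \<otimes> (x \<oplus> y) \<in> addspan R {x [^] i \<otimes> y [^] (Suc m - i) | i. i \<le> Suc m}"
  proof (rule addspan_mult [OF Suc.IH \<open>x \<oplus> y \<in> addspan R {x, y}\<close>])
    fix g h assume "g \<in> {x [^] i \<otimes> y [^] (m - i) | i. i \<le> m}" and h: "h \<in> {x, y}"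
    then obtain i where i: "g = x [^] i \<otimes> y [^] (m - i)" "i \<le> m"
      by auto
    have "x [^] i \<otimes> y [^] (m - i) \<otimes> x = x [^] Suc i \<otimes> y [^] (Suc m - Suc i)"
      using x y by (simp add: m_ac)
    moreover have "x [^] i \<otimes> y [^] (m - i) \<otimes> y = x [^] i \<otimes> y [^] (Suc m - i)"
      using x y i(2) by (simp add: m_assoc Suc_diff_le)
    ultimately have "\<exists>j\<le>Suc m. g \<otimes> h = x [^] j \<otimes> y [^] (Suc m - j)"
      using h i by (metis insertE le_SucI not_less_eq_eq singletonD)
    then show "g \<otimes> h \<in> addspan R {x [^] i \<otimes> y [^] (Suc m - i) | i. i \<le> Suc m}"
      by (intro addspan.generator) auto
  qed (use x y in auto)
  then show ?case
    by simp
qed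

lemma frobenius_char2:
  assumes char2: "\<And>z. z \<in> carrier R \<Longrightarrow> z \<oplus> z = \<zero>" and x: "x \<in> carrier R" and y: "y \<in> carrier R"
  shows "(x \<oplus> y) [^] (2 ^ e :: nat) = x [^] (2 ^ e :: nat) \<oplus> y [^] (2 ^ e :: nat)"
proof (induction e)
  case (Suc e)
  have sq: "z [^] (2 ^ Suc e :: nat) = z [^] (2 ^ e :: nat) \<otimes> z [^] (2 ^ e :: nat)" if "z \<in> carrier R" for z
    using that by (simp add: nat_pow_mult mult_2)
  have *: "(a \<oplus> b) \<otimes> (a \<oplus> b) = a \<otimes> a \<oplus> b \<otimes> b" if "a \<in> carrier R" "b \<in> carrier R" for a b
  proof -
    have "(a \<oplus> b) \<otimes> (a \<oplus> b) = a \<otimes> a \<oplus> b \<otimes> b \<oplus> (a \<otimes> b \<oplus> a \<otimes> b)"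
      using that by (simp add: l_distr r_distr a_ac m_comm)
    then show ?thesis
      using that char2 by simp
  qed
  show ?case
    using x y Suc.IH by (simp add: sq * del: power_Suc)
qed (use x y in simp)

end

section \<open>The tensor power as a quotient ring\<close>

context tensor_power_ring
begin

abbreviation I :: "((nat \<Rightarrow> 'a) \<Rightarrow> bit) set" where "I \<equiv> Idl\<^bsub>F\<^esub> (multilinear_relations k R)"

definition cls :: "((nat \<Rightarrow> 'a) \<Rightarrow> bit) \<Rightarrow> ((nat \<Rightarrow> 'a) \<Rightarrow> bit) set" where "cls u = I +>\<^bsub>F\<^esub> u"

lemma multilinear_relations_eq:
  "multilinear_relations k R = {pure (t(i := a \<oplus> b)) + pure (t(i := a)) + pure (t(i := b)) | t i a b.
     t \<in> tuples k R \<and> i < k \<and> a \<in> carrier R \<and> b \<in> carrier R}"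
  by (simp add: multilinear_relations_def plus_fun_def)

lemma update_tuples: "t \<in> tuples k R \<Longrightarrow> i < k \<Longrightarrow> a \<in> carrier R \<Longrightarrow> t(i := a) \<in> tuples k R"
  by (auto simp: tuples_def PiE_iff extensional_def)

lemma multilinear_relations_subset: "multilinear_relations k R \<subseteq> carrier F"
  unfolding multilinear_relations_eq
  by clarify (intro F_add_closed pure_carrier update_tuples a_closed; assumption)

lemma ideal_I: "ideal I F"
  by (rule F.genideal_ideal [OF multilinear_relations_subset])

sublocale T: cring T
  unfolding tensor_power_def by (rule ideal.quotient_is_cring [OF ideal_I F.is_cring])

lemma cls_hom: "cls \<in> ring_hom F T"
  unfolding cls_def tensor_power_def by (rule ideal.rcos_ring_hom [OF ideal_I])

lemma carrier_T: "carrier T = cls ` carrier F"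
  by (auto simp: tensor_power_def FactRing_def A_RCOSETS_def' cls_def)

lemma cls_closed [simp]: "u \<in> carrier F \<Longrightarrow> cls u \<in> carrier T"
  by (simp only: carrier_T imageI)

lemma cls_add: "u \<in> carrier F \<Longrightarrow> v \<in> carrier F \<Longrightarrow> cls (u + v) = cls u \<oplus>\<^bsub>T\<^esub> cls v"
  using ring_hom_add [OF cls_hom, of u v] by (simp only: F_simps)

lemma cls_mult: "u \<in> carrier F \<Longrightarrow> v \<in> carrier F \<Longrightarrow> cls (u \<otimes>\<^bsub>F\<^esub> v) = cls u \<otimes>\<^bsub>T\<^esub> cls v"
  by (rule ring_hom_mult [OF cls_hom])

lemma cls_one: "cls (pure (\<lambda>i\<in>{..<k}. \<one>)) = \<one>\<^bsub>T\<^esub>"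
  using ring_hom_one [OF cls_hom] by (simp only: F_simps)

lemma mem_cls: "v \<in> cls u \<longleftrightarrow> (\<exists>x\<in>I. v = x + u)"
  unfolding cls_def a_r_coset_def' by (auto simp only: F_simps)

lemma cls_eq_zero: "u \<in> I \<Longrightarrow> cls u = \<zero>\<^bsub>T\<^esub>"
proof -
  assume u: "u \<in> I"
  interpret I: ideal I F
    by (rule ideal_I)
  have "\<zero>\<^bsub>T\<^esub> = I"
    by (simp add: tensor_power_def FactRing_def)
  then show ?thesis
    unfolding cls_def using u I.a_subset
    by (simp, intro F.a_coset_join2 I.is_additive_subgroup [THEN additive_subgroup.a_subgroup]) auto
qed

lemma F_zero_closed: "0 \<in> carrier F"
  using F.zero_closed by (simp only: F_simps)

lemma cls_0: "cls 0 = \<zero>\<^bsub>T\<^esub>"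
  using additive_subgroup.zero_closed [OF ideal.axioms(1) [OF ideal_I]] cls_eq_zero
  by (simp only: F_simps)

lemma T_char2 [simp]: "w \<in> carrier T \<Longrightarrow> w \<oplus>\<^bsub>T\<^esub> w = \<zero>\<^bsub>T\<^esub>"
  unfolding carrier_T by (elim imageE) (simp only: cls_add [symmetric] F_add_self cls_0)

lemma T_eqI:
  assumes "x \<in> carrier T" "y \<in> carrier T" "x \<oplus>\<^bsub>T\<^esub> y = \<zero>\<^bsub>T\<^esub>"
  shows "x = y"
  using assms T_char2 [of y] T.a_assoc [of x y y] by simp

lemma cls_pure_update_add:
  assumes t: "t \<in> tuples k R" "i < k" and a: "a \<in> carrier R" and b: "b \<in> carrier R"
  shows "cls (pure (t(i := a \<oplus> b))) = cls (pure (t(i := a))) \<oplus>\<^bsub>T\<^esub> cls (pure (t(i := b)))"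
proof -
  have c: "pure (t(i := a \<oplus> b)) \<in> carrier F" "pure (t(i := a)) \<in> carrier F" "pure (t(i := b)) \<in> carrier F"
    using assms by (auto intro!: pure_carrier update_tuples)
  have "pure (t(i := a \<oplus> b)) + pure (t(i := a)) + pure (t(i := b)) \<in> multilinear_relations k R"
    unfolding multilinear_relations_eq using assms by blast
  then have "cls (pure (t(i := a \<oplus> b)) + pure (t(i := a)) + pure (t(i := b))) = \<zero>\<^bsub>T\<^esub>"
    using F.genideal_self [OF multilinear_relations_subset] by (intro cls_eq_zero) blast
  then have "cls (pure (t(i := a \<oplus> b))) \<oplus>\<^bsub>T\<^esub> (cls (pure (t(i := a))) \<oplus>\<^bsub>T\<^esub> cls (pure (t(i := b)))) = \<zero>\<^bsub>T\<^esub>"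
    unfolding cls_add [OF F_add_closed [OF c(1,2)] c(3)] cls_add [OF c(1,2)]
      T.a_assoc [OF cls_closed [OF c(1)] cls_closed [OF c(2)] cls_closed [OF c(3)]] .
  then show ?thesis
    by (rule T_eqI [OF cls_closed [OF c(1)] T.a_closed [OF cls_closed [OF c(2)] cls_closed [OF c(3)]]])
qed

text \<open>The inclusion of the ring as slot \<open>i\<close> of the tensor power, with units in
  all other slots; \<open>iota i X\<close> is the variable belonging to that slot.\<close>

definition iota :: "nat \<Rightarrow> 'a \<Rightarrow> ((nat \<Rightarrow> 'a) \<Rightarrow> bit) set" where
  "iota i r = cls (pure ((\<lambda>j\<in>{..<k}. \<one>)(i := r)))"

lemma iota_closed [simp]: "i < k \<Longrightarrow> r \<in> carrier R \<Longrightarrow> iota i r \<in> carrier T"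
  unfolding iota_def by (intro cls_closed pure_carrier update_tuples one_tuple)

lemma iota_add: "i < k \<Longrightarrow> r \<in> carrier R \<Longrightarrow> s \<in> carrier R \<Longrightarrow> iota i (r \<oplus> s) = iota i r \<oplus>\<^bsub>T\<^esub> iota i s"
  unfolding iota_def by (rule cls_pure_update_add [OF one_tuple])

lemma iota_mult:
  assumes "i < k" "r \<in> carrier R" "s \<in> carrier R"
  shows "iota i (r \<otimes> s) = iota i r \<otimes>\<^bsub>T\<^esub> iota i s"
proof -
  have "tuple_mult ((\<lambda>j\<in>{..<k}. \<one>)(i := r)) ((\<lambda>j\<in>{..<k}. \<one>)(i := s)) = (\<lambda>j\<in>{..<k}. \<one>)(i := r \<otimes> s)"
    using assms by (intro ext) (simp add: tuple_mult_def)
  then show ?thesis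
    unfolding iota_def using assms
    by (simp only: cls_mult [symmetric] pure_carrier update_tuples one_tuple pure_mult)
qed

lemma iota_one: "i < k \<Longrightarrow> iota i \<one> = \<one>\<^bsub>T\<^esub>"
proof -
  assume "i < k"
  then have "(\<lambda>j\<in>{..<k}. \<one>)(i := \<one>) = (\<lambda>j\<in>{..<k}. \<one>)"
    by (intro ext) simp
  then show ?thesis
    by (simp only: iota_def cls_one)
qed

lemma iota_zero: "i < k \<Longrightarrow> iota i \<zero> = \<zero>\<^bsub>T\<^esub>"
  using iota_add [of i \<zero> \<zero>] by simp

lemma iota_power: "i < k \<Longrightarrow> r \<in> carrier R \<Longrightarrow> iota i (r [^] (m::nat)) = iota i r [^]\<^bsub>T\<^esub> m"
  by (induction m) (simp_all add: iota_one iota_mult)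

text \<open>Initial segments serve to write a pure tensor as the product of its factors.\<close>

definition initial_segment :: "(nat \<Rightarrow> 'a) \<Rightarrow> nat \<Rightarrow> nat \<Rightarrow> 'a" where
  "initial_segment t m = (\<lambda>i\<in>{..<k}. if i < m then t i else \<one>)"

lemma initial_segment_tuples: "t \<in> tuples k R \<Longrightarrow> initial_segment t m \<in> tuples k R"
  by (auto simp: initial_segment_def tuples_def PiE_iff)

lemma cls_initial_segment_Suc:
  assumes "t \<in> tuples k R" "m < k"
  shows "cls (pure (initial_segment t (Suc m))) = cls (pure (initial_segment t m)) \<otimes>\<^bsub>T\<^esub> iota m (t m)"
proof -
  have tm: "t i \<in> carrier R" if "i < k" for i
    using assms that by (auto simp: tuples_def)
  have "tuple_mult (initial_segment t m) ((\<lambda>j\<in>{..<k}. \<one>)(m := t m)) = initial_segment t (Suc m)"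
    using assms(2) tm by (intro ext) (auto simp: tuple_mult_def initial_segment_def less_Suc_eq)
  then show ?thesis
    unfolding iota_def using assms tm
    by (simp only: cls_mult [symmetric] pure_carrier update_tuples one_tuple initial_segment_tuples pure_mult)
qed

lemma initial_segment_full: "t \<in> tuples k R \<Longrightarrow> initial_segment t k = t"
  by (intro ext) (auto simp: initial_segment_def tuples_def PiE_iff extensional_def)

lemma cls_initial_segment_0: "cls (pure (initial_segment t 0)) = \<one>\<^bsub>T\<^esub>"
  by (simp add: initial_segment_def cls_one)

subsection \<open>The iterated multiplication\<close>

definition tuple_prod :: "nat \<Rightarrow> (nat \<Rightarrow> 'a) \<Rightarrow> 'a" where
  "tuple_prod m t = foldr (\<lambda>i y. t i \<otimes> y) [0..<m] \<one>"

lemma foldr_closed: "(\<And>i. i < m \<Longrightarrow> t i \<in> carrier R) \<Longrightarrow> y \<in> carrier R \<Longrightarrow>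
    foldr (\<lambda>i y. t i \<otimes> y) [0..<m] y \<in> carrier R"
  by (induction m arbitrary: y) auto

lemma foldr_eq: "(\<And>i. i < m \<Longrightarrow> t i \<in> carrier R) \<Longrightarrow> y \<in> carrier R \<Longrightarrow>
    foldr (\<lambda>i y. t i \<otimes> y) [0..<m] y = tuple_prod m t \<otimes> y"
proof (induction m arbitrary: y)
  case (Suc m)
  have c: "tuple_prod m t \<in> carrier R"
    unfolding tuple_prod_def using Suc.prems(1) by (intro foldr_closed) auto
  have "tuple_prod (Suc m) t = tuple_prod m t \<otimes> t m"
    using Suc.IH [of "t m \<otimes> \<one>"] Suc.prems(1) by (simp add: tuple_prod_def)
  then show ?case
    using Suc.IH [of "t m \<otimes> y"] Suc.prems c by (simp add: m_assoc)
qed (simp add: tuple_prod_def)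

lemma tuple_prod_closed: "(\<And>i. i < m \<Longrightarrow> t i \<in> carrier R) \<Longrightarrow> tuple_prod m t \<in> carrier R"
  unfolding tuple_prod_def by (rule foldr_closed) auto

lemma tuple_prod_0: "tuple_prod 0 t = \<one>"
  by (simp add: tuple_prod_def)

lemma tuple_prod_Suc: "(\<And>i. i \<le> m \<Longrightarrow> t i \<in> carrier R) \<Longrightarrow> tuple_prod (Suc m) t = tuple_prod m t \<otimes> t m"
  using foldr_eq [of m t "t m \<otimes> \<one>"] by (simp add: tuple_prod_def)

lemma tuple_prod_cong: "(\<And>i. i < m \<Longrightarrow> s i = t i) \<Longrightarrow> tuple_prod m s = tuple_prod m t"
  unfolding tuple_prod_def by (rule foldr_cong) auto

lemma tuple_prod_mult:
  "(\<And>i. i < m \<Longrightarrow> s i \<in> carrier R) \<Longrightarrow> (\<And>i. i < m \<Longrightarrow> t i \<in> carrier R) \<Longrightarrow>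
    tuple_prod m (\<lambda>i. s i \<otimes> t i) = tuple_prod m s \<otimes> tuple_prod m t"
proof (induction m)
  case (Suc m)
  have "tuple_prod m s \<in> carrier R" "tuple_prod m t \<in> carrier R"
    using Suc.prems by (auto intro: tuple_prod_closed)
  then show ?case
    using Suc by (simp add: tuple_prod_Suc m_ac)
qed (simp add: tuple_prod_0)

lemma tuple_prod_add:
  "(\<And>j. j < m \<Longrightarrow> t j \<in> carrier R) \<Longrightarrow> i < m \<Longrightarrow> a \<in> carrier R \<Longrightarrow> b \<in> carrier R \<Longrightarrow>
    tuple_prod m (t(i := a \<oplus> b)) = tuple_prod m (t(i := a)) \<oplus> tuple_prod m (t(i := b))"
proof (induction m)
  case (Suc m)
  have c: "tuple_prod m t \<in> carrier R" "\<And>a. a \<in> carrier R \<Longrightarrow> tuple_prod m (t(i := a)) \<in> carrier R"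
    using Suc.prems by (auto intro: tuple_prod_closed)
  have S: "tuple_prod (Suc m) (t(i := x)) = tuple_prod m (t(i := x)) \<otimes> (t(i := x)) m"
    if "x \<in> carrier R" for x
    by (rule tuple_prod_Suc) (use Suc.prems that in auto)
  note S' = S [OF Suc.prems(3)] S [OF Suc.prems(4)] S [OF a_closed [OF Suc.prems(3,4)]]
  show ?case
  proof (cases "i = m")
    case True
    then have "tuple_prod m (t(i := x)) = tuple_prod m t" for x
      by (intro tuple_prod_cong) auto
    moreover have "(t(i := x)) m = x" for x
      using True by simp
    ultimately show ?thesis
      unfolding S' using Suc.prems(3,4) c(1) by (simp only: r_distr)
  next
    case False
    then have "(t(i := x)) m = t m" for x
      by simp
    moreover have "i < m" "t m \<in> carrier R"
      using False Suc.prems by auto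
    ultimately show ?thesis
      unfolding S' using Suc.IH Suc.prems c(2) by (simp add: l_distr del: fun_upd_apply)
  qed
qed simp

abbreviation mu :: "((nat \<Rightarrow> 'a) \<Rightarrow> bit) \<Rightarrow> 'a" where "mu \<equiv> free_iterated_mult k R"

lemma tuple_prod_tuple: "t \<in> tuples k R \<Longrightarrow> tuple_prod k t \<in> carrier R"
  by (rule tuple_prod_closed) (auto simp: tuples_def)

lemma mu_superset:
  assumes "finite A" "A \<subseteq> tuples k R" "{t. u t \<noteq> 0} \<subseteq> A"
  shows "mu u = (\<Oplus>t\<in>A. if u t = 1 then tuple_prod k t else \<zero>)"
  unfolding free_iterated_mult_def tuple_prod_def [symmetric]
  by (rule add.finprod_mono_neutral_cong_left) (use assms tuple_prod_tuple in auto)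

lemma mu_add:
  assumes "u \<in> carrier F" "v \<in> carrier F"
  shows "mu (u + v) = mu u \<oplus> mu v"
proof -
  let ?A = "{t. u t \<noteq> 0} \<union> {t. v t \<noteq> 0}"
  have A: "finite ?A" "?A \<subseteq> tuples k R"
    using assms by (auto simp: F_simps)
  have c: "(\<lambda>t. if w t = 1 then tuple_prod k t else \<zero>) \<in> ?A \<rightarrow> carrier R" for w :: "_ \<Rightarrow> bit"
    using A(2) tuple_prod_tuple by auto
  have "mu (u + v) = (\<Oplus>t\<in>?A. if (u + v) t = 1 then tuple_prod k t else \<zero>)"
    by (rule mu_superset [OF A]) auto
  also have "\<dots> = (\<Oplus>t\<in>?A. (if u t = 1 then tuple_prod k t else \<zero>) \<oplus> (if v t = 1 then tuple_prod k t else \<zero>))"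
  proof (rule add.finprod_cong' [OF refl])
    fix t assume "t \<in> ?A"
    then have "tuple_prod k t \<in> carrier R"
      using A(2) tuple_prod_tuple by blast
    then show "(if (u + v) t = 1 then tuple_prod k t else \<zero>) =
        (if u t = 1 then tuple_prod k t else \<zero>) \<oplus> (if v t = 1 then tuple_prod k t else \<zero>)"
      by (cases "u t"; cases "v t") (simp_all add: char2)
  qed (use A(2) tuple_prod_tuple in auto)
  also have "\<dots> = (\<Oplus>t\<in>?A. if u t = 1 then tuple_prod k t else \<zero>) \<oplus> (\<Oplus>t\<in>?A. if v t = 1 then tuple_prod k t else \<zero>)"
    by (rule finsum_addf [OF c c])
  also have "\<dots> = mu u \<oplus> mu v"
    using mu_superset [OF A, of u] mu_superset [OF A, of v] by auto
  finally show ?thesis .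
qed

lemma mu_pure: "t \<in> tuples k R \<Longrightarrow> mu (pure t) = tuple_prod k t"
  using mu_superset [of "{t}" "pure t"] tuple_prod_tuple [of t] by (simp add: pure_def)

lemma mu_0: "mu 0 = \<zero>"
  by (simp add: free_iterated_mult_def)

lemma mu_closed: "u \<in> carrier F \<Longrightarrow> mu u \<in> carrier R"
  by (induction rule: F_induct) (simp_all only: mu_0 mu_pure mu_add tuple_prod_tuple zero_closed a_closed)

lemma mu_mult:
  assumes "u \<in> carrier F" "v \<in> carrier F"
  shows "mu (u \<otimes>\<^bsub>F\<^esub> v) = mu u \<otimes> mu v"
proof -
  have p: "mu (pure s \<otimes>\<^bsub>F\<^esub> v) = mu (pure s) \<otimes> mu v" if s: "s \<in> tuples k R" for s
    using assms(2)
  proof (induction rule: F_induct)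
    case zero
    show ?case
      using mu_closed [OF pure_carrier [OF s]] by (simp only: F_mult_zero mu_0 r_null)
  next
    case (pure t)
    have "mu (pure s \<otimes>\<^bsub>F\<^esub> pure t) = tuple_prod k (tuple_mult s t)"
      using s pure by (simp only: pure_mult mu_pure tuple_mult_tuples)
    also have "\<dots> = tuple_prod k (\<lambda>i. s i \<otimes> t i)"
      by (rule tuple_prod_cong) (simp add: tuple_mult_def)
    also have "\<dots> = tuple_prod k s \<otimes> tuple_prod k t"
      using s pure by (intro tuple_prod_mult) (auto simp: tuples_def)
    finally show ?case
      using s pure by (simp only: mu_pure)
  next
    case (add u v)
    then show ?case
      using s by (simp only: F_r_distr pure_carrier mu_add F_mult_closed mu_closed r_distr)
  qed
  show ?thesis
    using assms(1)
  proof (induction rule: F_induct)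
    case zero
    show ?case
      using mu_closed [OF assms(2)] by (simp only: F_zero_mult mu_0 l_null)
  next
    case (add u u')
    then show ?case
      using assms(2) by (simp only: F_l_distr mu_add F_mult_closed mu_closed l_distr)
  qed (rule p)
qed

lemma F_idealI:
  assumes N: "N \<subseteq> carrier F" "0 \<in> N" "\<And>u v. u \<in> N \<Longrightarrow> v \<in> N \<Longrightarrow> u + v \<in> N"
    "\<And>u v. u \<in> N \<Longrightarrow> v \<in> carrier F \<Longrightarrow> v \<otimes>\<^bsub>F\<^esub> u \<in> N"
  shows "ideal N F"
proof (rule idealI [OF F.ring_axioms])
  show "subgroup N (add_monoid F)"
  proof (rule F.add.subgroupI)
    show "N \<noteq> {}"
      using N(2) by blast
    fix u assume u: "u \<in> N"
    then have "u \<in> carrier F" "u \<oplus>\<^bsub>F\<^esub> u = \<zero>\<^bsub>F\<^esub>"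
      using N(1) by (auto simp only: F_simps(3,4) F_add_self)
    then have "\<ominus>\<^bsub>F\<^esub> u = u"
      by (simp add: F.minus_equality)
    then show "\<ominus>\<^bsub>F\<^esub> u \<in> N"
      using u by (simp only:)
    show "u \<oplus>\<^bsub>F\<^esub> v \<in> N" if "v \<in> N" for v
      using N(3) [OF u that] by (simp only: F_simps)
  qed (rule N(1))
  show "x \<otimes>\<^bsub>F\<^esub> u \<in> N" "u \<otimes>\<^bsub>F\<^esub> x \<in> N" if "u \<in> N" "x \<in> carrier F" for u x
    using N(4) [OF that] F_comm [of u x] that N(1) by (auto simp only: subset_iff)
qed

text \<open>The elements annihilated by \<open>mu\<close> form an ideal because \<open>mu\<close> is
  multiplicative, and it contains the relations because a product is additive in each factor. Hence
  \<open>mu\<close> is constant on cosets and induces \<open>iterated_mult\<close>.\<close>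

lemma mu_I: "u \<in> I \<Longrightarrow> mu u = \<zero>"
proof -
  have "ideal {u \<in> carrier F. mu u = \<zero>} F"
    by (rule F_idealI) (auto simp only: F_zero_closed mu_0 F_add_closed mu_add l_zero zero_closed
        F_mult_closed mu_mult mu_closed r_null)
  moreover have "multilinear_relations k R \<subseteq> {u \<in> carrier F. mu u = \<zero>}"
  proof
    fix x assume x: "x \<in> multilinear_relations k R"
    then obtain t i a b where t: "t \<in> tuples k R" "i < k" "a \<in> carrier R" "b \<in> carrier R"
      and x_eq: "x = pure (t(i := a \<oplus> b)) + pure (t(i := a)) + pure (t(i := b))"
      unfolding multilinear_relations_eq by blast
    have up: "t(i := a \<oplus> b) \<in> tuples k R" "t(i := a) \<in> tuples k R" "t(i := b) \<in> tuples k R"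
      using t by (auto intro: update_tuples)
    have c: "tuple_prod k (t(i := a)) \<in> carrier R" "tuple_prod k (t(i := b)) \<in> carrier R"
      using up tuple_prod_tuple by auto
    have "mu x = (tuple_prod k (t(i := a)) \<oplus> tuple_prod k (t(i := b))) \<oplus> tuple_prod k (t(i := a)) \<oplus> tuple_prod k (t(i := b))"
      unfolding x_eq using up t tuple_prod_add [of k t i a b]
      by (simp add: mu_add mu_pure pure_carrier F_add_closed tuples_def PiE_iff del: plus_fun_apply)
    also have "\<dots> = (tuple_prod k (t(i := a)) \<oplus> tuple_prod k (t(i := b))) \<oplus> (tuple_prod k (t(i := a)) \<oplus> tuple_prod k (t(i := b)))"
      using c by (simp add: a_assoc)
    also have "\<dots> = \<zero>"
      using c by (intro char2) simp
    finally show "x \<in> {u \<in> carrier F. mu u = \<zero>}"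
      using x multilinear_relations_subset by blast
  qed
  ultimately have "I \<subseteq> {u \<in> carrier F. mu u = \<zero>}"
    by (rule F.genideal_minimal)
  then show "u \<in> I \<Longrightarrow> mu u = \<zero>"
    by blast
qed

lemma I_subset: "I \<subseteq> carrier F"
  by (rule additive_subgroup.a_subset [OF ideal.axioms(1) [OF ideal_I]])

text \<open>Invariance under \<open>I\<close> makes the image of a coset a singleton; both
  \<open>mu\<close> and the functionals \<open>lam f\<close> pass to the quotient in this
  way.\<close>

lemma the_elem_image_cls:
  assumes "\<And>x. x \<in> I \<Longrightarrow> h (x + u) = h u"
  shows "the_elem (h ` cls u) = h u"
proof -
  have "u \<in> cls u"
    unfolding mem_cls using additive_subgroup.zero_closed [OF ideal.axioms(1) [OF ideal_I]]
    by (intro bexI [of _ 0]) (simp_all only: F_simps add_0)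
  moreover have "h v = h u" if "v \<in> cls u" for v
    using that assms unfolding mem_cls by auto
  ultimately have "h ` cls u = {h u}"
    by blast
  then show ?thesis
    by simp
qed

lemma iterated_mult_cls:
  assumes "u \<in> carrier F"
  shows "iterated_mult k R (cls u) = mu u"
  unfolding iterated_mult_def
proof (rule the_elem_image_cls)
  fix x assume "x \<in> I"
  then show "mu (x + u) = mu u"
    using mu_add [of x u] mu_I [of x] mu_closed [OF assms] assms I_subset by auto
qed

end

context tensor_power_ring
begin

subsection \<open>Products of zero divisors\<close>

text \<open>Slots are numbered from 0, so \<open>q\<close> is at once the last slot and the number
  of the others.\<close>

definition q :: nat where "q = k - 1"

definition gen :: "nat \<Rightarrow> ((nat \<Rightarrow> 'a) \<Rightarrow> bit) set" where
  "gen l = iota l X \<oplus>\<^bsub>T\<^esub> iota q X"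

primrec gen_prod :: "(nat \<Rightarrow> nat) \<Rightarrow> nat \<Rightarrow> ((nat \<Rightarrow> 'a) \<Rightarrow> bit) set" where
  "gen_prod a 0 = \<one>\<^bsub>T\<^esub>"
| "gen_prod a (Suc m) = gen_prod a m \<otimes>\<^bsub>T\<^esub> gen m [^]\<^bsub>T\<^esub> a m"

text \<open>Additive generators of the \<open>m\<close>-th power of the ideal generated by the
  \<open>gen l\<close> with \<open>l < q\<close>; the total degree \<open>m\<close> will count the
  factors of a product of zero divisors.\<close>

definition gens :: "nat \<Rightarrow> ((nat \<Rightarrow> 'a) \<Rightarrow> bit) set set" where
  "gens m = {t \<otimes>\<^bsub>T\<^esub> gen_prod a q | t a. t \<in> carrier T \<and> (\<Sum>l<q. a l) = m}"

lemma q_less [simp]: "q < k"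
  using k_pos by (simp add: q_def)

lemma q_le [simp]: "q \<le> k"
  using q_less by (rule less_imp_le)

lemma less_q [simp]: "l < q \<Longrightarrow> l < k"
  by (rule less_trans [OF _ q_less])

lemma less_k_cases: "l < k \<Longrightarrow> l = q \<or> l < q"
  by (auto simp: q_def)

lemma gen_closed [simp]: "l < k \<Longrightarrow> gen l \<in> carrier T"
  by (simp add: gen_def)

lemma gen_prod_closed [simp]: "m \<le> k \<Longrightarrow> gen_prod a m \<in> carrier T"
  by (induction m) simp_all

lemma gens_subset: "gens m \<subseteq> carrier T"
  by (auto simp: gens_def)

lemma gens_mult_carrier:
  assumes "x \<in> addspan T (gens m)" "t \<in> carrier T"
  shows "t \<otimes>\<^bsub>T\<^esub> x \<in> addspan T (gens m)"
proof (rule T.addspan_mult [OF addspan.generator [of t "{t}"] assms(1) _ gens_subset])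
  fix g h assume "g \<in> {t}" "h \<in> gens m"
  then obtain s a where "g = t" "h = s \<otimes>\<^bsub>T\<^esub> gen_prod a q" "s \<in> carrier T" "(\<Sum>l<q. a l) = m"
    by (auto simp: gens_def)
  moreover from this have "g \<otimes>\<^bsub>T\<^esub> h = (t \<otimes>\<^bsub>T\<^esub> s) \<otimes>\<^bsub>T\<^esub> gen_prod a q"
    using assms(2) by (simp add: T.m_assoc)
  ultimately show "g \<otimes>\<^bsub>T\<^esub> h \<in> addspan T (gens m)"
    unfolding gens_def using assms(2) by (intro addspan.generator) blast
qed (use assms(2) in auto)

lemma gen_prod_mult:
  "m \<le> k \<Longrightarrow> gen_prod a m \<otimes>\<^bsub>T\<^esub> gen_prod b m = gen_prod (\<lambda>l. a l + b l) m"
proof (induction m)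
  case (Suc m)
  have "gen_prod a (Suc m) \<otimes>\<^bsub>T\<^esub> gen_prod b (Suc m) =
      (gen_prod a m \<otimes>\<^bsub>T\<^esub> gen_prod b m) \<otimes>\<^bsub>T\<^esub> (gen m [^]\<^bsub>T\<^esub> a m \<otimes>\<^bsub>T\<^esub> gen m [^]\<^bsub>T\<^esub> b m)"
    using Suc.prems by (simp add: T.m_ac)
  also have "\<dots> = gen_prod (\<lambda>l. a l + b l) (Suc m)"
    using Suc by (simp add: T.nat_pow_mult)
  finally show ?case .
qed simp

lemma gens_mult:
  assumes "x \<in> addspan T (gens m)" "y \<in> addspan T (gens m')"
  shows "x \<otimes>\<^bsub>T\<^esub> y \<in> addspan T (gens (m + m'))"
proof (rule T.addspan_mult [OF assms gens_subset gens_subset])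
  fix g h assume "g \<in> gens m" "h \<in> gens m'"
  then obtain s a t b where g: "g = s \<otimes>\<^bsub>T\<^esub> gen_prod a q" "s \<in> carrier T" "(\<Sum>l<q. a l) = m"
    and h: "h = t \<otimes>\<^bsub>T\<^esub> gen_prod b q" "t \<in> carrier T" "(\<Sum>l<q. b l) = m'"
    by (auto simp: gens_def)
  have "g \<otimes>\<^bsub>T\<^esub> h = (s \<otimes>\<^bsub>T\<^esub> t) \<otimes>\<^bsub>T\<^esub> (gen_prod a q \<otimes>\<^bsub>T\<^esub> gen_prod b q)"
    using g(2) h(2) by (simp add: g(1) h(1) T.m_ac)
  then have "g \<otimes>\<^bsub>T\<^esub> h = (s \<otimes>\<^bsub>T\<^esub> t) \<otimes>\<^bsub>T\<^esub> gen_prod (\<lambda>l. a l + b l) q"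
    by (simp add: gen_prod_mult)
  moreover have "(\<Sum>l<q. a l + b l) = m + m'"
    by (simp add: sum.distrib g h)
  ultimately have "g \<otimes>\<^bsub>T\<^esub> h \<in> gens (m + m')"
    unfolding gens_def using g(2) h(2) by blast
  then show "g \<otimes>\<^bsub>T\<^esub> h \<in> addspan T (gens (m + m'))"
    by (rule addspan.generator)
qed

lemma gen_in_gens:
  assumes "l < q"
  shows "gen l \<in> addspan T (gens 1)"
proof -
  have gp: "gen_prod (\<lambda>j. if j = l then 1 else 0) m = (if l < m then gen l else \<one>\<^bsub>T\<^esub>)" if "m \<le> k" for m
    using that by (induction m) (auto simp: less_Suc_eq)
  have "gen l = \<one>\<^bsub>T\<^esub> \<otimes>\<^bsub>T\<^esub> gen_prod (\<lambda>j. if j = l then 1 else 0) q"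
    using assms gp [of q] by simp
  moreover have "(\<Sum>j<q. if j = l then 1 else 0 :: nat) = 1"
    using assms by simp
  ultimately have "gen l \<in> gens 1"
    unfolding gens_def using T.one_closed by blast
  then show ?thesis
    by (rule addspan.generator)
qed

lemma gens_0: "\<one>\<^bsub>T\<^esub> \<in> addspan T (gens 0)"
proof -
  have gp: "gen_prod (\<lambda>j. 0) m = \<one>\<^bsub>T\<^esub>" for m
    by (induction m) simp_all
  have "\<one>\<^bsub>T\<^esub> = \<one>\<^bsub>T\<^esub> \<otimes>\<^bsub>T\<^esub> gen_prod (\<lambda>j. 0) q" "(\<Sum>j<q. 0 :: nat) = 0"
    by (simp_all add: gp)
  then have "\<one>\<^bsub>T\<^esub> \<in> gens 0"
    unfolding gens_def using T.one_closed by blast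
  then show ?thesis
    by (rule addspan.generator)
qed

text \<open>The product of \<open>x\<close> and \<open>w\<close> is added twice. So a product
  changes by multiples of the changes of its factors; applied slot by slot, this moves a whole
  tensor into the last slot.\<close>

lemma telescope:
  assumes "x \<in> carrier T" "y \<in> carrier T" "z \<in> carrier T" "w \<in> carrier T"
  shows "(x \<otimes>\<^bsub>T\<^esub> z) \<oplus>\<^bsub>T\<^esub> (y \<otimes>\<^bsub>T\<^esub> w) = x \<otimes>\<^bsub>T\<^esub> (z \<oplus>\<^bsub>T\<^esub> w) \<oplus>\<^bsub>T\<^esub> w \<otimes>\<^bsub>T\<^esub> (x \<oplus>\<^bsub>T\<^esub> y)"
proof -
  have "x \<otimes>\<^bsub>T\<^esub> (z \<oplus>\<^bsub>T\<^esub> w) \<oplus>\<^bsub>T\<^esub> w \<otimes>\<^bsub>T\<^esub> (x \<oplus>\<^bsub>T\<^esub> y)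
      = (x \<otimes>\<^bsub>T\<^esub> z \<oplus>\<^bsub>T\<^esub> y \<otimes>\<^bsub>T\<^esub> w) \<oplus>\<^bsub>T\<^esub> (x \<otimes>\<^bsub>T\<^esub> w \<oplus>\<^bsub>T\<^esub> x \<otimes>\<^bsub>T\<^esub> w)"
    using assms by (simp add: T.r_distr T.a_ac T.m_comm del: T_char2)
  then show ?thesis
    using assms by simp
qed

lemma telescope_span:
  assumes "x \<in> carrier T" "y \<in> carrier T" "z \<in> carrier T" "w \<in> carrier T"
    and "x \<oplus>\<^bsub>T\<^esub> y \<in> addspan T (gens m)" "z \<oplus>\<^bsub>T\<^esub> w \<in> addspan T (gens m)"
  shows "(x \<otimes>\<^bsub>T\<^esub> z) \<oplus>\<^bsub>T\<^esub> (y \<otimes>\<^bsub>T\<^esub> w) \<in> addspan T (gens m)"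
  unfolding telescope [OF assms(1-4)]
  by (rule addspan.add [OF gens_mult_carrier [OF assms(6,1)] gens_mult_carrier [OF assms(5,4)]])

lemma iota_difference:
  assumes "l < k" "r \<in> carrier R"
  shows "iota l r \<oplus>\<^bsub>T\<^esub> iota q r \<in> addspan T (gens 1)"
proof (cases "l = q")
  case True
  then show ?thesis
    using assms by (simp add: addspan.zero)
next
  case False
  then have l: "l < q"
    using less_k_cases [OF assms(1)] by simp
  show ?thesis
    using assms(2)
  proof (rule powers_induct)
    show "iota l \<zero> \<oplus>\<^bsub>T\<^esub> iota q \<zero> \<in> addspan T (gens 1)"
      using assms(1) by (simp add: iota_zero addspan.zero)
  next
    fix i :: nat
    show "iota l (X [^] i) \<oplus>\<^bsub>T\<^esub> iota q (X [^] i) \<in> addspan T (gens 1)"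
    proof (induction i)
      case 0
      show ?case
        using assms(1) by (simp add: iota_one addspan.zero)
    next
      case (Suc i)
      have "iota l X \<oplus>\<^bsub>T\<^esub> iota q X \<in> addspan T (gens 1)"
        using gen_in_gens [OF l] by (simp add: gen_def)
      then show ?case
        using assms(1) Suc.IH by (simp add: iota_mult telescope_span)
    qed
  next
    fix r s assume rs: "r \<in> carrier R" "s \<in> carrier R"
      and IH: "iota l r \<oplus>\<^bsub>T\<^esub> iota q r \<in> addspan T (gens 1)" "iota l s \<oplus>\<^bsub>T\<^esub> iota q s \<in> addspan T (gens 1)"
    have "(iota l r \<oplus>\<^bsub>T\<^esub> iota q r) \<oplus>\<^bsub>T\<^esub> (iota l s \<oplus>\<^bsub>T\<^esub> iota q s) \<in> addspan T (gens 1)"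
      by (rule addspan.add [OF IH])
    then show "iota l (r \<oplus> s) \<oplus>\<^bsub>T\<^esub> iota q (r \<oplus> s) \<in> addspan T (gens 1)"
      using rs assms(1) by (simp add: iota_add T.a_ac)
  qed
qed

text \<open>Modulo the ideal of the \<open>gen l\<close>, every factor of a tensor may be moved to
  the last slot, where the factors multiply to \<open>mu u\<close>. An element of the kernel
  therefore lies in that ideal.\<close>

lemma difference_in_gens:
  assumes "u \<in> carrier F"
  shows "cls u \<oplus>\<^bsub>T\<^esub> iota q (mu u) \<in> addspan T (gens 1)"
  using assms
proof (induction rule: F_induct)
  case zero
  show ?case
    unfolding cls_0 mu_0 by (simp add: iota_zero addspan.zero)
next
  case (pure t)
  then have tc: "t i \<in> carrier R" if "i < k" for i
    using that by (auto simp: tuples_def)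
  have "cls (pure (initial_segment t m)) \<oplus>\<^bsub>T\<^esub> iota q (tuple_prod m t) \<in> addspan T (gens 1)" if "m \<le> k" for m
    using that
  proof (induction m)
    case 0
    show ?case
      by (simp add: cls_initial_segment_0 tuple_prod_0 iota_one addspan.zero)
  next
    case (Suc m)
    have "tuple_prod m t \<in> carrier R" "cls (pure (initial_segment t m)) \<in> carrier T"
      using Suc.prems pure tc by (auto intro!: tuple_prod_closed cls_closed pure_carrier initial_segment_tuples)
    moreover have "t m \<in> carrier R" "m < k"
      using Suc.prems tc by auto
    ultimately have "(cls (pure (initial_segment t m)) \<otimes>\<^bsub>T\<^esub> iota m (t m)) \<oplus>\<^bsub>T\<^esub>
        (iota q (tuple_prod m t) \<otimes>\<^bsub>T\<^esub> iota q (t m)) \<in> addspan T (gens 1)"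
      using Suc by (intro telescope_span iota_difference) simp_all
    then show ?case
      using Suc.prems tc pure \<open>tuple_prod m t \<in> carrier R\<close>
      by (simp add: cls_initial_segment_Suc tuple_prod_Suc iota_mult)
  qed
  from this [OF order_refl] show ?case
    using pure by (simp add: initial_segment_full mu_pure)
next
  case (add u v)
  have "(cls u \<oplus>\<^bsub>T\<^esub> iota q (mu u)) \<oplus>\<^bsub>T\<^esub> (cls v \<oplus>\<^bsub>T\<^esub> iota q (mu v)) \<in> addspan T (gens 1)"
    by (rule addspan.add [OF add.IH])
  moreover have "(cls u \<oplus>\<^bsub>T\<^esub> iota q (mu u)) \<oplus>\<^bsub>T\<^esub> (cls v \<oplus>\<^bsub>T\<^esub> iota q (mu v))
      = cls (u + v) \<oplus>\<^bsub>T\<^esub> iota q (mu (u + v))"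
    using add.hyps by (simp add: cls_add mu_add mu_closed iota_add T.a_ac)
  ultimately show ?case
    by (simp only:)
qed

abbreviation kernel_T :: "((nat \<Rightarrow> 'a) \<Rightarrow> bit) set set" where
  "kernel_T \<equiv> a_kernel T R (iterated_mult k R)"

lemma kernel_T_subset: "kernel_T \<subseteq> addspan T (gens 1)"
proof
  fix w assume "w \<in> kernel_T"
  then have w: "w \<in> carrier T" "iterated_mult k R w = \<zero>"
    by (auto simp: a_kernel_def' )
  then obtain u where u: "u \<in> carrier F" "w = cls u"
    unfolding carrier_T by blast
  have "mu u = \<zero>"
    using w(2) iterated_mult_cls [OF u(1)] by (simp add: u(2))
  then show "w \<in> addspan T (gens 1)"
    using difference_in_gens [OF u(1)] w(1) by (simp add: u(2) iota_zero)
qed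

lemma mu_iota: "i < k \<Longrightarrow> r \<in> carrier R \<Longrightarrow> iterated_mult k R (iota i r) = r"
proof -
  assume i: "i < k" and r: "r \<in> carrier R"
  define t where "t = (\<lambda>j\<in>{..<k}. \<one>)(i := r)"
  have t: "t \<in> tuples k R"
    unfolding t_def using i r by (intro update_tuples one_tuple)
  have tj: "t j = (if j = i then r else \<one>)" if "j < k" for j
    using that by (simp add: t_def)
  have "tuple_prod m t = (if i < m then r else \<one>)" if "m \<le> k" for m
    using that
  proof (induction m)
    case (Suc m)
    have "tuple_prod (Suc m) t = tuple_prod m t \<otimes> t m"
      using Suc.prems r by (intro tuple_prod_Suc) (simp add: tj)
    then show ?case
      using Suc r by (simp add: tj)
  qed (simp add: tuple_prod_0)
  then show ?thesis
    using i t by (simp only: iota_def t_def [symmetric] iterated_mult_cls pure_carrier mu_pure order_refl if_True)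
qed

lemma gen_kernel_T: "l < k \<Longrightarrow> gen l \<in> kernel_T"
proof -
  assume l: "l < k"
  obtain u v where u: "u \<in> carrier F" "iota l X = cls u" and v: "v \<in> carrier F" "iota q X = cls v"
    using iota_closed [OF l X_carrier] iota_closed [OF q_less X_carrier] unfolding carrier_T by blast
  have "iterated_mult k R (gen l) = mu u \<oplus> mu v"
    using u v by (simp only: gen_def cls_add [symmetric] iterated_mult_cls F_add_closed mu_add)
  moreover have "mu u = X" "mu v = X"
    using mu_iota [OF l X_carrier] mu_iota [OF q_less X_carrier] u v by (simp_all add: iterated_mult_cls)
  ultimately have "iterated_mult k R (gen l) = \<zero>"
    by (simp add: char2)
  then show ?thesis
    using l by (simp add: a_kernel_def')
qed

text \<open>Expanding each factor in the generators writes the product as a sum of multiples of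
  elements \<open>gen_prod a q\<close> whose total degree is the number of factors; if the sum is
  nonzero, so is one of them.\<close>

lemma zero_divisor_product:
  assumes "set zs \<subseteq> kernel_T" and nz: "foldr (mult T) zs \<one>\<^bsub>T\<^esub> \<noteq> \<zero>\<^bsub>T\<^esub>"
  obtains a where "(\<Sum>l<q. a l) = length zs" "gen_prod a q \<noteq> \<zero>\<^bsub>T\<^esub>"
proof -
  have "foldr (mult T) zs \<one>\<^bsub>T\<^esub> \<in> addspan T (gens (length zs))"
    using assms(1)
  proof (induction zs)
    case Nil
    show ?case
      by (simp add: gens_0)
  next
    case (Cons z zs)
    then have "z \<in> addspan T (gens 1)"
      using kernel_T_subset by auto
    then show ?case
      using gens_mult [of z 1 "foldr (mult T) zs \<one>\<^bsub>T\<^esub>" "length zs"] Cons by simp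
  qed
  then obtain g where "g \<in> gens (length zs)" and g0: "g \<noteq> \<zero>\<^bsub>T\<^esub>"
    using T.addspan_trivial nz by blast
  then obtain t a where g: "g = t \<otimes>\<^bsub>T\<^esub> gen_prod a q" "t \<in> carrier T" "(\<Sum>l<q. a l) = length zs"
    unfolding gens_def by blast
  have "gen_prod a q \<noteq> \<zero>\<^bsub>T\<^esub>"
  proof
    assume "gen_prod a q = \<zero>\<^bsub>T\<^esub>"
    then show False
      using g0 g(2) by (simp only: g(1) T.r_null)
  qed
  with g(3) show thesis
    by (rule that)
qed

lemma gen_prod_list:
  "m \<le> k \<Longrightarrow> \<exists>zs. set zs \<subseteq> kernel_T \<and> length zs = (\<Sum>l<m. a l) \<and> foldr (mult T) zs \<one>\<^bsub>T\<^esub> = gen_prod a m"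
proof (induction m)
  case 0
  show ?case
    by (intro exI [of _ "[]"]) simp
next
  case (Suc m)
  then obtain zs where zs: "set zs \<subseteq> kernel_T" "length zs = (\<Sum>l<m. a l)"
    "foldr (mult T) zs \<one>\<^bsub>T\<^esub> = gen_prod a m"
    by auto
  have "foldr (mult T) (replicate j (gen m)) w = gen m [^]\<^bsub>T\<^esub> j \<otimes>\<^bsub>T\<^esub> w" if "w \<in> carrier T" for j w
    using Suc.prems that by (induction j) (simp_all add: T.m_ac)
  then have "foldr (mult T) (replicate (a m) (gen m) @ zs) \<one>\<^bsub>T\<^esub> = gen_prod a (Suc m)"
    using Suc.prems zs by (simp add: T.m_comm)
  then show ?case
    using zs gen_kernel_T [of m] Suc.prems by (intro exI [of _ "replicate (a m) (gen m) @ zs"]) auto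
qed

subsection \<open>Vanishing products\<close>

text \<open>The monomials that may occur in \<open>gen_prod a m\<close>. For \<open>M\<close> a
  power of two, the condition on remainders says that adding \<open>j l\<close> and
  \<open>a l - j l\<close> produces no carry into the place of \<open>M\<close>, as is the case
  whenever the binomial coefficient is odd.\<close>

definition monomials :: "nat \<Rightarrow> (nat \<Rightarrow> nat) \<Rightarrow> nat \<Rightarrow> ((nat \<Rightarrow> 'a) \<Rightarrow> bit) set set" where
  "monomials M a m = {(\<Otimes>\<^bsub>T\<^esub>l\<in>{..<m}. iota l X [^]\<^bsub>T\<^esub> j l) \<otimes>\<^bsub>T\<^esub> iota q X [^]\<^bsub>T\<^esub> (\<Sum>l<m. a l - j l) | j.
     \<forall>l<m. j l \<le> a l \<and> j l mod M + (a l - j l) mod M < M}"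

lemma iota_power_eq_0:
  assumes "i < k" "n < j"
  shows "iota i X [^]\<^bsub>T\<^esub> j = \<zero>\<^bsub>T\<^esub>"
proof -
  have "X [^] j = X [^] Suc n \<otimes> X [^] (j - Suc n)"
    using assms(2) by (simp only: nat_pow_mult [OF X_carrier] le_add_diff_inverse Suc_leI)
  then have "X [^] j = \<zero>"
    unfolding X_nilpotent by simp
  then show ?thesis
    using iota_power [OF assms(1) X_carrier, of j] iota_zero [OF assms(1)] by simp
qed

text \<open>Writing the exponent as \<open>A * 2 ^ e + c\<close> and using that squaring is additive, no binomial
  coefficient needs to be evaluated.\<close>

lemma gen_power_addspan:
  assumes "l < k"
  shows "gen l [^]\<^bsub>T\<^esub> (a::nat) \<in> addspan T {iota l X [^]\<^bsub>T\<^esub> j \<otimes>\<^bsub>T\<^esub> iota q X [^]\<^bsub>T\<^esub> (a - j) | j.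
     j \<le> a \<and> j mod 2 ^ e + (a - j) mod 2 ^ e < 2 ^ e}" (is "_ \<in> addspan T ?K")
proof -
  let ?x = "iota l X" and ?y = "iota q X" and ?M = "2 ^ e :: nat"
  define A c where "A = a div ?M" and "c = a mod ?M"
  have c: "c < ?M" and a: "a = A * ?M + c"
    unfolding A_def c_def by (simp, rule div_mult_mod_eq [symmetric])
  have xy: "?x \<in> carrier T" "?y \<in> carrier T"
    using assms by simp_all
  have "gen l [^]\<^bsub>T\<^esub> a = (?x [^]\<^bsub>T\<^esub> ?M \<oplus>\<^bsub>T\<^esub> ?y [^]\<^bsub>T\<^esub> ?M) [^]\<^bsub>T\<^esub> A \<otimes>\<^bsub>T\<^esub> (?x \<oplus>\<^bsub>T\<^esub> ?y) [^]\<^bsub>T\<^esub> c"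
    unfolding gen_def using xy
    by (simp add: T.frobenius_char2 [symmetric] T.nat_pow_pow T.nat_pow_mult mult.commute flip: a)
  moreover have "\<dots> \<in> addspan T ?K"
  proof (rule T.addspan_mult [OF T.power_add_addspan T.power_add_addspan])
    fix g h
    assume "g \<in> {(?x [^]\<^bsub>T\<^esub> ?M) [^]\<^bsub>T\<^esub> i \<otimes>\<^bsub>T\<^esub> (?y [^]\<^bsub>T\<^esub> ?M) [^]\<^bsub>T\<^esub> (A - i) | i. i \<le> A}"
      and "h \<in> {?x [^]\<^bsub>T\<^esub> i \<otimes>\<^bsub>T\<^esub> ?y [^]\<^bsub>T\<^esub> (c - i) | i. i \<le> c}"
    then obtain i i' where g: "g = (?x [^]\<^bsub>T\<^esub> ?M) [^]\<^bsub>T\<^esub> i \<otimes>\<^bsub>T\<^esub> (?y [^]\<^bsub>T\<^esub> ?M) [^]\<^bsub>T\<^esub> (A - i)" "i \<le> A"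
      and h: "h = ?x [^]\<^bsub>T\<^esub> i' \<otimes>\<^bsub>T\<^esub> ?y [^]\<^bsub>T\<^esub> (c - i')" "i' \<le> c"
      by auto
    let ?j = "?M * i + i'"
    have "?M * i \<le> ?M * A"
      using g(2) by simp
    then have j: "?j \<le> a" "a - ?j = ?M * (A - i) + (c - i')"
      using add_mono [OF \<open>?M * i \<le> ?M * A\<close> h(2)] h(2)
      by (simp_all add: a algebra_simps diff_mult_distrib2)
    have "g \<otimes>\<^bsub>T\<^esub> h = (?x [^]\<^bsub>T\<^esub> (?M * i) \<otimes>\<^bsub>T\<^esub> ?x [^]\<^bsub>T\<^esub> i') \<otimes>\<^bsub>T\<^esub>
        (?y [^]\<^bsub>T\<^esub> (?M * (A - i)) \<otimes>\<^bsub>T\<^esub> ?y [^]\<^bsub>T\<^esub> (c - i'))"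
      using xy by (simp add: g(1) h(1) T.nat_pow_pow T.m_ac)
    then have "g \<otimes>\<^bsub>T\<^esub> h = ?x [^]\<^bsub>T\<^esub> ?j \<otimes>\<^bsub>T\<^esub> ?y [^]\<^bsub>T\<^esub> (a - ?j)"
      using xy by (simp only: T.nat_pow_mult j(2))
    \<comment> \<open>The remainders of the two exponents are \<open>i'\<close> and
      \<open>c - i'\<close>, and their sum \<open>c\<close> is itself a remainder modulo
      \<open>?M\<close>.\<close>
    moreover have "?j mod ?M + (a - ?j) mod ?M < ?M"
    proof -
      have "(?M * x + d) mod ?M = d" if "d < ?M" for x d
        using that by simp
      from this [of i' i] this [of "c - i'" "A - i"] have "?j mod ?M = i'" "(a - ?j) mod ?M = c - i'"
        unfolding j(2) using c h(2) by simp_all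
      then show ?thesis
        using c h(2) by (simp only: le_add_diff_inverse)
    qed
    ultimately have "g \<otimes>\<^bsub>T\<^esub> h \<in> ?K"
      using j(1) by blast
    then show "g \<otimes>\<^bsub>T\<^esub> h \<in> addspan T ?K"
      by (rule addspan.generator)
  qed (use xy in auto)
  ultimately show ?thesis
    by (simp only:)
qed

lemma gen_prod_addspan: "m \<le> q \<Longrightarrow> gen_prod a m \<in> addspan T (monomials (2 ^ e) a m)"
proof (induction m)
  case 0
  show ?case
    by (rule addspan.generator) (simp add: monomials_def)
next
  case (Suc m)
  let ?M = "2 ^ e :: nat"
  have mk: "m < k"
    using Suc.prems by simp
  have sub: "monomials ?M a m \<subseteq> carrier T"
    using Suc.prems by (auto simp: monomials_def intro!: T.m_closed T.finprod_closed T.nat_pow_closed iota_closed)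
  have "gen_prod a m \<otimes>\<^bsub>T\<^esub> gen m [^]\<^bsub>T\<^esub> a m \<in> addspan T (monomials ?M a (Suc m))"
  proof (rule T.addspan_mult [OF Suc.IH gen_power_addspan [OF mk, of "a m" e] sub])
    fix g h assume "g \<in> monomials ?M a m" and "h \<in> {iota m X [^]\<^bsub>T\<^esub> j \<otimes>\<^bsub>T\<^esub> iota q X [^]\<^bsub>T\<^esub> (a m - j) | j.
       j \<le> a m \<and> j mod 2 ^ e + (a m - j) mod 2 ^ e < 2 ^ e}"
    then obtain j i where g: "g = (\<Otimes>\<^bsub>T\<^esub>l\<in>{..<m}. iota l X [^]\<^bsub>T\<^esub> j l) \<otimes>\<^bsub>T\<^esub> iota q X [^]\<^bsub>T\<^esub> (\<Sum>l<m. a l - j l)"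
       "\<forall>l<m. j l \<le> a l \<and> j l mod ?M + (a l - j l) mod ?M < ?M"
      and h: "h = iota m X [^]\<^bsub>T\<^esub> i \<otimes>\<^bsub>T\<^esub> iota q X [^]\<^bsub>T\<^esub> (a m - i)" "i \<le> a m" "i mod ?M + (a m - i) mod ?M < ?M"
      by (auto simp: monomials_def)
    let ?j = "j(m := i)"
    have P: "(\<Otimes>\<^bsub>T\<^esub>l\<in>{..<m}. iota l X [^]\<^bsub>T\<^esub> j l) \<in> carrier T"
      using Suc.prems by (intro T.finprod_closed) auto
    have "(\<Otimes>\<^bsub>T\<^esub>l\<in>{..<m}. iota l X [^]\<^bsub>T\<^esub> ?j l) = (\<Otimes>\<^bsub>T\<^esub>l\<in>{..<m}. iota l X [^]\<^bsub>T\<^esub> j l)"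
      using Suc.prems by (intro T.finprod_cong') auto
    then have "(\<Otimes>\<^bsub>T\<^esub>l\<in>{..<Suc m}. iota l X [^]\<^bsub>T\<^esub> ?j l) = iota m X [^]\<^bsub>T\<^esub> i \<otimes>\<^bsub>T\<^esub> (\<Otimes>\<^bsub>T\<^esub>l\<in>{..<m}. iota l X [^]\<^bsub>T\<^esub> j l)"
      using Suc.prems unfolding lessThan_Suc by (subst T.finprod_insert) auto
    moreover have "(\<Sum>l<Suc m. a l - ?j l) = (\<Sum>l<m. a l - j l) + (a m - i)"
      by simp
    ultimately have "g \<otimes>\<^bsub>T\<^esub> h = (\<Otimes>\<^bsub>T\<^esub>l\<in>{..<Suc m}. iota l X [^]\<^bsub>T\<^esub> ?j l) \<otimes>\<^bsub>T\<^esub> iota q X [^]\<^bsub>T\<^esub> (\<Sum>l<Suc m. a l - ?j l)"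
      using P mk by (simp add: g(1) h(1) T.m_ac flip: T.nat_pow_mult)
    moreover have "\<forall>l<Suc m. ?j l \<le> a l \<and> ?j l mod ?M + (a l - ?j l) mod ?M < ?M"
      using g(2) h(2,3) by (simp add: less_Suc_eq)
    ultimately have "g \<otimes>\<^bsub>T\<^esub> h \<in> monomials ?M a (Suc m)"
      unfolding monomials_def by blast
    then show "g \<otimes>\<^bsub>T\<^esub> h \<in> addspan T (monomials ?M a (Suc m))"
      by (rule addspan.generator)
  qed (use Suc.prems mk in auto)
  then show ?case
    by simp
qed

text \<open>Some monomial of the expansion is nonzero, so none of its exponents exceeds
  \<open>n\<close>; the last variable occurs in every factor, and its exponent is the sum of all
  \<open>a l - j l\<close>.\<close>

lemma gen_prod_nonzero:
  assumes "gen_prod a q \<noteq> \<zero>\<^bsub>T\<^esub>"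
  obtains j where "\<forall>l<q. j l \<le> a l \<and> j l \<le> n \<and> j l mod 2 ^ e + (a l - j l) mod 2 ^ e < 2 ^ e"
    "(\<Sum>l<q. a l - j l) \<le> n"
proof -
  obtain g where "g \<in> monomials (2 ^ e) a q" "g \<noteq> \<zero>\<^bsub>T\<^esub>"
    using T.addspan_trivial [OF gen_prod_addspan [OF order_refl, of a e]] assms by blast
  then obtain j where g: "(\<Otimes>\<^bsub>T\<^esub>l\<in>{..<q}. iota l X [^]\<^bsub>T\<^esub> j l) \<otimes>\<^bsub>T\<^esub> iota q X [^]\<^bsub>T\<^esub> (\<Sum>l<q. a l - j l) \<noteq> \<zero>\<^bsub>T\<^esub>"
    and j: "\<forall>l<q. j l \<le> a l \<and> j l mod 2 ^ e + (a l - j l) mod 2 ^ e < 2 ^ e"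
    by (auto simp: monomials_def)
  have P: "(\<Otimes>\<^bsub>T\<^esub>l\<in>A. iota l X [^]\<^bsub>T\<^esub> j l) \<in> carrier T" if "A \<subseteq> {..<q}" for A
    using that by (intro T.finprod_closed)  auto
  have "j l \<le> n" if l: "l < q" for l
  proof (rule ccontr)
    assume "\<not> j l \<le> n"
    then have z: "iota l X [^]\<^bsub>T\<^esub> j l = \<zero>\<^bsub>T\<^esub>"
      using l by (intro iota_power_eq_0) auto
    have "(\<Otimes>\<^bsub>T\<^esub>i\<in>insert l ({..<q} - {l}). iota i X [^]\<^bsub>T\<^esub> j i)
        = iota l X [^]\<^bsub>T\<^esub> j l \<otimes>\<^bsub>T\<^esub> (\<Otimes>\<^bsub>T\<^esub>i\<in>{..<q} - {l}. iota i X [^]\<^bsub>T\<^esub> j i)"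
      using l by (intro T.finprod_insert) auto
    moreover have "insert l ({..<q} - {l}) = {..<q}"
      using l by auto
    ultimately have "(\<Otimes>\<^bsub>T\<^esub>i\<in>{..<q}. iota i X [^]\<^bsub>T\<^esub> j i) = \<zero>\<^bsub>T\<^esub>"
      using P [of "{..<q} - {l}"] by (simp only: z T.l_null Diff_subset)
    then show False
      using g by simp
  qed
  moreover have "(\<Sum>l<q. a l - j l) \<le> n"
  proof (rule ccontr)
    assume "\<not> (\<Sum>l<q. a l - j l) \<le> n"
    then show False
      using g iota_power_eq_0 [OF q_less, of "\<Sum>l<q. a l - j l"] P [of "{..<q}"] by simp
  qed
  ultimately show thesis
    using that j by blast
qed

subsection \<open>Nonvanishing products\<close>

definition additive_family :: "(nat \<Rightarrow> 'a \<Rightarrow> bit) \<Rightarrow> bool" where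
  "additive_family f \<longleftrightarrow> (\<forall>i<k. \<forall>r\<in>carrier R. \<forall>s\<in>carrier R. f i (r \<oplus> s) = f i r + f i s)"

text \<open>The functional that sends a tensor \<open>t\<close> to the product of the
  \<open>f i (t i)\<close>. Additivity of each \<open>f i\<close> makes it pass to the tensor power,
  where it certifies that an element is nonzero.\<close>

definition lam :: "(nat \<Rightarrow> 'a \<Rightarrow> bit) \<Rightarrow> ((nat \<Rightarrow> 'a) \<Rightarrow> bit) \<Rightarrow> bit" where
  "lam f u = (\<Sum>t\<in>{t. u t \<noteq> 0}. \<Prod>i<k. f i (t i))"

lemma lam_superset:
  assumes "finite A" "{t. u t \<noteq> 0} \<subseteq> A"
  shows "lam f u = (\<Sum>t\<in>A. u t * (\<Prod>i<k. f i (t i)))"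
  unfolding lam_def by (rule sum.mono_neutral_cong_left) (use assms in auto)

lemma lam_add:
  assumes "u \<in> carrier F" "v \<in> carrier F"
  shows "lam f (u + v) = lam f u + lam f v"
proof -
  let ?A = "{t. u t \<noteq> 0} \<union> {t. v t \<noteq> 0}"
  have A: "finite ?A"
    using assms by (simp add: F_simps)
  have "lam f (u + v) = (\<Sum>t\<in>?A. (u + v) t * (\<Prod>i<k. f i (t i)))"
    by (rule lam_superset [OF A]) auto
  moreover have "lam f u = (\<Sum>t\<in>?A. u t * (\<Prod>i<k. f i (t i)))" "lam f v = (\<Sum>t\<in>?A. v t * (\<Prod>i<k. f i (t i)))"
    by (rule lam_superset [OF A]; blast)+
  ultimately show ?thesis
    by (simp only: plus_fun_apply distrib_right sum.distrib)
qed

lemma lam_pure: "lam f (pure t) = (\<Prod>i<k. f i (t i))"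
  by (simp add: lam_def)

lemma lam_0: "lam f 0 = 0"
  by (simp add: lam_def)

lemma lam_cong:
  assumes "u \<in> carrier F" "\<And>i r. i < k \<Longrightarrow> r \<in> carrier R \<Longrightarrow> f i r = g i r"
  shows "lam f u = lam g u"
  unfolding lam_def using assms by (intro sum.cong prod.cong) (auto simp: F_simps tuples_def PiE_iff subset_iff)

lemma lam_pure_mult:
  assumes s: "s \<in> tuples k R" and u: "u \<in> carrier F"
  shows "lam f (pure s \<otimes>\<^bsub>F\<^esub> u) = lam (\<lambda>i r. f i (s i \<otimes> r)) u"
  using u
proof (induction rule: F_induct)
  case zero
  show ?case
    by (simp only: F_mult_zero lam_0)
next
  case (pure t)
  show ?case
    by (simp add: pure_mult lam_pure tuple_mult_def)
next
  case (add u v)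
  then show ?case
    using s by (simp only: F_r_distr pure_carrier lam_add F_mult_closed)
qed

lemma additive_family_shift:
  assumes "additive_family f" "\<And>i. i < k \<Longrightarrow> s i \<in> carrier R"
  shows "additive_family (\<lambda>i r. f i (s i \<otimes> r))"
  using assms by (simp add: additive_family_def r_distr)

lemma lam_I:
  assumes "u \<in> I" "additive_family f"
  shows "lam f u = 0"
proof -
  \<comment> \<open>All additive families are quantified at once: multiplication by a tuple changes
    the family, so the zero set of a single functional need not be an ideal.\<close>
  define N where "N = {u \<in> carrier F. \<forall>f. additive_family f \<longrightarrow> lam f u = 0}"
  have "ideal N F"
  proof (rule F_idealI)
    show "0 \<in> N"
      unfolding N_def using F_zero_closed lam_0 by blast
    show "u + v \<in> N" if "u \<in> N" "v \<in> N" for u v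
      using that unfolding N_def by (simp add: F_add_closed lam_add del: plus_fun_apply)
    show "v \<otimes>\<^bsub>F\<^esub> u \<in> N" if u: "u \<in> N" and "v \<in> carrier F" for u v
      using that(2)
    proof (induction rule: F_induct)
      case zero
      show ?case
        using \<open>0 \<in> N\<close> by (simp only: F_zero_mult)
    next
      case (pure s)
      have "lam f (pure s \<otimes>\<^bsub>F\<^esub> u) = 0" if f: "additive_family f" for f
      proof -
        have "additive_family (\<lambda>i r. f i (s i \<otimes> r))"
          using pure by (intro additive_family_shift f) (auto simp: tuples_def)
        then show ?thesis
          using u pure by (simp add: N_def lam_pure_mult)
      qed
      then show ?case
        using u pure unfolding N_def by (simp add: pure_carrier F_mult_closed)
    next
      case (add v w)
      have "(v + w) \<otimes>\<^bsub>F\<^esub> u = v \<otimes>\<^bsub>F\<^esub> u + w \<otimes>\<^bsub>F\<^esub> u"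
        using add u by (intro F_l_distr) (simp_all add: N_def)
      then show ?case
        using add \<open>\<And>u v. u \<in> N \<Longrightarrow> v \<in> N \<Longrightarrow> u + v \<in> N\<close> by (simp only:)
    qed
  qed (auto simp: N_def)
  moreover have "multilinear_relations k R \<subseteq> N"
  proof
    fix x assume x: "x \<in> multilinear_relations k R"
    then obtain t i a b where t: "t \<in> tuples k R" "i < k" "a \<in> carrier R" "b \<in> carrier R"
      and x_eq: "x = pure (t(i := a \<oplus> b)) + pure (t(i := a)) + pure (t(i := b))"
      unfolding multilinear_relations_eq by blast
    have c: "pure (t(i := a \<oplus> b)) \<in> carrier F" "pure (t(i := a)) \<in> carrier F" "pure (t(i := b)) \<in> carrier F"
      using t by (auto intro!: pure_carrier update_tuples)
    have "lam f x = 0" if f: "additive_family f" for f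
    proof -
      have P: "(\<Prod>j<k. f j ((t(i := r)) j)) = f i r * (\<Prod>j\<in>{..<k} - {i}. f j (t j))" for r
        using t(2) by (subst prod.remove [of _ i]) (auto intro!: prod.cong)
      have "f i (a \<oplus> b) = f i a + f i b"
        using f t by (simp add: additive_family_def)
      then show ?thesis
        unfolding x_eq lam_add [OF F_add_closed [OF c(1,2)] c(3)] lam_add [OF c(1,2)] lam_pure P
        by (simp add: distrib_right add.assoc [symmetric])
    qed
    then show "x \<in> N"
      using x multilinear_relations_subset unfolding N_def by blast
  qed
  ultimately have "I \<subseteq> N"
    by (rule F.genideal_minimal)
  then show ?thesis
    using assms unfolding N_def by blast
qed

definition Lam :: "(nat \<Rightarrow> 'a \<Rightarrow> bit) \<Rightarrow> ((nat \<Rightarrow> 'a) \<Rightarrow> bit) set \<Rightarrow> bit" where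
  "Lam f w = the_elem (lam f ` w)"

lemma Lam_cls:
  assumes "additive_family f" "u \<in> carrier F"
  shows "Lam f (cls u) = lam f u"
  unfolding Lam_def
proof (rule the_elem_image_cls)
  fix x assume x: "x \<in> I"
  then show "lam f (x + u) = lam f u"
    using lam_add [of x u f] lam_I [OF x assms(1)] assms(2) I_subset by auto
qed

lemma Lam_add:
  assumes f: "additive_family f" and "x \<in> carrier T" "y \<in> carrier T"
  shows "Lam f (x \<oplus>\<^bsub>T\<^esub> y) = Lam f x + Lam f y"
proof -
  obtain u v where "u \<in> carrier F" "x = cls u" "v \<in> carrier F" "y = cls v"
    using assms(2,3) unfolding carrier_T by blast
  then show ?thesis
    using f by (simp only: cls_add [symmetric] Lam_cls F_add_closed lam_add)
qed

lemma Lam_0: "additive_family f \<Longrightarrow> Lam f \<zero>\<^bsub>T\<^esub> = 0"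
  using Lam_cls [of f 0] F_zero_closed by (simp only: cls_0 lam_0)

lemma Lam_one: "additive_family f \<Longrightarrow> Lam f \<one>\<^bsub>T\<^esub> = (\<Prod>i<k. f i \<one>)"
  using Lam_cls [of f "pure (\<lambda>i\<in>{..<k}. \<one>)"] one_tuple by (simp add: cls_one lam_pure pure_carrier)

lemma additive_family_update:
  assumes "additive_family f" "r \<in> carrier R"
  shows "additive_family (f(i := \<lambda>s. f i (r \<otimes> s)))"
  using assms by (simp add: additive_family_def r_distr)

text \<open>Multiplication by an element of one slot is transposed to the functional, where it
  changes the family in that slot only. This permits an induction over the factors of a
  product.\<close>

lemma Lam_iota_mult:
  assumes f: "additive_family f" and "i < k" "r \<in> carrier R" "w \<in> carrier T"
  shows "Lam f (iota i r \<otimes>\<^bsub>T\<^esub> w) = Lam (f(i := \<lambda>s. f i (r \<otimes> s))) w"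
proof -
  obtain u where u: "u \<in> carrier F" "w = cls u"
    using assms(4) unfolding carrier_T by blast
  define t where "t = (\<lambda>j\<in>{..<k}. \<one>)(i := r)"
  have t: "t \<in> tuples k R"
    unfolding t_def using assms by (intro update_tuples one_tuple)
  have tj: "t j = (if j = i then r else \<one>)" if "j < k" for j
    using that by (simp add: t_def)
  have "Lam f (iota i r \<otimes>\<^bsub>T\<^esub> w) = lam f (pure t \<otimes>\<^bsub>F\<^esub> u)"
    using f t u by (simp only: iota_def t_def [symmetric] cls_mult [symmetric] pure_carrier Lam_cls F_mult_closed)
  also have "\<dots> = lam (\<lambda>j s. f j (t j \<otimes> s)) u"
    by (rule lam_pure_mult [OF t u(1)])
  also have "\<dots> = lam (f(i := \<lambda>s. f i (r \<otimes> s))) u"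
    by (rule lam_cong [OF u(1)]) (simp add: tj)
  finally show ?thesis
    using Lam_cls [OF additive_family_update [OF f assms(3)] u(1)] by (simp only: u(2))
qed

lemma bit_pascal:
  fixes H :: "nat \<Rightarrow> nat \<Rightarrow> bit"
  shows "(\<Sum>j\<le>m. of_nat (m choose j) * H (Suc j) (m - j)) + (\<Sum>j\<le>m. of_nat (m choose j) * H j (Suc m - j))
    = (\<Sum>j\<le>Suc m. of_nat (Suc m choose j) * H j (Suc m - j))"
proof -
  have "(\<Sum>j\<le>Suc m. of_nat (Suc m choose j) * H j (Suc m - j)) =
      H 0 (Suc m) + (\<Sum>j\<le>m. (of_nat (m choose j) + of_nat (m choose Suc j)) * H (Suc j) (m - j))"
    by (subst sum.atMost_Suc_shift) simp
  also have "\<dots> = (\<Sum>j\<le>m. of_nat (m choose j) * H (Suc j) (m - j)) +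
      (H 0 (Suc m) + (\<Sum>j\<le>m. of_nat (m choose Suc j) * H (Suc j) (m - j)))"
    by (simp only: distrib_right sum.distrib add.assoc add.commute add.left_commute)
  also have "H 0 (Suc m) + (\<Sum>j\<le>m. of_nat (m choose Suc j) * H (Suc j) (m - j)) =
      (\<Sum>j\<le>Suc m. of_nat (m choose j) * H j (Suc m - j))"
    by (subst sum.atMost_Suc_shift) simp
  also have "\<dots> = (\<Sum>j\<le>m. of_nat (m choose j) * H j (Suc m - j))"
    by (simp add: binomial_eq_0)
  finally show ?thesis
    by (simp only:)
qed

text \<open>Once a functional is applied, the expansion is a sum in \<open>bit\<close>, so the
  parity of each binomial coefficient is retained, in contrast to the version with spans.\<close>

lemma Lam_binomial:
  assumes f: "additive_family f" and x: "x \<in> carrier T" and y: "y \<in> carrier T" and w: "w \<in> carrier T"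
  shows "Lam f ((x \<oplus>\<^bsub>T\<^esub> y) [^]\<^bsub>T\<^esub> (m::nat) \<otimes>\<^bsub>T\<^esub> w) =
    (\<Sum>j\<le>m. of_nat (m choose j) * Lam f (x [^]\<^bsub>T\<^esub> j \<otimes>\<^bsub>T\<^esub> (y [^]\<^bsub>T\<^esub> (m - j) \<otimes>\<^bsub>T\<^esub> w)))"
  using w
proof (induction m arbitrary: w)
  case 0
  then show ?case
    by simp
next
  case (Suc m)
  let ?H = "\<lambda>i j. Lam f (x [^]\<^bsub>T\<^esub> i \<otimes>\<^bsub>T\<^esub> (y [^]\<^bsub>T\<^esub> j \<otimes>\<^bsub>T\<^esub> w))"
  have "(x \<oplus>\<^bsub>T\<^esub> y) [^]\<^bsub>T\<^esub> Suc m \<otimes>\<^bsub>T\<^esub> w =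
      (x \<oplus>\<^bsub>T\<^esub> y) [^]\<^bsub>T\<^esub> m \<otimes>\<^bsub>T\<^esub> (x \<otimes>\<^bsub>T\<^esub> w) \<oplus>\<^bsub>T\<^esub> (x \<oplus>\<^bsub>T\<^esub> y) [^]\<^bsub>T\<^esub> m \<otimes>\<^bsub>T\<^esub> (y \<otimes>\<^bsub>T\<^esub> w)"
    using x y Suc.prems by (simp add: T.m_assoc T.l_distr T.r_distr)
  then have "Lam f ((x \<oplus>\<^bsub>T\<^esub> y) [^]\<^bsub>T\<^esub> Suc m \<otimes>\<^bsub>T\<^esub> w) =
      Lam f ((x \<oplus>\<^bsub>T\<^esub> y) [^]\<^bsub>T\<^esub> m \<otimes>\<^bsub>T\<^esub> (x \<otimes>\<^bsub>T\<^esub> w)) + Lam f ((x \<oplus>\<^bsub>T\<^esub> y) [^]\<^bsub>T\<^esub> m \<otimes>\<^bsub>T\<^esub> (y \<otimes>\<^bsub>T\<^esub> w))"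
    using x y Suc.prems f by (simp only: Lam_add T.m_closed T.nat_pow_closed T.a_closed)
  also have "Lam f ((x \<oplus>\<^bsub>T\<^esub> y) [^]\<^bsub>T\<^esub> m \<otimes>\<^bsub>T\<^esub> (x \<otimes>\<^bsub>T\<^esub> w)) =
      (\<Sum>j\<le>m. of_nat (m choose j) * ?H (Suc j) (m - j))"
    unfolding Suc.IH [OF T.m_closed [OF x Suc.prems]]
  proof (rule sum.cong [OF refl])
    fix j
    have "x [^]\<^bsub>T\<^esub> j \<otimes>\<^bsub>T\<^esub> (y [^]\<^bsub>T\<^esub> (m - j) \<otimes>\<^bsub>T\<^esub> (x \<otimes>\<^bsub>T\<^esub> w)) = x [^]\<^bsub>T\<^esub> Suc j \<otimes>\<^bsub>T\<^esub> (y [^]\<^bsub>T\<^esub> (m - j) \<otimes>\<^bsub>T\<^esub> w)"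
      using x y Suc.prems by (simp add: T.m_ac)
    then show "of_nat (m choose j) * Lam f (x [^]\<^bsub>T\<^esub> j \<otimes>\<^bsub>T\<^esub> (y [^]\<^bsub>T\<^esub> (m - j) \<otimes>\<^bsub>T\<^esub> (x \<otimes>\<^bsub>T\<^esub> w))) =
        of_nat (m choose j) * ?H (Suc j) (m - j)"
      by (simp only:)
  qed
  also have "Lam f ((x \<oplus>\<^bsub>T\<^esub> y) [^]\<^bsub>T\<^esub> m \<otimes>\<^bsub>T\<^esub> (y \<otimes>\<^bsub>T\<^esub> w)) =
      (\<Sum>j\<le>m. of_nat (m choose j) * ?H j (Suc m - j))"
    unfolding Suc.IH [OF T.m_closed [OF y Suc.prems]]
  proof (rule sum.cong [OF refl])
    fix j assume "j \<in> {..m}"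
    then have "y [^]\<^bsub>T\<^esub> (m - j) \<otimes>\<^bsub>T\<^esub> (y \<otimes>\<^bsub>T\<^esub> w) = y [^]\<^bsub>T\<^esub> (Suc m - j) \<otimes>\<^bsub>T\<^esub> w"
      using y Suc.prems by (simp add: Suc_diff_le T.m_assoc)
    then show "of_nat (m choose j) * Lam f (x [^]\<^bsub>T\<^esub> j \<otimes>\<^bsub>T\<^esub> (y [^]\<^bsub>T\<^esub> (m - j) \<otimes>\<^bsub>T\<^esub> (y \<otimes>\<^bsub>T\<^esub> w))) =
        of_nat (m choose j) * ?H j (Suc m - j)"
      by (simp only:)
  qed
  also have "(\<Sum>j\<le>m. of_nat (m choose j) * ?H (Suc j) (m - j)) + (\<Sum>j\<le>m. of_nat (m choose j) * ?H j (Suc m - j))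
      = (\<Sum>j\<le>Suc m. of_nat (Suc m choose j) * ?H j (Suc m - j))"
    by (rule bit_pascal [of m ?H])
  finally show ?case .
qed

lemma coeff_0: "coeff i \<zero> = 0"
  using coeff_add [of \<zero> \<zero> i] by simp

text \<open>Reading off the coefficient of the \<open>n\<close>-th power in slot \<open>m\<close>
  leaves only the term \<open>j = n\<close> of the binomial expansion, whose coefficient is odd, and
  passes \<open>b m\<close> on to the exponent of the last variable. The family is arbitrary in the
  remaining slots because the induction step alters it there.\<close>

lemma Lam_gen_prod:
  assumes odd: "\<And>l. l < q \<Longrightarrow> odd ((n + b l) choose n)"
  shows "m \<le> q \<Longrightarrow> additive_family f \<Longrightarrow> (\<And>l. l < m \<Longrightarrow> f l = coeff n) \<Longrightarrow>
    Lam f (gen_prod (\<lambda>l. n + b l) m) = (\<Prod>l\<in>{m..<q}. f l \<one>) * f q (X [^] (\<Sum>l<m. b l))"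
proof (induction m arbitrary: f)
  case 0
  have "{..<k} = insert q {..<q}"
    using k_pos by (auto simp: q_def)
  then have "(\<Prod>l<k. f l \<one>) = (\<Prod>l<q. f l \<one>) * f q \<one>"
    by (simp add: mult.commute)
  then show ?case
    using Lam_one [OF 0(2)] by (simp add: lessThan_atLeast0)
next
  case (Suc m)
  let ?a = "\<lambda>l. n + b l"
  have mq: "m < q" and mk: "m < k"
    using Suc.prems(1) by auto
  have W: "gen_prod ?a m \<in> carrier T"
    using mk by simp
  have monomial: "Lam f (iota m X [^]\<^bsub>T\<^esub> j \<otimes>\<^bsub>T\<^esub> (iota q X [^]\<^bsub>T\<^esub> s \<otimes>\<^bsub>T\<^esub> gen_prod ?a m)) =
     (if j = n then (\<Prod>l\<in>{Suc m..<q}. f l \<one>) * f q (X [^] (s + (\<Sum>l<m. b l))) else 0)" for j s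
  proof -
    define g where "g = f(m := \<lambda>r. f m (X [^] j \<otimes> r))"
    define h where "h = g(q := \<lambda>r. g q (X [^] s \<otimes> r))"
    have g: "additive_family g"
      unfolding g_def by (rule additive_family_update [OF Suc.prems(2)]) simp
    have h: "additive_family h"
      unfolding h_def by (rule additive_family_update [OF g]) simp
    have "Lam f (iota m X [^]\<^bsub>T\<^esub> j \<otimes>\<^bsub>T\<^esub> (iota q X [^]\<^bsub>T\<^esub> s \<otimes>\<^bsub>T\<^esub> gen_prod ?a m)) =
        Lam f (iota m (X [^] j) \<otimes>\<^bsub>T\<^esub> (iota q (X [^] s) \<otimes>\<^bsub>T\<^esub> gen_prod ?a m))"
      using mk by (simp only: iota_power q_less X_carrier)
    also have "\<dots> = Lam g (iota q (X [^] s) \<otimes>\<^bsub>T\<^esub> gen_prod ?a m)"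
      unfolding g_def using mk W by (intro Lam_iota_mult Suc.prems(2)) auto
    also have "\<dots> = Lam h (gen_prod ?a m)"
      unfolding h_def using W by (intro Lam_iota_mult g) auto
    also have "\<dots> = (\<Prod>l\<in>{m..<q}. h l \<one>) * h q (X [^] (\<Sum>l<m. b l))"
    proof (rule Suc.IH [OF _ h])
      show "m \<le> q"
        using mq by simp
      show "h l = coeff n" if "l < m" for l
        using that mq Suc.prems(3) by (auto simp: h_def g_def)
    qed
    also have "(\<Prod>l\<in>{m..<q}. h l \<one>) = h m \<one> * (\<Prod>l\<in>{Suc m..<q}. h l \<one>)"
      using mq by (simp add: prod.atLeast_Suc_lessThan)
    also have "(\<Prod>l\<in>{Suc m..<q}. h l \<one>) = (\<Prod>l\<in>{Suc m..<q}. f l \<one>)"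
      by (rule prod.cong) (auto simp: h_def g_def)
    also have "h m \<one> = (if j = n then 1 else 0)"
    proof -
      have "h m \<one> = coeff n (X [^] j)"
        using mq Suc.prems(3) by (simp add: h_def g_def)
      moreover have "X [^] j = \<zero>" if "n < j"
      proof -
        have "X [^] j = X [^] Suc n \<otimes> X [^] (j - Suc n)"
          using that by (simp only: nat_pow_mult [OF X_carrier] le_add_diff_inverse Suc_leI)
        then show ?thesis
          unfolding X_nilpotent by simp
      qed
      ultimately show ?thesis
        using coeff_power [of n j] coeff_0 by (cases "j \<le> n") auto
    qed
    also have "h q (X [^] (\<Sum>l<m. b l)) = f q (X [^] (s + (\<Sum>l<m. b l)))"
      using mq by (simp add: h_def g_def nat_pow_mult)
    finally show ?thesis
      by simp
  qed
  have "Lam f (gen_prod ?a (Suc m)) = Lam f ((iota m X \<oplus>\<^bsub>T\<^esub> iota q X) [^]\<^bsub>T\<^esub> ?a m \<otimes>\<^bsub>T\<^esub> gen_prod ?a m)"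
    using mk W by (simp add: gen_def T.m_comm)
  also have "\<dots> = (\<Sum>j\<le>?a m. of_nat (?a m choose j) *
      (if j = n then (\<Prod>l\<in>{Suc m..<q}. f l \<one>) * f q (X [^] (?a m - j + (\<Sum>l<m. b l))) else 0))"
    using mk W by (subst Lam_binomial [OF Suc.prems(2)]) (simp_all add: monomial)
  also have "\<dots> = (\<Sum>j\<in>{n}. of_nat (?a m choose j) *
      (if j = n then (\<Prod>l\<in>{Suc m..<q}. f l \<one>) * f q (X [^] (?a m - j + (\<Sum>l<m. b l))) else 0))"
    by (rule sum.mono_neutral_right) auto
  also have "\<dots> = of_nat (?a m choose n) * ((\<Prod>l\<in>{Suc m..<q}. f l \<one>) * f q (X [^] (\<Sum>l<Suc m. b l)))"
    by (simp add: add.commute)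
  also have "of_nat (?a m choose n) = (1::bit)"
    using odd [OF mq] of_int_bit_eq_0_iff [of "int (?a m choose n)"] by simp
  finally show ?case
    by simp
qed

lemma gen_prod_nonzero_if_odd:
  assumes odd: "\<And>l. l < q \<Longrightarrow> odd ((n + b l) choose n)" and le: "(\<Sum>l<q. b l) \<le> n"
  shows "gen_prod (\<lambda>l. n + b l) q \<noteq> \<zero>\<^bsub>T\<^esub>"
proof
  assume z: "gen_prod (\<lambda>l. n + b l) q = \<zero>\<^bsub>T\<^esub>"
  \<comment> \<open>The functional reading off the monomial with exponent \<open>n\<close> in every
    slot below \<open>q\<close> and the sum of the \<open>b l\<close> in the last slot.\<close>
  define f where "f l = (if l < q then coeff n else coeff (\<Sum>l<q. b l))" for l
  have f: "additive_family f"
    by (simp add: additive_family_def f_def coeff_add)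
  have "Lam f (gen_prod (\<lambda>l. n + b l) q) = f q (X [^] (\<Sum>l<q. b l))"
    using Lam_gen_prod [OF odd order_refl f] by (simp add: f_def)
  also have "\<dots> = 1"
    using le by (simp add: f_def coeff_power)
  finally show False
    using Lam_0 [OF f] by (simp add: z)
qed

end

subsection \<open>Binary expansions\<close>

text \<open>\<open>Z\<close> with an exclusive bound: the empty case \<open>p = 0\<close> is
  allowed, and the index becomes the exponent of the modulus \<open>2 ^ p\<close>.\<close>

definition zeros_below :: "nat \<Rightarrow> nat \<Rightarrow> nat" where
  "zeros_below p n = (\<Sum>j<p. (1 - digit n j) * 2 ^ j)"

lemma Z_eq: "Z i n = zeros_below (Suc i) n"
  by (simp add: Z_def zeros_below_def lessThan_Suc_atMost)

lemma digit_cases: "digit n j = 0 \<or> digit n j = 1"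
  by (auto simp: digit_def)

text \<open>The two numbers have complementary digits below \<open>p\<close>, so their sum has all
  these digits equal to 1.\<close>

lemma mod_add_zeros_below: "Suc (n mod 2 ^ p + zeros_below p n) = 2 ^ p"
proof (induction p)
  case (Suc p)
  have "n mod 2 ^ Suc p = digit n p * 2 ^ p + n mod 2 ^ p"
    unfolding digit_def power_Suc2 by (simp add: mod_mult2_eq)
  moreover have "zeros_below (Suc p) n = zeros_below p n + (1 - digit n p) * 2 ^ p"
    by (simp add: zeros_below_def)
  moreover have "digit n p + (1 - digit n p) = 1"
    using digit_cases [of n p] by auto
  then have "digit n p * 2 ^ p + (1 - digit n p) * 2 ^ p = (2 ^ p :: nat)"
    by (metis add_mult_distrib mult_1)
  ultimately show ?case
    using Suc.IH by simp
qed (simp add: zeros_below_def)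

text \<open>Each of the \<open>q\<close> exponents exceeds \<open>n\<close> by at most
  \<open>zeros_below p n\<close>, and \<open>n mod 2 ^ p\<close>, being \<open>2 ^ p - 1\<close>
  minus the same number, contributes it once more: this is the origin of the factor
  \<open>Suc q\<close>.\<close>

lemma degree_bound:
  assumes "\<forall>l<q. j l \<le> a l \<and> j l \<le> n \<and> j l mod 2 ^ p + (a l - j l) mod 2 ^ p < 2 ^ p" and le: "(\<Sum>l<q. a l - j l) \<le> n"
  shows "int (\<Sum>l<q. a l) \<le> int (Suc q) * int n - (2 ^ p - 1 - int (Suc q) * int (zeros_below p n))"
proof -
  let ?M = "2 ^ p :: nat" and ?z = "zeros_below p n"
  let ?B = "\<Sum>l<q. a l - j l" and ?C = "\<Sum>l<q. (a l - j l) mod ?M"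
  have j: "\<And>l. l < q \<Longrightarrow> j l \<le> a l" "\<And>l. l < q \<Longrightarrow> j l \<le> n"
    "\<And>l. l < q \<Longrightarrow> j l mod ?M + (a l - j l) mod ?M < ?M"
    using assms(1) by auto
  have Mz: "Suc (n mod ?M + ?z) = ?M"
    by (rule mod_add_zeros_below)
  \<comment> \<open>The part of \<open>j l\<close> divisible by \<open>?M\<close> is at most that of
    \<open>n\<close>, and the two remainders together are at most \<open>?M - 1\<close>, which is
    \<open>n mod ?M + ?z\<close>.\<close>
  have one: "j l + (a l - j l) mod ?M \<le> n + ?z" if l: "l < q" for l
  proof -
    have "j l div ?M * ?M \<le> n div ?M * ?M"
      using j(2) [OF l] by (intro mult_le_mono1 div_le_mono)
    moreover have "j l = j l div ?M * ?M + j l mod ?M" "n = n div ?M * ?M + n mod ?M"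
      by (rule div_mult_mod_eq [symmetric])+
    ultimately show ?thesis
      using j(3) [OF l] Mz by linarith
  qed
  have "(\<Sum>l<q. j l) + ?C = (\<Sum>l<q. j l + (a l - j l) mod ?M)"
    by (simp add: sum.distrib)
  also have "\<dots> \<le> (\<Sum>l<q. n + ?z)"
    using one by (intro sum_mono) simp
  finally have 1: "(\<Sum>l<q. j l) + ?C \<le> q * (n + ?z)"
    by simp
  \<comment> \<open>Replacing the summands of \<open>?B\<close> by their remainders does not change
    the class modulo \<open>?M\<close>, and a natural number is at least its remainder; so the gap
    \<open>n - ?B\<close> is at least \<open>n mod ?M - ?C\<close>.\<close>
  have "(n - ?B + ?C) mod ?M = (n - ?B + ?B) mod ?M"
    by (rule mod_add_cong [OF refl mod_sum_eq])
  then have "n mod ?M = (n - ?B + ?C) mod ?M"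
    using le by simp
  then have "n mod ?M \<le> n - ?B + ?C"
    by simp
  then have 2: "?B + n mod ?M \<le> n + ?C"
    using le by linarith
  have "(\<Sum>l<q. a l) = (\<Sum>l<q. j l + (a l - j l))"
    using j(1) by (intro sum.cong) auto
  then have 3: "(\<Sum>l<q. a l) = (\<Sum>l<q. j l) + ?B"
    by (simp add: sum.distrib)
  have 4: "(\<Sum>l<q. a l) + n mod ?M \<le> q * (n + ?z) + n"
    using 1 2 3 by linarith
  have "int (\<Sum>l<q. a l) + int (n mod ?M) \<le> int q * (int n + int ?z) + int n"
    using of_nat_mono [OF 4, where 'a = int] by (simp only: of_nat_add of_nat_mult)
  moreover have "int (n mod ?M) = 2 ^ p - 1 - int ?z"
    using arg_cong [OF Mz, of int] by simp
  ultimately show ?thesis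
    by (simp add: algebra_simps)
qed

section \<open>Odd binomial coefficients and sums of numbers with prescribed binary digits\<close>

definition bit_disjoint :: "nat \<Rightarrow> nat \<Rightarrow> bool" where
  "bit_disjoint n b \<longleftrightarrow> (\<forall>j. \<not> (bit n j \<and> bit b j))"

lemma digit_eq: "digit n j = of_bool (bit n j)"
  by (simp add: digit_def bit_iff_odd mod_2_eq_odd)

text \<open>Lucas' theorem for one binary digit. The two statements are proved together because
  Pascal's rule, applied twice to reach the next even row, mixes even and odd columns.\<close>

lemma choose_double_parity:
  "even (2 * a choose Suc (2 * c)) \<and> (odd (2 * a choose (2 * c)) \<longleftrightarrow> odd (a choose c))"
proof (induction a arbitrary: c)
  case 0
  show ?case
    by (cases c) auto
next
  case (Suc a)
  have 1: "even (2 * a choose Suc (2 * c))" "odd (2 * a choose (2 * c)) \<longleftrightarrow> odd (a choose c)" for c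
    using Suc.IH by auto
  have 2: "odd (Suc (2 * a) choose Suc (2 * c)) \<longleftrightarrow> odd (a choose c)" for c
    using 1 by simp
  have 3: "odd (Suc (2 * a) choose (2 * c)) \<longleftrightarrow> odd (a choose c)" for c
    using 1(1) [of "c - 1"] 1(2) [of c] by (cases c) auto
  show ?case
  proof (cases c)
    case 0
    then show ?thesis
      by simp
  next
    case c: (Suc d)
    have "even (Suc (Suc (2 * a)) choose Suc (2 * c))"
      using 2 [of c] 3 [of c] by (simp del: binomial_Suc_Suc add: binomial_Suc_Suc [of "Suc (2 * a)"])
    moreover have "odd (Suc (Suc (2 * a)) choose Suc (Suc (2 * d))) \<longleftrightarrow> odd (Suc a choose Suc d)"
      using 2 [of d] 3 [of "Suc d"]
      by (simp del: binomial_Suc_Suc add: binomial_Suc_Suc [of "Suc (2 * a)"] binomial_Suc_Suc [of a])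
    ultimately show ?thesis
      using c by simp
  qed
qed

lemma choose_odd_parity:
  "odd (Suc (2 * a) choose Suc (2 * c)) \<longleftrightarrow> odd (a choose c)"
  "odd (Suc (2 * a) choose (2 * c)) \<longleftrightarrow> odd (a choose c)"
  using choose_double_parity [of a c] choose_double_parity [of a "c - 1"] by (cases c; simp)+

text \<open>Without a common binary digit there is no carry, so halving \<open>n\<close> and
  \<open>b\<close> halves the sum as well, and the parity rules strip the last digit.\<close>

lemma odd_choose_if_bit_disjoint: "bit_disjoint n b \<Longrightarrow> odd ((n + b) choose n)"
proof (induction "n + b" arbitrary: n b rule: less_induct)
  case less
  show ?case
  proof (cases "n + b = 0")
    case False
    define n' b' where "n' = n div 2" and "b' = b div 2"
    have "bit_disjoint n' b'"
      using less.prems unfolding bit_disjoint_def n'_def b'_def by (metis bit_Suc)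
    moreover have "n' + b' < n + b"
      using False unfolding n'_def b'_def by linarith
    ultimately have IH: "odd ((n' + b') choose n')"
      by (intro less.hyps)
    have "\<not> (odd n \<and> odd b)"
      using less.prems unfolding bit_disjoint_def by (metis bit_0)
    then consider "n = 2 * n'" "n + b = 2 * (n' + b')" | "n = Suc (2 * n')" "n + b = Suc (2 * (n' + b'))"
      | "n = 2 * n'" "n + b = Suc (2 * (n' + b'))"
      unfolding n'_def b'_def by (cases "odd n"; cases "odd b") (auto elim!: evenE oddE)
    then show ?thesis
      using IH choose_double_parity [of "n' + b'" n'] choose_odd_parity [of "n' + b'" n'] by cases simp_all
  qed simp
qed

text \<open>The numbers \<open>b l\<close> are built from the powers of two missing in \<open>n\<close>, each of them being used
  at most \<open>q\<close> times, greedily from the top.  After the last power of two at which not all \<open>q\<close> copies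
  could be used the remainder is determined by the lower digits of \<open>n\<close>.\<close>

lemma greedy_representation:
  "R mod 2 ^ p = n mod 2 ^ p \<Longrightarrow> \<exists>b. (\<forall>l<q. b l < 2 ^ p \<and> bit_disjoint n (b l)) \<and> (\<Sum>l<q. b l) \<le> R \<and>
     (int R - int (\<Sum>l<q. b l) \<le> int R - int q * int (zeros_below p n) \<or>
      (\<exists>p'. int R - int (\<Sum>l<q. b l) \<le> 2 ^ p' - 1 - int (Suc q) * int (zeros_below p' n)))"
proof (induction p arbitrary: R)
  case 0
  show ?case
    by (intro exI [of _ "\<lambda>_. 0"]) (simp add: bit_disjoint_def zeros_below_def)
next
  case (Suc p)
  have dig: "n mod 2 ^ Suc p = digit n p * 2 ^ p + n mod 2 ^ p" for n
    unfolding digit_def power_Suc2 by (simp add: mod_mult2_eq)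
  have R: "R mod 2 ^ p = n mod 2 ^ p"
    using arg_cong [OF Suc.prems, of "\<lambda>x. x mod 2 ^ p"] by (simp add: mod_mod_cancel)
  have zs: "zeros_below (Suc p) n = zeros_below p n + (1 - digit n p) * 2 ^ p"
    by (simp add: zeros_below_def)
  show ?case
  proof (cases "digit n p = 1")
    case True
    then have "zeros_below (Suc p) n = zeros_below p n"
      by (simp add: zs)
    moreover obtain b where b: "\<forall>l<q. b l < 2 ^ p \<and> bit_disjoint n (b l)" "(\<Sum>l<q. b l) \<le> R"
       "int R - int (\<Sum>l<q. b l) \<le> int R - int q * int (zeros_below p n) \<or>
        (\<exists>p'. int R - int (\<Sum>l<q. b l) \<le> 2 ^ p' - 1 - int (Suc q) * int (zeros_below p' n))"
      using Suc.IH [OF R] by blast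
    moreover have "\<forall>l<q. b l < 2 ^ Suc p \<and> bit_disjoint n (b l)"
    proof (intro allI impI)
      fix l assume "l < q"
      with b(1) have "b l < 2 ^ p" "bit_disjoint n (b l)"
        by auto
      then show "b l < 2 ^ Suc p \<and> bit_disjoint n (b l)"
        by simp
    qed
    ultimately show ?thesis
      by (intro exI [of _ b]) (simp only: simp_thms)
  next
    case False
    then have d0: "digit n p = 0"
      using digit_cases by blast
    \<comment> \<open>As many copies of \<open>2 ^ p\<close> as fit into the remainder
      \<open>R\<close>, but at most one for each of the \<open>q\<close> numbers.\<close>
    define s where "s = min q (R div 2 ^ p)"
    define R' where "R' = R - s * 2 ^ p"
    have sR: "s * 2 ^ p \<le> R"
    proof -
      have "s * 2 ^ p \<le> R div 2 ^ p * 2 ^ p"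
        by (simp add: s_def)
      also have "\<dots> \<le> R"
        by simp
      finally show ?thesis .
    qed
    have RR: "R = R' + s * 2 ^ p"
      using sR by (simp add: R'_def)
    \<comment> \<open>Removing multiples of \<open>2 ^ p\<close> does not affect the lower digits,
      in which the remainder continues to agree with \<open>n\<close>.\<close>
    have "R' mod 2 ^ p = n mod 2 ^ p"
      using R unfolding RR by simp
    from Suc.IH [OF this] obtain b where b: "\<And>l. l < q \<Longrightarrow> b l < 2 ^ p \<and> bit_disjoint n (b l)"
      "(\<Sum>l<q. b l) \<le> R'"
      "int R' - int (\<Sum>l<q. b l) \<le> int R' - int q * int (zeros_below p n) \<or>
        (\<exists>p'. int R' - int (\<Sum>l<q. b l) \<le> 2 ^ p' - 1 - int (Suc q) * int (zeros_below p' n))"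
      by blast
    define b' where "b' l = b l + (if l < s then 2 ^ p else 0)" for l
    have "s \<le> q"
      by (simp add: s_def)
    then have "{..<q} \<inter> {l. l < s} = {..<s}"
      by auto
    then have "(\<Sum>l<q. if l < s then 2 ^ p else 0 :: nat) = s * 2 ^ p"
      by (simp add: sum.If_cases)
    then have sb: "(\<Sum>l<q. b' l) = (\<Sum>l<q. b l) + s * 2 ^ p"
      by (simp add: b'_def sum.distrib)
    then have diff: "int R - int (\<Sum>l<q. b' l) = int R' - int (\<Sum>l<q. b l)"
      by (simp add: RR)
    have disj: "b' l < 2 ^ Suc p \<and> bit_disjoint n (b' l)" if l: "l < q" for l
    proof (cases "l < s")
      case True
      have bl: "b l < 2 ^ p" "bit_disjoint n (b l)"
        using b(1) [OF l] by auto
      then have "\<not> bit (b l) p"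
        by (simp add: bit_iff_odd)
      then have "b' l = set_bit p (b l)"
        using True by (simp add: b'_def set_bit_eq)
      then show ?thesis
        using bl True d0 by (auto simp: bit_disjoint_def bit_set_bit_iff digit_eq b'_def)
    next
      case False
      then show ?thesis
        using b(1) [OF l] by (simp add: b'_def)
    qed
    have "int R' - int (\<Sum>l<q. b l) \<le> int R - int q * int (zeros_below (Suc p) n) \<or>
      (\<exists>p'. int R' - int (\<Sum>l<q. b l) \<le> 2 ^ p' - 1 - int (Suc q) * int (zeros_below p' n))"
    proof (cases "s = q")
      case True
      then have "int R - int q * int (zeros_below (Suc p) n) = int R' - int q * int (zeros_below p n)"
        by (simp add: zs d0 RR algebra_simps)
      then show ?thesis
        using b(3) by simp
    next
      case False
      \<comment> \<open>Fewer than \<open>q\<close> copies fit, so what is left consists of the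
        lower digits of \<open>n\<close>; with this size, even the use of all copies below
        \<open>p\<close> gives the second alternative with \<open>p' = p\<close>.\<close>
      then have "s = R div 2 ^ p"
        by (simp add: s_def min_def split: if_splits)
      then have "R' = R mod 2 ^ p"
        by (simp add: R'_def minus_div_mult_eq_mod)
      then have "int R' = 2 ^ p - 1 - int (zeros_below p n)"
        using R arg_cong [OF mod_add_zeros_below [of n p], of int] by simp
      then have "int R' - int q * int (zeros_below p n) = 2 ^ p - 1 - int (Suc q) * int (zeros_below p n)"
        by (simp add: algebra_simps)
      then show ?thesis
        using b(3) by metis
    qed
    moreover have "(\<Sum>l<q. b' l) \<le> R"
      using b(2) sb RR by linarith
    ultimately show ?thesis
      using disj unfolding diff [symmetric] by (intro exI [of _ b']) blast
  qed
qed

text \<open>The greedy choice starts from \<open>R = n\<close> and \<open>p = n\<close>, above all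
  digits of \<open>n\<close>. There \<open>n\<close> is \<open>2 ^ n - 1\<close> minus its missing
  powers of two, so the case in which every copy is used is an instance of the same formula.\<close>

lemma optimal_representation:
  obtains b p where "\<forall>l<q. odd ((n + b l) choose n)" "(\<Sum>l<q. b l) \<le> n"
    "int n - int (\<Sum>l<q. b l) \<le> 2 ^ p - 1 - int (Suc q) * int (zeros_below p n)"
proof -
  have "n < 2 ^ n"
    by (rule less_exp)
  obtain b where b: "\<forall>l<q. b l < 2 ^ n \<and> bit_disjoint n (b l)" "(\<Sum>l<q. b l) \<le> n"
     "int n - int (\<Sum>l<q. b l) \<le> int n - int q * int (zeros_below n n) \<or>
      (\<exists>p'. int n - int (\<Sum>l<q. b l) \<le> 2 ^ p' - 1 - int (Suc q) * int (zeros_below p' n))"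
    using greedy_representation [of n n n q] by blast
  have "int n = 2 ^ n - 1 - int (zeros_below n n)"
    using arg_cong [OF mod_add_zeros_below [of n n], of int] \<open>n < 2 ^ n\<close> by simp
  then have "int n - int q * int (zeros_below n n) = 2 ^ n - 1 - int (Suc q) * int (zeros_below n n)"
    by (simp add: algebra_simps)
  then obtain p where "int n - int (\<Sum>l<q. b l) \<le> 2 ^ p - 1 - int (Suc q) * int (zeros_below p n)"
    using b(3) by metis
  then show thesis
    using that b(1,2) odd_choose_if_bit_disjoint by blast
qed

section \<open>The largest deficiency and the exponents that attain it\<close>

lemma \<nu>_properties:
  assumes "0 < m"
  shows "2 ^ \<nu> m dvd m" "2 ^ t dvd m \<Longrightarrow> t \<le> \<nu> m"
proof -
  have "{t. 2 ^ t dvd m} \<subseteq> {..m}"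
  proof
    fix t assume "t \<in> {t. 2 ^ t dvd m}"
    then have "2 ^ t \<le> m"
      using assms by (auto dest: dvd_imp_le)
    then show "t \<in> {..m}"
      using less_exp [of t] by (metis atMost_iff less_imp_le less_le_trans)
  qed
  then have fin: "finite {t. 2 ^ t dvd m}"
    by (rule finite_subset) simp
  moreover have "0 \<in> {t. 2 ^ t dvd m}"
    by simp
  ultimately show "2 ^ \<nu> m dvd m" "2 ^ t dvd m \<Longrightarrow> t \<le> \<nu> m"
    unfolding \<nu>_def using Max_in [of "{t. 2 ^ t dvd m}"] Max_ge [of "{t. 2 ^ t dvd m}" t] by blast+
qed

text \<open>The last \<open>\<nu> (n + 1)\<close> digits of \<open>n\<close> are all 1. Thus the
  term with \<open>\<nu>\<close> in the formula is the deficiency for this exponent.\<close>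

lemma zeros_below_\<nu>: "zeros_below (\<nu> (n + 1)) n = 0"
proof -
  let ?M = "2 ^ \<nu> (n + 1) :: nat"
  have "?M dvd n + 1"
    by (rule \<nu>_properties) simp
  then have "Suc (n mod ?M) mod ?M = 0"
    by (simp add: mod_Suc_eq dvd_eq_mod_eq_0)
  then have "?M \<le> Suc (n mod ?M)"
    by (metis Suc_not_Zero mod_less not_le)
  then show ?thesis
    using mod_add_zeros_below [of n "\<nu> (n + 1)"] by simp
qed

lemma finite_S: "finite (S n)"
proof -
  have "S n \<subseteq> {..n}"
  proof
    fix i assume "i \<in> S n"
    then have "2 ^ i \<le> n"
      by (auto simp: S_def digit_def) (metis One_nat_def div_less mod_0 not_less zero_neq_one)
    then show "i \<in> {..n}"
      using less_exp [of i] by (metis atMost_iff less_imp_le less_le_trans)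
  qed
  then show ?thesis
    by (rule finite_subset) simp
qed

text \<open>The top two digits below \<open>p\<close> decide: a zero on top makes the value
  negative, a one above a zero gains nothing over the exponent two places lower, and within a run of
  ones the value increases up to the top of the run.\<close>

lemma deficiency_le_Max:
  fixes n k :: nat
  assumes k: "k \<ge> 3"
  defines "A \<equiv> {2 ^ \<nu> (n + 1) - 1} \<union> {2 ^ (i + 1) - 1 - int k * int (Z i n) | i. i \<in> S n}"
  shows "2 ^ p - 1 - int k * int (zeros_below p n) \<le> Max A"
proof -
  have fin: "finite A"
    using finite_S by (simp add: A_def)
  have nuA: "2 ^ \<nu> (n + 1) - 1 \<le> Max A"
    using fin by (intro Max_ge) (simp_all add: A_def)
  have "(1::int) \<le> 2 ^ \<nu> (n + 1)"
    by simp
  then have A0: "0 \<le> Max A"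
    using nuA by linarith
  have zs: "zeros_below (Suc p) n = zeros_below p n + (1 - digit n p) * 2 ^ p" for p
    by (simp add: zeros_below_def)
  have k3: "3 * int x \<le> int k * int x" for x
    using k by (intro mult_right_mono) auto
  show ?thesis
  proof (induction p rule: less_induct)
    case (less p)
    show ?case
    proof (cases p)
      case 0
      then show ?thesis
        using A0 by (simp add: zeros_below_def)
    next
      case p: (Suc i)
      show ?thesis
      proof (cases "digit n i = 0")
        case True
        \<comment> \<open>The zero at \<open>i\<close> costs at least \<open>3 * 2 ^ i\<close>, more
          than \<open>2 ^ p = 2 * 2 ^ i\<close>.\<close>
        have "int k * int (2 ^ i) \<le> int k * int (zeros_below p n)"
          using True by (intro mult_left_mono) (simp_all add: p zs)
        then have "3 * int (2 ^ i) \<le> int k * int (zeros_below p n)"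
          by (rule order_trans [OF k3])
        moreover have "(0::int) \<le> 2 ^ i" "int (2 ^ i) = 2 ^ i"
          by simp_all
        ultimately show ?thesis
          using A0 unfolding p power_Suc by linarith
      next
        case False
        then have d1: "digit n i = 1"
          using digit_cases [of n i] by simp
        show ?thesis
        proof (cases i)
          case 0
          \<comment> \<open>A one in the lowest place belongs to the trailing run, which the first
            member of \<open>A\<close> covers.\<close>
          then have "n mod 2 = 1"
            using d1 by (simp add: digit_def)
          then have "2 dvd n + 1"
            by presburger
          then have "2 ^ 1 dvd n + 1"
            by simp
          then have "1 \<le> \<nu> (n + 1)"
            by (rule \<nu>_properties(2) [rotated]) simp
          then have "(2::int) ^ 1 \<le> 2 ^ \<nu> (n + 1)"
            by (rule power_increasing) simp
          then show ?thesis
            using nuA 0 p d1 by (simp add: zs zeros_below_def)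
        next
          case i: (Suc h)
          show ?thesis
          proof (cases "digit n h = 0")
            case True
            then have "zeros_below p n = zeros_below h n + 2 ^ h"
              using d1 by (simp add: p i zs)
            \<comment> \<open>Passing the digits at \<open>h\<close> and \<open>h + 1\<close> raises
              the power by \<open>4 * 2 ^ h - 2 ^ h\<close>, which \<open>k \<ge> 3\<close> copies
              of the missing \<open>2 ^ h\<close> use up. This is why an isolated one does not count
              in \<open>S n\<close>.\<close>
            then have "2 ^ p - 1 - int k * int (zeros_below p n) \<le> 2 ^ h - 1 - int k * int (zeros_below h n)"
              using k3 [of "2 ^ h"] by (simp add: p i algebra_simps)
            also have "\<dots> \<le> Max A"
              by (rule less.IH) (simp add: p i)
            finally show ?thesis .
          next
            case False
            then have h1: "digit n h = 1"
              using digit_cases [of n h] by simp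
            have "n < 2 ^ (i + n + 1)"
              by (rule less_le_trans [OF less_exp [of n] power_increasing]) simp_all
            then have "digit n (i + n + 1) = 0"
              by (simp add: digit_def)
            then have ex: "digit n (i + (LEAST d. digit n (i + d + 1) = 0) + 1) = 0"
              by (rule LeastI [where P = "\<lambda>d. digit n (i + d + 1) = 0"])
            \<comment> \<open>\<open>i + d\<close> is the top of the run of ones through
              \<open>i\<close>; no missing digit is met on the way up, so only the power
              grows.\<close>
            define d where "d = (LEAST d. digit n (i + d + 1) = 0)"
            have d0: "digit n (i + d + 1) = 0"
              using ex by (simp add: d_def)
            have ones: "digit n (i + e) = 1" if "e \<le> d" for e
            proof (cases e)
              case 0
              then show ?thesis
                using d1 by simp
            next
              case (Suc e')
              then have "digit n (i + e' + 1) \<noteq> 0"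
                using not_less_Least [of e' "\<lambda>d. digit n (i + d + 1) = 0"] that by (simp add: d_def)
              then show ?thesis
                using digit_cases [of n "i + e' + 1"] Suc by simp
            qed
            have zeq: "e \<le> d \<Longrightarrow> zeros_below (Suc (i + e)) n = zeros_below p n" for e
            proof (induction e)
              case 0
              show ?case
                by (simp add: p)
            next
              case (Suc e)
              then show ?case
                using ones [OF Suc.prems] by (simp add: zs [of "Suc (i + e)"])
            qed
            have "digit n (i + d - 1) = 1"
              using ones [of "d - 1"] h1 i by (cases d) auto
            then have "i + d \<in> S n"
              using ones [OF order_refl] d0 i by (simp add: S_def)
            then have "2 ^ (i + d + 1) - 1 - int k * int (Z (i + d) n) \<in> A"
              unfolding A_def by blast
            then have "2 ^ (i + d + 1) - 1 - int k * int (zeros_below p n) \<le> Max A"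
              using zeq [OF order_refl] fin by (simp add: Z_eq Max_ge)
            moreover have "(2::int) ^ p \<le> 2 ^ (i + d + 1)"
              by (rule power_increasing) (simp_all add: p)
            ultimately show ?thesis
              by linarith
          qed
        qed
      qed
    qed
  qed
qed

section \<open>Zero-divisor cup length from the upper and lower bounds\<close>

theorem theorem1p2:
  fixes n k :: nat
  assumes "k \<ge> 3"
  shows "int (zcl k (projective_space n)) =
    int k * int n -
      Max ({2 ^ \<nu> (n + 1) - 1} \<union> {2 ^ (i + 1) - 1 - int k * int (Z i n) | i. i \<in> S n})"
proof -
  define A where "A = {2 ^ \<nu> (n + 1) - 1} \<union> {2 ^ (i + 1) - 1 - int k * int (Z i n) | i. i \<in> S n}"
  let ?P = "projective_space n"
  interpret truncated_polynomial_ring "cohomology_ring ?P" "cohomology_class ?P (sw n)" n "cohomology_coeff ?P"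
    by (rule truncated_polynomial_ring_cohomology_ring)
  interpret tensor_power_ring "cohomology_ring ?P" "cohomology_class ?P (sw n)" n "cohomology_coeff ?P" k
    by unfold_locales (use assms in simp)
  have kq: "k = Suc (k - 1)" "q = k - 1"
    using assms by (simp_all add: q_def)
  have fin: "finite A"
    using finite_S by (simp add: A_def)
  define L where "L = {length zs | zs. set zs \<subseteq> kernel_T \<and> foldr (mult T) zs \<one>\<^bsub>T\<^esub> \<noteq> \<zero>\<^bsub>T\<^esub>}"
  have upper: "int m \<le> int k * int n - Max A" if "m \<in> L" for m
  proof -
    have "\<exists>zs. m = length zs \<and> set zs \<subseteq> kernel_T \<and> foldr (mult T) zs \<one>\<^bsub>T\<^esub> \<noteq> \<zero>\<^bsub>T\<^esub>"
      using that unfolding L_def by (rule CollectD)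
    then obtain zs where zs: "set zs \<subseteq> kernel_T" "foldr (mult T) zs \<one>\<^bsub>T\<^esub> \<noteq> \<zero>\<^bsub>T\<^esub>" "m = length zs"
      by (elim exE conjE)
    obtain a where a: "(\<Sum>l<q. a l) = length zs" "gen_prod a q \<noteq> \<zero>\<^bsub>T\<^esub>"
      by (rule zero_divisor_product [OF zs(1,2)])
    \<comment> \<open>The bound is available for every exponent \<open>p\<close>; all members of
      \<open>A\<close> are deficiencies of particular exponents, so the largest may be
      inserted.\<close>
    have bound: "int m \<le> int k * int n - (2 ^ p - 1 - int k * int (zeros_below p n))" for p
    proof -
      obtain j where "\<forall>l<q. j l \<le> a l \<and> j l \<le> n \<and> j l mod 2 ^ p + (a l - j l) mod 2 ^ p < 2 ^ p" "(\<Sum>l<q. a l - j l) \<le> n"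
        by (rule gen_prod_nonzero [OF a(2), of p])
      then have "int (\<Sum>l<q. a l) \<le> int (Suc q) * int n - (2 ^ p - 1 - int (Suc q) * int (zeros_below p n))"
        by (rule degree_bound)
      then show ?thesis
        unfolding zs(3) a(1) [symmetric] kq(2) using kq(1) by simp
    qed
    have "Max A \<in> A"
      by (rule Max_in [OF fin]) (simp add: A_def)
    then consider "Max A = 2 ^ \<nu> (n + 1) - 1" | i where "Max A = 2 ^ (i + 1) - 1 - int k * int (Z i n)"
      unfolding A_def by blast
    then show ?thesis
    proof cases
      case 1
      then show ?thesis
        using bound [of "\<nu> (n + 1)"] unfolding zeros_below_\<nu> by (simp only: of_nat_0 mult_zero_right diff_zero)
    next
      case 2
      then show ?thesis
        using bound [of "i + 1"] by (simp only: Z_eq Suc_eq_plus1)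
    qed
  qed
  obtain b p where b: "\<forall>l<q. odd ((n + b l) choose n)" "(\<Sum>l<q. b l) \<le> n"
    "int n - int (\<Sum>l<q. b l) \<le> 2 ^ p - 1 - int (Suc q) * int (zeros_below p n)"
    by (rule optimal_representation [of q n])
  \<comment> \<open>With exponents \<open>n + b l\<close>, each factor contributes \<open>n\<close>
    to its own variable and \<open>b l\<close> to the common last one.\<close>
  define m where "m = (\<Sum>l<q. n + b l)"
  have "gen_prod (\<lambda>l. n + b l) q \<noteq> \<zero>\<^bsub>T\<^esub>"
    using b(1) by (intro gen_prod_nonzero_if_odd [OF _ b(2)]) blast
  then have mL: "m \<in> L"
    using gen_prod_list [OF q_le, of "\<lambda>l. n + b l"] unfolding L_def m_def by force
  have "int n - int (\<Sum>l<q. b l) \<le> Max A"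
    using b(3) deficiency_le_Max [OF assms, of p n] kq unfolding A_def by simp
  moreover have "int m = int q * int n + int (\<Sum>l<q. b l)"
    by (simp add: m_def sum.distrib)
  moreover have "int k * int n = int q * int n + int n"
    using kq by (metis add.commute distrib_right mult_1 of_nat_Suc)
  ultimately have "int k * int n - Max A \<le> int m"
    by linarith
  then have m: "int m = int k * int n - Max A"
    using upper [OF mL] by simp
  \<comment> \<open>Boundedness also makes \<open>L\<close> finite, so that the maximum in
    \<open>zcl\<close> is meaningful.\<close>
  have "x \<le> m" if "x \<in> L" for x
    using upper [OF that] m by simp
  then have "Max L = m"
    using mL by (intro Max_eqI) (auto intro: finite_subset [of L "{..m}"])
  moreover have "zcl k ?P = Max L"
    unfolding zcl_def zcl_kernel_def L_def ..
  ultimately show ?thesis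
    using m unfolding A_def by simp
qed

end
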